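(* Let $J,K\ge 1$ be integers, $A=\{1,\dots,J\}$, $B=\{1,\dots,K\}$, and fix $\rho_{\max}>0$. Fix any $d>0$. There exists a random universal distortion $d$-semifaithful code $\tilde C_n=(\Phi_n,f_n,g_n)$ (one for each block length $n$, not depending on $p$ or $\rho$) such that for every $(p,\rho)\in\mathcal S_d$, $$\mathbb E_c\big[\mathcal R_n(\tilde C_n,p,\rho)\big]\ \le\ \Big(\frac K2+1\Big)\frac{\ln n}{n}+o\Big(\frac{\ln n}{n}\Big)\qquad(n\to\infty),$$ where $\mathbb E_c[\cdot]$ denotes expectation with respect to the random code. (The convergence is pointwise: the $o(\cdot)$ term may depend on $p$ and $\rho$.)
   Context: $\mathcal P(A)$ is the set of probability distributions on $A$; for $p\in\mathcal P(A)$, $p^n$ is the $n$-fold product distribution on $A^n$. $\mathcal D$ is the set of all distortion measures $\rho:A\times B\to[0,\infty)$ satisfying the standing assumption $\max_{j\in A}\min_{k\in B}\rho(j,k)=0$, and $\mathcal D^{\rho_{\max}}\subset\mathcal D$ is the subset of those with $\rho(j,k)\le\rho_{\max}$ for all $j,k$. The $n$-fold extension is $\rho_n(x^n,y^n)=\frac1n\sum_{i=1}^n\rho(x_i,y_i)$. Information quantities are in nats. Rate-distortion function: $R(p,d,\rho)=\min_{W}I(p,W)$, the minimum over conditional distributions $W=W(k|j)$ from $A$ to $B$ with $\sum_{j,k}p(j)W(k|j)\rho(j,k)\le d$, where $I(p,W)$ is the mutual information of $(X,Y)$ with joint law $p(j)W(k|j)$. $W^*_{B|A}$ denotes a minimizer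 (not necessarily unique) and $Q^{p,d,\rho}(k)=\sum_{j}p(j)W^*_{B|A}(k|j)$ the corresponding optimal output distribution on $B$. $\mathcal S_d\subset\mathcal P(A)\times\mathcal D^{\rho_{\max}}$ is the set of pairs $(p,\rho)$ such that: (1) $p(j)>0$ for all $j\in A$; (2) $Q^{p,d,\rho}$ is unique; (3) $Q^{p,d,\rho}(k)>0$ for all $k\in B$; (4) $0<d<\min_{k\in B}\sum_{j\in A}p(j)\rho(j,k)$. Universal distortion $d$-semifaithful code (order $n$): a triple $(\phi_n,f_n,g_n)$ with $\phi_n:A^n\times\mathcal D\to B_{\phi_n}$, $f_n:B_{\phi_n}\to\mathcal B^*$, $g_n:\mathcal B^*\to B_{\phi_n}$, where $B_{\phi_n}\subset B^n$ is the codebook, $\mathcal B^*$ is a set of binary strings, $(f_n,g_n)$ is a prefix-free (lossless) binary encoder/decoder pair (the strings $f_n(y^n)$ form a prefix-free set and $g_n(f_n(y^n))=y^n$ for all $y^n\in B_{\phi_n}$), and $\rho_n(x^n,\phi_n(x^n,\rho))\le d$ for all $x^n\in A^n$ and all input $\rho$. A random code is a random choice of such a triple, made independently of the source; the randomness (e.g. a random codebook) is shared by encoder and decoder. $l(b)$ denotes the length of a binary string $b$. Rate redundancy: for (a realization of) the code and $X^n\sim p^n$, $$\mathcal R_n(\tilde C_n,p,\rho)=\frac1n\mathbb E\big[l(f_n(\Phi_n(X^n,\rho)))\ln 2\big]-R(p,d,\rho),$$ the expectation here being over $X^n$. *)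

theory Defs
  imports "HOL-Probability.Probability" "HOL-Library.Landau_Symbols" "HOL-Library.Sublist"
begin

text \<open>
  The source alphabet \<open>A\<close> and the reproduction alphabet \<open>B\<close> are finite types \<open>'a\<close>, \<open>'b\<close>
  (necessarily nonempty), so \<open>J = CARD('a)\<close> and \<open>K = CARD('b)\<close>. Distributions on them are pmfs,
  and the \<open>n\<close>-fold product of \<open>p\<close> is \<^term>\<open>replicate_pmf n p\<close>, on lists of length \<open>n\<close>.
\<close>

section \<open>Distortion measures\<close>

type_synonym ('a, 'b) distortion = "'a \<Rightarrow> 'b \<Rightarrow> real"

definition distortions :: "('a::finite, 'b::finite) distortion set" where
  "distortions = {\<rho>. (\<forall>j k. 0 \<le> \<rho> j k) \<and> (MAX j. MIN k. \<rho> j k) = 0}"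

definition bounded_distortions :: "real \<Rightarrow> ('a::finite, 'b::finite) distortion set" where
  "bounded_distortions rho_max = {\<rho> \<in> distortions. \<forall>j k. \<rho> j k \<le> rho_max}"

definition block_distortion ::
    "nat \<Rightarrow> ('a, 'b) distortion \<Rightarrow> 'a list \<Rightarrow> 'b list \<Rightarrow> real" where
  "block_distortion n \<rho> x y = (\<Sum>i<n. \<rho> (x ! i) (y ! i)) / real n"

section \<open>Rate-distortion function\<close>

definition joint_pmf :: "'a pmf \<Rightarrow> ('a \<Rightarrow> 'b pmf) \<Rightarrow> ('a \<times> 'b) pmf" where
  "joint_pmf p W = bind_pmf p (\<lambda>j. map_pmf (Pair j) (W j))"

definition mutual_info :: "'a pmf \<Rightarrow> ('a \<Rightarrow> 'b pmf) \<Rightarrow> real" where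
  "mutual_info p W =
     prob_space.mutual_information (measure_pmf (joint_pmf p W)) (exp 1)
       (count_space UNIV) (count_space UNIV) fst snd"

definition feasible_channels ::
    "'a::finite pmf \<Rightarrow> real \<Rightarrow> ('a, 'b::finite) distortion \<Rightarrow> ('a \<Rightarrow> 'b pmf) set" where
  "feasible_channels p d \<rho> =
     {W. (\<Sum>j\<in>UNIV. \<Sum>k\<in>UNIV. pmf p j * pmf (W j) k * \<rho> j k) \<le> d}"

text \<open>
  The infimum is a minimum whenever the set of feasible channels is nonempty: this set is compact
  and \<^const>\<open>mutual_info\<close> is continuous in the channel.
\<close>

definition rate_distortion ::
    "'a::finite pmf \<Rightarrow> real \<Rightarrow> ('a, 'b::finite) distortion \<Rightarrow> real" where
  "rate_distortion p d \<rho> = (INF W\<in>feasible_channels p d \<rho>. mutual_info p W)"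

definition optimal_outputs ::
    "'a::finite pmf \<Rightarrow> real \<Rightarrow> ('a, 'b::finite) distortion \<Rightarrow> 'b pmf set" where
  "optimal_outputs p d \<rho> =
     {bind_pmf p W |W. is_arg_min (mutual_info p) (\<lambda>W. W \<in> feasible_channels p d \<rho>) W}"

definition regular_pairs ::
    "real \<Rightarrow> real \<Rightarrow> ('a::finite pmf \<times> ('a, 'b::finite) distortion) set" where
  "regular_pairs rho_max d =
     {(p, \<rho>). \<rho> \<in> bounded_distortions rho_max \<and>
        (\<forall>j. pmf p j > 0) \<and>
        (\<exists>!Q. Q \<in> optimal_outputs p d \<rho>) \<and>
        (\<forall>Q\<in>optimal_outputs p d \<rho>. \<forall>k. pmf Q k > 0) \<and>
        0 < d \<and> d < (MIN k. \<Sum>j\<in>UNIV. pmf p j * \<rho> j k)}"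

section \<open>Universal semifaithful codes\<close>

definition words :: "nat \<Rightarrow> 'c list set" where
  "words n = {w. length w = n}"

definition prefix_free :: "'c list set \<Rightarrow> bool" where
  "prefix_free S \<longleftrightarrow> (\<forall>s\<in>S. \<forall>t\<in>S. prefix s t \<longrightarrow> s = t)"

text \<open>
  The triple \<open>(\<phi>, f, g)\<close> together with the codebook on which \<open>f\<close> is defined. The functions are total;
  the values of \<open>quantize\<close>, \<open>encode\<close>, \<open>decode\<close> outside words of length \<open>n\<close> and members of
  \<^const>\<open>distortions\<close>, outside the codebook, and outside the set of codeword strings, respectively,
  are irrelevant.
\<close>

record ('a, 'b) code_triple =
  codebook :: "'b list set"
  quantize :: "'a list \<Rightarrow> ('a, 'b) distortion \<Rightarrow> 'b list"
  encode :: "'b list \<Rightarrow> bool list"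
  decode :: "bool list \<Rightarrow> 'b list"

definition semifaithful_codes :: "nat \<Rightarrow> real \<Rightarrow> ('a::finite, 'b::finite) code_triple set" where
  "semifaithful_codes n d = {c.
     codebook c \<subseteq> words n \<and>
     (\<forall>x\<in>words n. \<forall>\<rho>\<in>distortions. quantize c x \<rho> \<in> codebook c) \<and>
     prefix_free (encode c ` codebook c) \<and>
     (\<forall>y\<in>codebook c. decode c (encode c y) = y) \<and>
     (\<forall>x\<in>words n. \<forall>\<rho>\<in>distortions. block_distortion n \<rho> x (quantize c x \<rho>) \<le> d)}"

text \<open>
  A random code is a probability distribution on the set of codes. The \<open>\<sigma>\<close>-algebra is generated by
  the individual values of the components of a code (each ranging over a countable set); in
  particular the length of the transmitted string is measurable for every input \<open>(x, \<rho>)\<close>.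
\<close>

definition code_space :: "nat \<Rightarrow> real \<Rightarrow> ('a::finite, 'b::finite) code_triple measure" where
  "code_space n d = sigma (semifaithful_codes n d)
     ({{c \<in> semifaithful_codes n d. y \<in> codebook c} |y. y \<in> words n} \<union>
      {{c \<in> semifaithful_codes n d. quantize c x \<rho> = y} |x \<rho> y.
         x \<in> words n \<and> \<rho> \<in> distortions \<and> y \<in> words n} \<union>
      {{c \<in> semifaithful_codes n d. y \<in> codebook c \<and> encode c y = s} |y s. y \<in> words n} \<union>
      {{c \<in> semifaithful_codes n d. s \<in> encode c ` codebook c \<and> decode c s = y} |s y.
         y \<in> words n})"

definition random_semifaithful_code ::
    "nat \<Rightarrow> real \<Rightarrow> ('a::finite, 'b::finite) code_triple measure \<Rightarrow> bool" where
  "random_semifaithful_code n d C \<longleftrightarrow> prob_space C \<and> sets C = sets (code_space n d)"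

definition rate_redundancy ::
    "nat \<Rightarrow> real \<Rightarrow> ('a::finite, 'b::finite) code_triple \<Rightarrow> 'a pmf \<Rightarrow>
     ('a, 'b) distortion \<Rightarrow> real" where
  "rate_redundancy n d c p \<rho> =
     1 / real n * measure_pmf.expectation (replicate_pmf n p)
       (\<lambda>x. real (length (encode c (quantize c x \<rho>))) * ln 2) - rate_distortion p d \<rho>"

end

theory Submission
  imports Defs "HOL-Real_Asymp.Real_Asymp" "HOL-Library.Discrete_Functions"
begin

text \<open>
  The codebook is a list of words drawn independently from a mixture of the product distributions
  \<open>Q\<^sup>n\<close>, where \<open>Q\<close> ranges over a grid of mesh \<open>1/\<surd>n\<close> with \<open>O(n\<^bsup>(K-1)/2\<^esup>)\<close> points, followed by all
  words of length \<open>n\<close>. A source word \<open>x\<close> is represented by the index of the first word in the list within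
  distortion \<open>d\<close>, which costs \<open>-ln q(x) + ln n + O(1)\<close> nats on average, \<open>q(x)\<close> being the mixture
  probability of the distortion ball around \<open>x\<close>.

  For a regular pair the optimal channel has the form \<open>W(k|j) = Q(k) exp(c\<^sub>j - \<lambda> \<rho>(j,k))\<close>. Tilting \<open>Q\<close>
  in this way turns the probability of the ball into the probability that a sum of independent terms
  falls into a window of constant size near its mean, which costs \<open>(ln n)/2\<close>. Replacing \<open>Q\<close> by the nearest
  point of the grid changes the exponent only by \<open>O(1)\<close>, because the optimality of \<open>Q\<close> removes the
  first-order term. The total is \<open>(K-1)/2 + 1/2 + 1 = K/2 + 1\<close> times \<open>ln n\<close>.
\<close>

section \<open>The optimal test channel\<close>

text \<open>The mesh is set by the second-order error: moving \<open>Q\<close> by 1/sqrt n costs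
  O(1/n) per letter on average, O(1) in all, while each of the K - 1 free coordinates takes about
  sqrt n values. The last \<open>ln n\<close> pays for prefix freeness: the index has O(n) binary
  digits, and their number is announced in a field of log2 n + O(1) digits. Appending all words
  makes the constraint satisfiable for every distortion measure, whatever was drawn.

  The obstacle is uniformity. The grid point varies with \<open>n\<close> and misses the distortion
  level by O(1/sqrt n), and the source word is random. The lower bound on the ball therefore needs
  constants valid for all nearby \<open>Q\<close> and for all words with enough copies of one
  letter, and must allow a mean off the threshold: it carries the exponent (sum - d n)^2 / n, whose
  expectation under \<open>p\<close> is O(1). A limit theorem for one fixed law would not give this;
  an explicit binomial estimate does. It requires one row of the distortion matrix with two distinct
  entries, which a regular pair supplies.\<close>

lemma log_ratio_ge:
  fixes y m :: real assumes "0 \<le> y" "0 < m" shows "y - m \<le> y * ln (y / m)"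
proof (cases "y = 0")
  case True then show ?thesis using assms by simp
next
  case False
  then have "ln (m / y) \<le> m / y - 1" using assms by (intro ln_le_minus_one) auto
  then have "y * ln (m / y) \<le> y * (m / y - 1)" using assms by (intro mult_left_mono) auto
  also have "\<dots> = m - y" using False by (simp add: field_simps)
  finally show ?thesis using False assms by (simp add: ln_div algebra_simps)
qed

lemma mutual_info_eq:
  fixes p :: "'a::finite pmf" and W :: "'a \<Rightarrow> 'b::finite pmf"
  shows "mutual_info p W =
    (\<Sum>j\<in>UNIV. \<Sum>k\<in>UNIV. pmf p j * pmf (W j) k * ln (pmf (W j) k / pmf (bind_pmf p W) k))"
proof -
  let ?M = "joint_pmf p W"
  interpret information_space "measure_pmf ?M" "exp 1"
    by unfold_locales auto
  have pj: "pmf ?M (j, k) = pmf p j * pmf (W j) k" for j k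
  proof -
    have *: "pmf (map_pmf (Pair i) (W i)) (j, k) = (if i = j then pmf (W j) k else 0)" for i
    proof -
      have "Pair i -` {(j, k)} = (if i = j then {k} else {})" by auto
      then show ?thesis by (auto simp: pmf_map pmf.rep_eq)
    qed
    have "pmf ?M (j, k) = (\<Sum>i\<in>UNIV. pmf p i * (if i = j then pmf (W j) k else 0))"
      unfolding joint_pmf_def pmf_bind * by (subst integral_measure_pmf[of UNIV]) (auto simp: )
    then show ?thesis by (simp add: if_distrib sum.delta cong: if_cong)
  qed
  have f: "map_pmf fst ?M = p"
    by (simp add: joint_pmf_def map_bind_pmf map_pmf_comp bind_return_pmf')
  have s: "map_pmf snd ?M = bind_pmf p W"
    by (simp add: joint_pmf_def map_bind_pmf map_pmf_comp)
  have pf: "pmf p x = measure ?M (fst -` {x})" for x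
    by (metis f pmf_map)
  have ps: "pmf (bind_pmf p W) x = measure ?M (snd -` {x})" for x
    by (metis s pmf_map)
  have sd1: "simple_distributed ?M fst (pmf p)"
    by (rule measure_pmf.simple_distributedI)
      (auto simp: simple_function_def pf vimage_def intro!: arg_cong2[where f=measure])
  have sd2: "simple_distributed ?M snd (pmf (bind_pmf p W))"
    by (rule measure_pmf.simple_distributedI)
      (auto simp: simple_function_def ps vimage_def intro!: arg_cong2[where f=measure])
  have sd3: "simple_distributed ?M (\<lambda>x. (fst x, snd x)) (pmf ?M)"
    by (rule measure_pmf.simple_distributedI)
      (auto simp: simple_function_def pmf.rep_eq vimage_def intro!: arg_cong2[where f=measure])
  have "mutual_info p W = (\<Sum>(x, y)\<in>(\<lambda>x. (fst x, snd x)) ` space ?M. pmf ?M (x, y) * log (exp 1) (pmf ?M (x, y) / (pmf p x * pmf (bind_pmf p W) y)))"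
    using mutual_information_simple_distributed[OF sd1 sd2 sd3]
    by (simp add: mutual_info_def)
  also have "\<dots> = (\<Sum>(j, k)\<in>UNIV \<times> UNIV. pmf p j * pmf (W j) k * ln (pmf (W j) k / pmf (bind_pmf p W) k))"
    by (intro sum.cong) (auto simp: pj log_def)
  finally show ?thesis by (simp only: sum.cartesian_product)
qed

text \<open>The difference of the two sides is the divergence of the output law from
  \<open>q\<close>. With \<open>q\<close> frozen at the optimal output, the optimal channel
  therefore minimises a sum of convex functions of single entries, which is easier to vary than
  mutual information.\<close>

lemma mutual_info_le_cross:
  fixes p :: "'a::finite pmf" and W :: "'a \<Rightarrow> 'b::finite pmf"
  assumes q: "\<And>k. 0 < q k" "(\<Sum>k\<in>UNIV. q k) = 1"
  shows "mutual_info p W \<le> (\<Sum>j\<in>UNIV. \<Sum>k\<in>UNIV. pmf p j * pmf (W j) k * ln (pmf (W j) k / q k))"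
proof -
  let ?r = "pmf (bind_pmf p W)"
  have r: "?r k = (\<Sum>j\<in>UNIV. pmf p j * pmf (W j) k)" for k
    unfolding pmf_bind by (subst integral_measure_pmf[of UNIV]) auto
  have e: "pmf p j * pmf (W j) k * ln (pmf (W j) k / q k)
     = pmf p j * pmf (W j) k * ln (pmf (W j) k / ?r k) + pmf p j * pmf (W j) k * ln (?r k / q k)" for j k
  proof (cases "pmf p j * pmf (W j) k = 0")
    case False
    then have pos: "pmf p j > 0" "pmf (W j) k > 0" by (auto simp: less_le)
    have "0 < pmf p j * pmf (W j) k" using pos by simp
    also have "\<dots> \<le> ?r k" unfolding r by (rule member_le_sum) auto
    finally have "?r k > 0" .
    then show ?thesis using pos q(1)[of k] by (simp add: ln_div algebra_simps)
  qed auto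
  have "0 = (\<Sum>k\<in>UNIV. ?r k - q k)" by (simp add: sum_subtractf q(2) sum_pmf_eq_1)
  also have "\<dots> \<le> (\<Sum>k\<in>UNIV. ?r k * ln (?r k / q k))"
    by (intro sum_mono log_ratio_ge q) auto
  also have "\<dots> = (\<Sum>k\<in>UNIV. \<Sum>j\<in>UNIV. pmf p j * pmf (W j) k * ln (?r k / q k))"
    by (simp add: r sum_distrib_right)
  also have "\<dots> = (\<Sum>j\<in>UNIV. \<Sum>k\<in>UNIV. pmf p j * pmf (W j) k * ln (?r k / q k))" by (rule sum.swap)
  finally show ?thesis unfolding e sum.distrib mutual_info_eq by linarith
qed

text \<open>Channels as real matrices, which can be perturbed entry by entry;
  \<open>stochastic_channel\<close> leads back to pmfs.\<close>

definition stochastic :: "('a \<Rightarrow> 'b::finite \<Rightarrow> real) \<Rightarrow> bool" where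
  "stochastic w \<longleftrightarrow> (\<forall>j k. 0 \<le> w j k) \<and> (\<forall>j. (\<Sum>k\<in>UNIV. w j k) = 1)"

lemma stochastic_channel:
  assumes "stochastic w" obtains W :: "'a \<Rightarrow> 'b::finite pmf" where "\<And>j k. pmf (W j) k = w j k"
proof
  fix j k
  show "pmf ((\<lambda>j. embed_pmf (w j)) j) k = w j k"
    using assms
    by (subst pmf_embed_pmf) (auto simp: stochastic_def nn_integral_count_space_finite)
qed

text \<open>Effect on a linear functional of moving mass \<open>c\<close> from \<open>l\<close> to
  \<open>k\<close>, the elementary direction of the variation arguments below.\<close>

lemma sum_of_bool_diff:
  fixes f :: "'b::finite \<Rightarrow> real"
  shows "(\<Sum>m\<in>UNIV. c * (of_bool (m = k) - of_bool (m = l)) * f m) = c * (f k - f l)"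
proof -
  have "c * (of_bool (m = k) - of_bool (m = l)) * f m
      = (if m = k then c * f k else 0) - (if m = l then c * f l else 0)" for m
    by auto
  then show ?thesis by (simp add: sum_subtractf right_diff_distrib)
qed

text \<open>\<open>optimal\<close> uses the same \<open>q\<close> in the cost of every
  \<open>v\<close>, although the output of \<open>v\<close> may differ;
  \<open>mutual_info_le_cross\<close> derives it from minimality of the mutual information.\<close>

locale optimal_channel =
  fixes p :: "'a::finite \<Rightarrow> real" and q :: "'b::finite \<Rightarrow> real" and w :: "'a \<Rightarrow> 'b \<Rightarrow> real"
    and \<rho> :: "('a, 'b) distortion" and d :: real
  assumes p_pos: "\<And>j. 0 < p j" and q_pos: "\<And>k. 0 < q k"
    and q_sum: "(\<Sum>k\<in>UNIV. q k) = 1"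
    and output_law: "\<And>k. (\<Sum>j\<in>UNIV. p j * w j k) = q k"
    and stoch: "stochastic w"
    and feasible: "(\<Sum>j\<in>UNIV. \<Sum>k\<in>UNIV. p j * w j k * \<rho> j k) \<le> d"
    and optimal: "\<And>v. stochastic v \<Longrightarrow> (\<Sum>j\<in>UNIV. \<Sum>k\<in>UNIV. p j * v j k * \<rho> j k) \<le> d \<Longrightarrow>
      (\<Sum>j\<in>UNIV. \<Sum>k\<in>UNIV. p j * w j k * ln (w j k / q k)) \<le> (\<Sum>j\<in>UNIV. \<Sum>k\<in>UNIV. p j * v j k * ln (v j k / q k))"
    and rho_nonneg: "\<And>j k. 0 \<le> \<rho> j k"
    and rho_zero: "\<And>j. \<exists>k. \<rho> j k = 0"
    and d_pos: "0 < d" and d_less: "\<And>k. d < (\<Sum>j\<in>UNIV. p j * \<rho> j k)"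
begin

definition cost :: "('a \<Rightarrow> 'b \<Rightarrow> real) \<Rightarrow> real" where "cost v = (\<Sum>j\<in>UNIV. \<Sum>k\<in>UNIV. p j * v j k * ln (v j k / q k))"
definition mean_dist :: "('a \<Rightarrow> 'b \<Rightarrow> real) \<Rightarrow> real" where "mean_dist v = (\<Sum>j\<in>UNIV. \<Sum>k\<in>UNIV. p j * v j k * \<rho> j k)"

lemma w_nonneg: "0 \<le> w j k" and w_sum: "(\<Sum>k\<in>UNIV. w j k) = 1"
  using stoch by (auto simp: stochastic_def)

text \<open>A channel that ignores its input violates the constraint. This supplies a full-support
  competitor in \<open>w_pos\<close> and shows in \<open>exponential_form\<close> that the
  constraint is active.\<close>

lemma mean_dist_output_gt: "d < mean_dist (\<lambda>j. q)"
proof -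
  have "d = (\<Sum>k\<in>UNIV. q k * d)" by (simp add: sum_distrib_right[symmetric] q_sum)
  also have "\<dots> < (\<Sum>k\<in>UNIV. q k * (\<Sum>j\<in>UNIV. p j * \<rho> j k))"
    by (intro sum_strict_mono mult_strict_left_mono d_less q_pos) auto
  also have "\<dots> = mean_dist (\<lambda>j. q)" unfolding mean_dist_def
    by (subst sum.swap) (simp add: sum_distrib_left algebra_simps)
  finally show ?thesis .
qed

lemma mean_dist_linear: "mean_dist (\<lambda>j k. a * u j k + b * v j k) = a * mean_dist u + b * mean_dist v"
  by (simp add: mean_dist_def sum.distrib sum_distrib_left algebra_simps)

text \<open>The derivative of y ln y is minus infinity at 0: if an entry vanished, a short step t
  towards a feasible channel with full support would lower the cost by the order of t |ln t|, which
  beats every change linear in t.\<close>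

lemma w_pos: "0 < w j k"
proof (rule ccontr)
  assume "\<not> 0 < w j k" then have w0: "w j k = 0" using w_nonneg[of j k] by simp
  define z where "z j = (SOME k. \<rho> j k = 0)" for j
  have z: "\<rho> j (z j) = 0" for j using someI_ex[OF rho_zero[of j]] by (simp add: z_def)
  define u :: "'a \<Rightarrow> 'b \<Rightarrow> real" where "u j k = of_bool (k = z j)" for j k
  have du: "mean_dist u = 0" unfolding mean_dist_def u_def by (auto simp: z of_bool_def intro!: sum.neutral)
  have us: "(\<Sum>k\<in>UNIV. u j k) = 1" for j by (simp add: u_def of_bool_def)
  \<comment> \<open>Mixing the zero-distortion map \<open>u\<close> with the constant rows
    \<open>q\<close> in this proportion gives full support and mean distortion exactly
    \<open>d\<close>.\<close>
  define s where "s = d / mean_dist (\<lambda>j. q)"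
  have s: "0 < s" "s < 1" using d_pos mean_dist_output_gt by (auto simp: s_def)
  define v where "v j k = (1 - s) * u j k + s * q k" for j k
  have dv: "mean_dist v = d" using mean_dist_linear[of "1-s" u s "\<lambda>j. q"] du mean_dist_output_gt d_pos
    by (simp add: v_def[abs_def] s_def)
  have vpos: "0 < v j k" for j k unfolding v_def u_def using s q_pos[of k] by (intro add_nonneg_pos) auto
  have vsum: "(\<Sum>k\<in>UNIV. v j k) = 1" for j
    unfolding v_def sum.distrib by (simp add: sum_distrib_left[symmetric] us q_sum)
  let ?c = "p j * v j k"
  have c: "0 < ?c" using p_pos vpos by simp
  have main: "0 \<le> (cost v - cost w) + ln t * ?c" if t: "0 < t" "t < 1" for t
  proof -
    define y where "y j k = (1 - t) * w j k + t * v j k" for j k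
    have "stochastic y" using t vpos w_nonneg
      by (auto simp: stochastic_def y_def sum.distrib sum_distrib_left[symmetric] w_sum vsum less_imp_le)
    moreover have "mean_dist y = (1-t) * mean_dist w + t * mean_dist v" unfolding y_def[abs_def] by (rule mean_dist_linear)
    then have "mean_dist y \<le> (1-t) * d + t * d" using t feasible dv by (simp add: mean_dist_def[of w] mult_left_mono)
    then have "mean_dist y \<le> d" by (simp add: algebra_simps)
    ultimately have "cost w \<le> cost y" unfolding cost_def mean_dist_def by (rule optimal)
    also have "cost y \<le> (\<Sum>i\<in>UNIV. \<Sum>l\<in>UNIV. (1-t) * (p i * w i l * ln (w i l / q l)) + t * (p i * v i l * ln (v i l / q l))
        + (if l = k then if i = j then t * ln t * ?c else 0 else 0))"
      unfolding cost_def
    proof (intro sum_mono)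
      fix i l
      have ypos: "0 < y i l" unfolding y_def using t vpos[of i l] w_nonneg[of i l] by (intro add_nonneg_pos) auto
      have conv: "y i l * ln (y i l / q l) \<le> (1-t) * (w i l * ln (w i l / q l)) + t * (v i l * ln (v i l / q l))"
      proof -
        have e: "x * ln (x / q l) = x * ln (y i l / q l) + x * ln (x / y i l)" if "0 \<le> x" for x
          using that ypos q_pos[of l] by (cases "x = 0") (auto simp: ln_div algebra_simps)
        have "(1-t) * (w i l - y i l) + t * (v i l - y i l) \<le> (1-t) * (w i l * ln (w i l / y i l)) + t * (v i l * ln (v i l / y i l))"
          using t by (intro add_mono mult_left_mono log_ratio_ge w_nonneg less_imp_le[OF vpos] ypos) auto
        moreover have "(1-t) * (w i l - y i l) + t * (v i l - y i l) = 0" by (simp add: y_def algebra_simps)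
        ultimately have "0 \<le> (1-t) * (w i l * ln (w i l / y i l)) + t * (v i l * ln (v i l / y i l))" by simp
        moreover have "(1-t) * (w i l * ln (w i l / q l)) + t * (v i l * ln (v i l / q l))
          = y i l * ln (y i l / q l) + ((1-t) * (w i l * ln (w i l / y i l)) + t * (v i l * ln (v i l / y i l)))"
          by (subst e[OF w_nonneg], subst e[OF less_imp_le[OF vpos]]) (simp add: y_def[of i l] ring_distribs)
        ultimately show ?thesis by linarith
      qed
      show "p i * y i l * ln (y i l / q l) \<le> (1-t) * (p i * w i l * ln (w i l / q l)) + t * (p i * v i l * ln (v i l / q l))
        + (if l = k then if i = j then t * ln t * ?c else 0 else 0)"
      proof (cases "i = j \<and> l = k")
        case True
        then show ?thesis using w0 t vpos[of j k] q_pos[of k]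
          by (simp add: y_def ln_mult ln_div algebra_simps)
      next
        case False
        then have "(if l = k then if i = j then t * ln t * ?c else 0 else 0) = 0" by auto
        with mult_left_mono[OF conv less_imp_le[OF p_pos[of i]]] show ?thesis by (simp add: algebra_simps)
      qed
    qed
    also have "\<dots> = (1-t) * cost w + t * cost v + t * ln t * ?c"
      by (simp add: sum.distrib cost_def sum_distrib_left)
    finally have "0 \<le> t * ((cost v - cost w) + ln t * ?c)" by (simp add: algebra_simps)
    then show ?thesis using t by (simp add: zero_le_mult_iff)
  qed
  \<comment> \<open>Chosen so that \<open>t = exp (- b)\<close> turns the logarithmic term into
    -(|cost v - cost w| + 1).\<close>
  define b where "b = (\<bar>cost v - cost w\<bar> + 1) / ?c"
  have b: "b > 0" using c by (simp add: b_def)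
  have "0 \<le> (cost v - cost w) + ln (exp (- b)) * ?c" using b by (intro main) auto
  also have "ln (exp (- b)) * ?c = - (\<bar>cost v - cost w\<bar> + 1)" using less_imp_neq[OF c] by (simp add: b_def)
  finally show False by linarith
qed

text \<open>Derivative of \<open>cost\<close> at \<open>w\<close> along \<open>v\<close>.
  Differentiating the logarithm would add the sum of all \<open>p j * v j k\<close>, which vanishes
  for directions with zero row sums.\<close>

definition slope :: "('a \<Rightarrow> 'b \<Rightarrow> real) \<Rightarrow> real" where "slope v = (\<Sum>j\<in>UNIV. \<Sum>k\<in>UNIV. p j * v j k * ln (w j k / q k))"

lemma slope_linear: "slope (\<lambda>j k. a * u j k + b * v j k) = a * slope u + b * slope v"
  by (simp add: slope_def sum.distrib sum_distrib_left algebra_simps)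

lemma slope_nonneg:
  assumes v: "\<And>j. (\<Sum>k\<in>UNIV. v j k) = 0" and t0: "t0 > 0"
    and D: "\<And>t. 0 < t \<Longrightarrow> t < t0 \<Longrightarrow> mean_dist w + t * mean_dist v \<le> d"
  shows "0 \<le> slope v"
proof -
  define C where "C = (\<Sum>j\<in>UNIV. \<Sum>k\<in>UNIV. p j * (v j k)\<^sup>2 / w j k)"
  have C: "0 \<le> C" unfolding C_def by (intro sum_nonneg divide_nonneg_pos mult_nonneg_nonneg w_pos) (auto simp: less_imp_le p_pos)
  \<comment> \<open>Below this bound \<open>w + t v\<close> stays positive; the 1 guards against
    division by 0 where \<open>v\<close> vanishes.\<close>
  define m where "m = Min (insert t0 (range (\<lambda>(j,k). w j k / (\<bar>v j k\<bar> + 1))))"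
  have m: "0 < m" unfolding m_def by (subst Min_gr_iff) (auto simp: t0 w_pos intro!: divide_pos_pos add_nonneg_pos)
  have mt: "m \<le> t0" unfolding m_def by (intro Min_le) auto
  have mw: "m \<le> w j k / (\<bar>v j k\<bar> + 1)" for j k unfolding m_def
    by (rule Min_le) (auto intro!: image_eqI[where x="(j,k)"])
  have main: "0 \<le> slope v + t * C" if t: "0 < t" "t < m" for t
  proof -
    define y where "y j k = w j k + t * v j k" for j k
    have ypos: "0 < y j k" for j k
    proof -
      have "\<bar>t * v j k\<bar> \<le> t * (\<bar>v j k\<bar> + 1)" using t by (simp add: abs_mult)
      also have "\<dots> < m * (\<bar>v j k\<bar> + 1)" using t by (intro mult_strict_right_mono) auto
      also have "\<dots> \<le> w j k / (\<bar>v j k\<bar> + 1) * (\<bar>v j k\<bar> + 1)" by (intro mult_right_mono mw) auto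
      also have "\<dots> = w j k" by (simp add: field_simps)
      finally show ?thesis by (auto simp: y_def)
    qed
    have "stochastic y" using ypos
      by (auto simp: stochastic_def less_imp_le) (simp add: y_def sum.distrib sum_distrib_left[symmetric] w_sum v)
    moreover have "mean_dist y = mean_dist w + t * mean_dist v"
      using mean_dist_linear[of 1 w t v] by (simp add: y_def[abs_def])
    then have "mean_dist y \<le> d" using D[of t] t mt by simp
    ultimately have "cost w \<le> cost y" unfolding cost_def mean_dist_def by (rule optimal)
    also have "cost y \<le> (\<Sum>j\<in>UNIV. \<Sum>k\<in>UNIV. p j * w j k * ln (w j k / q k) + t * (p j * v j k * ln (w j k / q k))
        + t * (p j * v j k) + t\<^sup>2 * (p j * (v j k)\<^sup>2 / w j k))"
      unfolding cost_def
    proof (intro sum_mono)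
      fix j k
      have "y j k * ln (y j k / q k) = y j k * ln (w j k / q k) + y j k * ln (y j k / w j k)"
        using ypos[of j k] w_pos[of j k] q_pos[of k] by (simp add: ln_div algebra_simps)
      also have "y j k * ln (y j k / w j k) \<le> y j k * (y j k / w j k - 1)"
        using ypos[of j k] w_pos[of j k] by (intro mult_left_mono ln_le_minus_one) auto
      also have "y j k * (y j k / w j k - 1) = t * v j k + t\<^sup>2 * ((v j k)\<^sup>2 / w j k)"
        using w_pos[of j k] by (simp add: y_def field_simps power2_eq_square)
      finally have "y j k * ln (y j k / q k) \<le> y j k * ln (w j k / q k) + (t * v j k + t\<^sup>2 * ((v j k)\<^sup>2 / w j k))" by simp
      from mult_left_mono[OF this less_imp_le[OF p_pos[of j]]]
      show "p j * y j k * ln (y j k / q k) \<le> p j * w j k * ln (w j k / q k) + t * (p j * v j k * ln (w j k / q k))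
        + t * (p j * v j k) + t\<^sup>2 * (p j * (v j k)\<^sup>2 / w j k)"
        by (simp add: y_def algebra_simps)
    qed
    also have "\<dots> = cost w + t * slope v + t * (\<Sum>j\<in>UNIV. p j * (\<Sum>k\<in>UNIV. v j k)) + t\<^sup>2 * C"
      by (simp add: sum.distrib cost_def slope_def C_def sum_distrib_left)
    finally have "0 \<le> t * (slope v + t * C)" by (simp add: v algebra_simps power2_eq_square)
    then show ?thesis using t by (simp add: zero_le_mult_iff)
  qed
  show ?thesis
  proof (rule ccontr)
    assume "\<not> 0 \<le> slope v" then have neg: "slope v < 0" by simp
    define t where "t = min (m/2) (- slope v / (2 * (C+1)))"
    have t: "0 < t" "t < m" using m neg C by (auto simp: t_def min_def field_simps)
    have "t * C \<le> t * (C + 1)" using t by simp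
    also have "\<dots> \<le> (- slope v / (2 * (C+1))) * (C + 1)" using C by (intro mult_right_mono) (auto simp: t_def)
    also have "\<dots> = - slope v / 2" using C by (simp add: field_simps)
    finally show False using main[OF t] neg by linarith
  qed
qed

text \<open>Two distinct distortions within one row give \<open>multiplier\<close> a direction that
  strictly lowers the distortion, and later provide the two values of a fair coin.\<close>

lemma exists_nonconstant_row: "\<exists>j k l. \<rho> j k < \<rho> j l"
proof (rule ccontr)
  assume *: "\<not> ?thesis"
  have "\<rho> j k = 0" for j k
  proof -
    obtain l where "\<rho> j l = 0" using rho_zero by blast
    with * rho_nonneg[of j k] show ?thesis by (metis order_le_less)
  qed
  then show False using d_less[of undefined] d_pos by simp
qed

text \<open>The linear functional \<^const>\<open>slope\<close> is nonnegative on the half space of admissible directions, hence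
  a nonpositive multiple of \<^const>\<open>mean_dist\<close>.\<close>

lemma multiplier:
  obtains lam where "0 \<le> lam" "\<And>v. (\<And>j. (\<Sum>k\<in>UNIV. v j k) = 0) \<Longrightarrow> slope v = - lam * mean_dist v"
    "mean_dist w < d \<Longrightarrow> lam = 0"
proof (cases "mean_dist w < d")
  case True
  have "0 \<le> slope v" if v: "\<And>j. (\<Sum>k\<in>UNIV. v j k) = 0" for v
  proof (rule slope_nonneg[OF v, of "(d - mean_dist w) / (\<bar>mean_dist v\<bar> + 1)"])
    fix t assume t: "0 < t" "t < (d - mean_dist w) / (\<bar>mean_dist v\<bar> + 1)"
    have "t * mean_dist v \<le> t * (\<bar>mean_dist v\<bar> + 1)" using t by (intro mult_left_mono) auto
    also have "\<dots> \<le> d - mean_dist w" using t by (simp add: field_simps)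
    finally show "mean_dist w + t * mean_dist v \<le> d" by simp
  qed (use True in auto)
  note pos = this
  have "slope v = 0" if v: "\<And>j. (\<Sum>k\<in>UNIV. v j k) = 0" for v
  proof -
    have "0 \<le> slope (\<lambda>j k. (-1) * v j k + 0 * v j k)" using v by (intro pos) (simp add: sum_negf)
    with pos[of v, OF v] show ?thesis unfolding slope_linear by simp
  qed
  then show ?thesis using that[of 0] by simp
next
  case False
  then have eq: "mean_dist w = d" using feasible by (simp add: mean_dist_def)
  have pos: "0 \<le> slope v" if v: "\<And>j. (\<Sum>k\<in>UNIV. v j k) = 0" "mean_dist v \<le> 0" for v
    by (rule slope_nonneg[OF v(1), of 1]) (auto simp: eq v(2) mult_nonneg_nonpos)
  obtain j0 k0 l0 where r: "\<rho> j0 k0 < \<rho> j0 l0" using exists_nonconstant_row by blast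
  \<comment> \<open>Moving mass to the cheaper letter strictly lowers the distortion; the slope in
    this one direction determines the multiplier.\<close>
  define v1 where "v1 j k = (if j = j0 then of_bool (k = k0) - of_bool (k = l0) else (0::real))" for j k
  have v1: "(\<Sum>k\<in>UNIV. v1 j k) = 0" for j
    using sum_of_bool_diff[of 1 k0 l0 "\<lambda>_. 1"] by (cases "j = j0") (simp_all add: v1_def)
  have "mean_dist v1 = (\<Sum>k\<in>UNIV. p j0 * (of_bool (k = k0) - of_bool (k = l0)) * \<rho> j0 k)"
    unfolding mean_dist_def v1_def by (subst sum.remove[of _ j0]) (auto intro!: sum.neutral)
  also have "\<dots> = p j0 * (\<rho> j0 k0 - \<rho> j0 l0)"
    by (rule sum_of_bool_diff)
  finally have D1: "mean_dist v1 < 0" using r p_pos[of j0] by (simp add: mult_pos_neg)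
  define lam where "lam = slope v1 / (- mean_dist v1)"
  have "0 \<le> lam" unfolding lam_def using D1 pos[OF v1] by (intro divide_nonneg_pos) auto
  moreover have "slope v = - lam * mean_dist v" if v: "\<And>j. (\<Sum>k\<in>UNIV. v j k) = 0" for v
  proof -
    \<comment> \<open>With this coefficient the combination has mean distortion 0, so that it and
      its negative are both admissible and \<open>slope\<close> must vanish on it.\<close>
    let ?b = "- mean_dist v / mean_dist v1"
    have s: "(\<Sum>k\<in>UNIV. a * v j k + b * v1 j k) = 0" for a b j
      unfolding sum.distrib sum_distrib_left[symmetric] by (simp add: v v1)
    have "0 \<le> slope (\<lambda>j k. 1 * v j k + ?b * v1 j k)"
      by (intro pos s) (subst mean_dist_linear, use D1 in auto)
    moreover have "0 \<le> slope (\<lambda>j k. (-1) * v j k + (- ?b) * v1 j k)"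
      by (intro pos s) (subst mean_dist_linear, use D1 in auto)
    ultimately have "slope v + ?b * slope v1 = 0" unfolding slope_linear by linarith
    then show ?thesis using D1 by (simp add: lam_def field_simps)
  qed
  ultimately show ?thesis using that[of lam] False by blast
qed

text \<open>Moving mass between two letters of row \<open>j\<close> shows that
  \<open>ln (w j k / q k) + lam * \<rho> j k\<close> does not depend on \<open>k\<close>; this
  constant is \<open>c j\<close>. A slack constraint would force \<open>lam = 0\<close>, hence all
  rows equal to \<open>q\<close>, against \<open>mean_dist_output_gt\<close>.\<close>

lemma exponential_form:
  obtains lam c where "0 \<le> lam" "\<And>j k. w j k = q k * exp (c j - lam * \<rho> j k)"
    "(\<Sum>j\<in>UNIV. \<Sum>k\<in>UNIV. p j * w j k * \<rho> j k) = d"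
    "(\<Sum>j\<in>UNIV. \<Sum>k\<in>UNIV. p j * w j k * ln (w j k / q k)) = (\<Sum>j\<in>UNIV. p j * c j) - lam * d"
proof -
  obtain lam where lam: "0 \<le> lam" "\<And>v. (\<And>j. (\<Sum>k\<in>UNIV. v j k) = 0) \<Longrightarrow> slope v = - lam * mean_dist v"
    "mean_dist w < d \<Longrightarrow> lam = 0" using multiplier by metis
  let ?a = "\<lambda>j k. ln (w j k / q k)"
  define l :: 'b where "l = undefined"
  define c where "c j = ?a j l + lam * \<rho> j l" for j
  have a: "?a j k = c j - lam * \<rho> j k" for j k
  proof -
    define v where "v i m = (if i = j then of_bool (m = k) - of_bool (m = l) else (0::real))" for i m
    have v: "(\<Sum>m\<in>UNIV. v i m) = 0" for i
      using sum_of_bool_diff[of 1 k l "\<lambda>_. 1"] by (cases "i = j") (simp_all add: v_def)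
    have ev: "(\<Sum>i\<in>UNIV. \<Sum>m\<in>UNIV. p i * v i m * f i m) = p j * (f j k - f j l)" for f
    proof -
      have "(\<Sum>i\<in>UNIV. \<Sum>m\<in>UNIV. p i * v i m * f i m) = (\<Sum>m\<in>UNIV. p j * (of_bool (m = k) - of_bool (m = l)) * f j m)"
        unfolding v_def by (subst sum.remove[of _ j]) (auto intro!: sum.neutral)
      also have "\<dots> = p j * (f j k - f j l)"
        by (rule sum_of_bool_diff)
      finally show ?thesis .
    qed
    have "p j * (?a j k - ?a j l) = - lam * (p j * (\<rho> j k - \<rho> j l))"
      using lam(2)[of v, OF v] unfolding slope_def mean_dist_def ev .
    then have "p j * ((?a j k - ?a j l) + lam * (\<rho> j k - \<rho> j l)) = 0" by (simp add: algebra_simps)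
    with p_pos[of j] have "(?a j k - ?a j l) + lam * (\<rho> j k - \<rho> j l) = 0" by simp
    then show ?thesis by (simp add: c_def algebra_simps)
  qed
  have form: "w j k = q k * exp (c j - lam * \<rho> j k)" for j k
    using w_pos[of j k] q_pos[of k] by (simp add: a[symmetric] )
  have "\<not> mean_dist w < d"
  proof
    assume lt: "mean_dist w < d"
    with lam(3) have "w j k = q k * exp (c j)" for j k using form[of j k] by simp
    with w_sum have "w j k = q k" for j k
      using w_sum[of j] by (simp add: sum_distrib_right[symmetric] q_sum)
    then have "w = (\<lambda>j. q)" by auto
    with mean_dist_output_gt lt show False by simp
  qed
  with feasible have eq: "mean_dist w = d" by (simp add: mean_dist_def)
  have "slope w = (\<Sum>j\<in>UNIV. p j * c j) - lam * mean_dist w"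
  proof -
    have "slope w = (\<Sum>j\<in>UNIV. \<Sum>k\<in>UNIV. p j * c j * w j k - lam * (p j * w j k * \<rho> j k))"
      unfolding slope_def a by (intro sum.cong refl) (simp add: algebra_simps)
    also have "\<dots> = (\<Sum>j\<in>UNIV. p j * c j * (\<Sum>k\<in>UNIV. w j k)) - lam * mean_dist w"
      by (simp add: sum_subtractf mean_dist_def sum_distrib_left)
    finally show ?thesis by (simp add: w_sum)
  qed
  then show ?thesis using that[of lam c] lam(1) form eq by (simp add: slope_def mean_dist_def)
qed

end

section \<open>From regular pairs to the tilting identities\<close>

lemma distortions_zero:
  assumes "\<rho> \<in> distortions" shows "\<exists>k. \<rho> j k = 0"
proof -
  have "(MIN k. \<rho> j k) \<le> (MAX j. MIN k. \<rho> j k)" by (intro Max_ge) auto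
  with assms have "(MIN k. \<rho> j k) \<le> 0" by (simp add: distortions_def)
  moreover have "(MIN k. \<rho> j k) \<in> range (\<rho> j)" by (intro Min_in) auto
  ultimately obtain k where "\<rho> j k \<le> 0" by (metis rangeE)
  moreover have "0 \<le> \<rho> j k" using assms by (simp add: distortions_def)
  ultimately show ?thesis by (intro exI[of _ k]) simp
qed

text \<open>Collects what is needed of the optimum. The third conclusion is the normalisation of row
  \<open>j\<close>. The fourth is the output law divided by \<open>pmf Q k\<close>; it says that the
  average over \<open>p\<close> of the log partition sums has, at \<open>Q\<close>, the same partial
  derivative in every coordinate \<open>k\<close>.\<close>

lemma regular_pair_tilting:
  fixes p :: "'a::finite pmf" and \<rho> :: "('a, 'b::finite) distortion"
  assumes reg: "(p, \<rho>) \<in> regular_pairs rho_max d"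
  obtains Q :: "'b pmf" and lam c where
    "\<And>k. 0 < pmf Q k" "0 \<le> lam"
    "\<And>j. (\<Sum>k\<in>UNIV. pmf Q k * exp (- lam * \<rho> j k)) = exp (- c j)"
    "\<And>k. (\<Sum>j\<in>UNIV. pmf p j * exp (c j - lam * \<rho> j k)) = 1"
    "(\<Sum>j\<in>UNIV. pmf p j * (\<Sum>k\<in>UNIV. pmf Q k * exp (c j - lam * \<rho> j k) * \<rho> j k)) = d"
    "rate_distortion p d \<rho> = (\<Sum>j\<in>UNIV. pmf p j * c j) - lam * d"
    "\<exists>j k l. \<rho> j k < \<rho> j l"
proof -
  from reg obtain Q where Q: "Q \<in> optimal_outputs p d \<rho>" unfolding regular_pairs_def by auto
  then obtain W where QW: "Q = bind_pmf p W" and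
    arg: "is_arg_min (mutual_info p) (\<lambda>W. W \<in> feasible_channels p d \<rho>) W"
    unfolding optimal_outputs_def by auto
  have Qpos: "0 < pmf Q k" for k using reg Q unfolding regular_pairs_def by auto
  have D: "\<rho> \<in> distortions" and ppos: "\<And>j. pmf p j > 0" and d: "0 < d" "d < (MIN k. \<Sum>j\<in>UNIV. pmf p j * \<rho> j k)"
    using reg unfolding regular_pairs_def bounded_distortions_def by auto
  have rn: "0 \<le> \<rho> j k" for j k using D by (auto simp: distortions_def)
  have Qsum: "(\<Sum>k\<in>UNIV. pmf Q k) = 1" by (simp add: sum_pmf_eq_1)
  have mi: "mutual_info p W = (\<Sum>j\<in>UNIV. \<Sum>k\<in>UNIV. pmf p j * pmf (W j) k * ln (pmf (W j) k / pmf Q k))"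
    unfolding mutual_info_eq QW ..
  interpret optimal_channel "pmf p" "pmf Q" "\<lambda>j. pmf (W j)" \<rho> d
  proof unfold_locales
    fix k show "(\<Sum>j\<in>UNIV. pmf p j * pmf (W j) k) = pmf Q k"
      unfolding QW pmf_bind by (subst integral_measure_pmf[of UNIV]) auto
  next
    show "stochastic (\<lambda>j. pmf (W j))" by (simp add: stochastic_def sum_pmf_eq_1)
    show "(\<Sum>j\<in>UNIV. \<Sum>k\<in>UNIV. pmf p j * pmf (W j) k * \<rho> j k) \<le> d"
      using arg by (simp add: is_arg_min_def feasible_channels_def)
  next
    fix v :: "'a \<Rightarrow> 'b \<Rightarrow> real"
    assume v: "stochastic v" "(\<Sum>j\<in>UNIV. \<Sum>k\<in>UNIV. pmf p j * v j k * \<rho> j k) \<le> d"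
    obtain V :: "'a \<Rightarrow> 'b pmf" where V: "\<And>j k. pmf (V j) k = v j k" using stochastic_channel[OF v(1)] by metis
    have "V \<in> feasible_channels p d \<rho>" using v(2) by (simp add: feasible_channels_def V)
    then have "mutual_info p W \<le> mutual_info p V" using arg by (auto simp: is_arg_min_def not_less)
    also have "\<dots> \<le> (\<Sum>j\<in>UNIV. \<Sum>k\<in>UNIV. pmf p j * pmf (V j) k * ln (pmf (V j) k / pmf Q k))"
      by (rule mutual_info_le_cross[OF Qpos Qsum])
    finally show "(\<Sum>j\<in>UNIV. \<Sum>k\<in>UNIV. pmf p j * pmf (W j) k * ln (pmf (W j) k / pmf Q k))
       \<le> (\<Sum>j\<in>UNIV. \<Sum>k\<in>UNIV. pmf p j * v j k * ln (v j k / pmf Q k))" by (simp add: V mi)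
  next
    fix k
    have "(MIN k. \<Sum>j\<in>UNIV. pmf p j * \<rho> j k) \<le> (\<Sum>j\<in>UNIV. pmf p j * \<rho> j k)" by (intro Min_le) auto
    with d show "d < (\<Sum>j\<in>UNIV. pmf p j * \<rho> j k)" by simp
  qed (fact ppos Qpos Qsum rn distortions_zero[OF D] d(1))+
  obtain lam c where form: "0 \<le> lam" "\<And>j k. pmf (W j) k = pmf Q k * exp (c j - lam * \<rho> j k)"
    "(\<Sum>j\<in>UNIV. \<Sum>k\<in>UNIV. pmf p j * pmf (W j) k * \<rho> j k) = d"
    "(\<Sum>j\<in>UNIV. \<Sum>k\<in>UNIV. pmf p j * pmf (W j) k * ln (pmf (W j) k / pmf Q k)) = (\<Sum>j\<in>UNIV. pmf p j * c j) - lam * d"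
    by (rule exponential_form) (rule that)
  show ?thesis
  proof (rule that[OF Qpos form(1)])
    fix j
    have "1 = (\<Sum>k\<in>UNIV. exp (c j) * (pmf Q k * exp (- lam * \<rho> j k)))"
      using w_sum[of j] by (simp add: form(2) exp_diff exp_minus field_simps)
    then show "(\<Sum>k\<in>UNIV. pmf Q k * exp (- lam * \<rho> j k)) = exp (- c j)"
      unfolding sum_distrib_left[symmetric] by (simp add: exp_minus field_simps)
  next
    fix k
    have "pmf Q k * (\<Sum>j\<in>UNIV. pmf p j * exp (c j - lam * \<rho> j k)) = pmf Q k * 1"
      using output_law[of k] by (simp add: form(2) sum_distrib_left algebra_simps)
    then show "(\<Sum>j\<in>UNIV. pmf p j * exp (c j - lam * \<rho> j k)) = 1" using Qpos[of k] by simp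
  next
    show "(\<Sum>j\<in>UNIV. pmf p j * (\<Sum>k\<in>UNIV. pmf Q k * exp (c j - lam * \<rho> j k) * \<rho> j k)) = d"
      using form(3) by (simp add: form(2) sum_distrib_left algebra_simps)
  next
    have "rate_distortion p d \<rho> = mutual_info p W" unfolding rate_distortion_def
      using arg by (intro cInf_eq_minimum) (auto simp: is_arg_min_def not_less)
    then show "rate_distortion p d \<rho> = (\<Sum>j\<in>UNIV. pmf p j * c j) - lam * d" by (simp add: mi form(4))
  next
    show "\<exists>j k l. \<rho> j k < \<rho> j l" by (rule exists_nonconstant_row)
  qed
qed

section \<open>Binomial probabilities\<close>

text \<open>Successive central coefficients have ratio 2 (2h + 1) / (h + 1), while the bound grows
  by 4 sqrt (h / (h + 1)); the induction step is thus the mean inequality 2 sqrt (h (h + 1)) \<le>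
  2h + 1.\<close>

lemma central_binomial_ge:
  assumes "0 < h"
  shows "4 ^ h / (2 * sqrt (real h)) \<le> real ((2 * h) choose h)"
  using assms
proof (induction h rule: nat_induct_non_zero)
  case 1 show ?case by simp
next
  case (Suc h)
  let ?r = "real h"
  have h: "?r > 0" using Suc by simp
  have "Suc h * ((2 * Suc h) choose Suc h) = 2 * (2 * h + 1) * ((2 * h) choose h)"
  proof -
    have a: "Suc h * (Suc (Suc (2*h)) choose Suc h) = Suc (Suc (2*h)) * (Suc (2*h) choose h)"
      by (rule Suc_times_binomial)
    have b: "(Suc (2*h) choose h) = (Suc (2*h) choose Suc h)"
      by (subst binomial_symmetric) auto
    have c: "Suc h * (Suc (2*h) choose Suc h) = Suc (2*h) * ((2*h) choose h)" by (rule Suc_times_binomial)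
    have "Suc h * (Suc h * ((2 * Suc h) choose Suc h)) = Suc h * (2 * (2 * h + 1) * ((2 * h) choose h))"
    proof -
      have "Suc h * (Suc h * ((2 * Suc h) choose Suc h)) = Suc h * (Suc (Suc (2*h)) * (Suc (2*h) choose Suc h))"
        using a unfolding b by (simp del: binomial_Suc_Suc)
      also have "\<dots> = Suc (Suc (2*h)) * (Suc (2*h) * ((2*h) choose h))" using c by (metis mult.left_commute)
      also have "\<dots> = Suc h * (2 * (2 * h + 1) * ((2 * h) choose h))" by simp
      finally show ?thesis .
    qed
    then show ?thesis by (simp only: mult_cancel1) auto
  qed
  then have "real (Suc h * ((2 * Suc h) choose Suc h)) = real (2 * (2 * h + 1) * ((2 * h) choose h))" by (rule arg_cong)
  then have eq: "real ((2 * Suc h) choose Suc h) = 2 * (2 * ?r + 1) / (?r + 1) * real ((2 * h) choose h)"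
    using h by (simp add: field_simps del: binomial_Suc_Suc)
  have s: "2 * sqrt (?r * (?r + 1)) \<le> 2 * ?r + 1"
  proof -
    have "sqrt (4 * (?r * (?r + 1))) \<le> 2 * ?r + 1"
      using h by (intro real_le_lsqrt) (auto simp: power2_eq_square algebra_simps)
    then show ?thesis by (simp add: real_sqrt_mult)
  qed
  have "4 ^ Suc h / (2 * sqrt (?r + 1)) = 2 * (2 * sqrt (?r * (?r + 1))) / (?r + 1) * (4 ^ h / (2 * sqrt ?r))"
  proof -
    define a b where "a = sqrt ?r" and "b = sqrt (?r + 1)"
    have ab: "a > 0" "b > 0" "?r + 1 = b * b" using h by (auto simp: a_def b_def)
    have "sqrt (?r * (?r + 1)) = a * b" by (simp add: a_def b_def real_sqrt_mult)
    then show ?thesis unfolding a_def[symmetric] b_def[symmetric] using ab(1,2)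
      by (simp only: ab(3)) (simp add: field_simps)
  qed
  also have "\<dots> \<le> 2 * (2 * ?r + 1) / (?r + 1) * (4 ^ h / (2 * sqrt ?r))"
    using h s by (intro mult_right_mono divide_right_mono mult_left_mono) auto
  also have "\<dots> \<le> 2 * (2 * ?r + 1) / (?r + 1) * real ((2 * h) choose h)"
    using h Suc.IH by (intro mult_left_mono) auto
  finally show ?case by (simp only: eq of_nat_Suc add.commute)
qed

text \<open>Each step away from the centre multiplies the coefficient by (h - u) / (h + u + 1),
  which is at least exp (- 2 (2u + 1) / h) while h - u is at least h / 2; the odd numbers 2u + 1 add
  up to a square.\<close>

lemma binomial_off_center_ge:
  assumes "2 * u \<le> h" "0 < h"
  shows "real ((2 * h) choose h) * exp (- 2 * (real u)\<^sup>2 / h) \<le> real ((2 * h) choose (h + u))"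
  using assms(1)
proof (induction u)
  case 0 show ?case by simp
next
  case (Suc u)
  let ?h = "real h" and ?u = "real u"
  have hu: "2 * ?u + 2 \<le> ?h" using of_nat_mono[OF Suc.prems, where 'a=real] by simp
  have "Suc (h + u) * ((2 * h) choose Suc (h + u)) = (2 * h - (h + u)) * ((2 * h) choose (h + u))"
    using binomial_absorb_comp[of "2*h" "h+u"] binomial_absorption[of "h+u" "2*h"]
    by (metis binomial_absorb_comp binomial_absorption)
  also have "2 * h - (h + u) = h - u" using Suc.prems by simp
  finally have "real (Suc (h + u) * ((2 * h) choose Suc (h + u))) = real ((h - u) * ((2 * h) choose (h + u)))"
    by (rule arg_cong)
  then have eq: "real ((2 * h) choose (h + Suc u)) = (?h - ?u) / (?h + ?u + 1) * real ((2 * h) choose (h + u))"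
    using Suc.prems by (simp add: field_simps of_nat_diff)
  have "exp (- (2 * (2 * ?u + 1) / ?h)) \<le> (?h - ?u) / (?h + ?u + 1)"
  proof -
    have "(?h + ?u + 1) / (?h - ?u) = 1 + (2 * ?u + 1) / (?h - ?u)" using hu by (simp add: field_simps)
    also have "(2 * ?u + 1) / (?h - ?u) \<le> (2 * ?u + 1) / (?h / 2)" using hu by (intro divide_left_mono) auto
    also have "1 + (2 * ?u + 1) / (?h / 2) \<le> exp ((2 * ?u + 1) / (?h / 2))" by (rule exp_ge_add_one_self)
    finally have "(?h + ?u + 1) / (?h - ?u) \<le> exp (2 * (2 * ?u + 1) / ?h)" by (simp add: algebra_simps)
    then have "inverse (exp (2 * (2 * ?u + 1) / ?h)) \<le> inverse ((?h + ?u + 1) / (?h - ?u))"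
      using hu by (intro le_imp_inverse_le divide_pos_pos) auto
    then show ?thesis by (simp only: exp_minus inverse_divide)
  qed
  then have "exp (- (2 * (2 * ?u + 1) / ?h)) * (real ((2 * h) choose h) * exp (- 2 * ?u\<^sup>2 / h)) \<le>
    (?h - ?u) / (?h + ?u + 1) * real ((2 * h) choose (h + u))"
    using Suc hu by (intro mult_mono) auto
  also have "exp (- (2 * (2 * ?u + 1) / ?h)) * (real ((2 * h) choose h) * exp (- 2 * ?u\<^sup>2 / h))
     = real ((2 * h) choose h) * exp (- 2 * (real (Suc u))\<^sup>2 / h)"
    by (simp add: exp_add[symmetric] power2_eq_square algebra_simps add_divide_distrib diff_divide_distrib)
  finally show ?case unfolding eq .
qed

lemma even_binomial_ge:
  assumes h: "0 < h" and k: "2 * \<bar>real k - real h\<bar> \<le> real h"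
  shows "exp (- 2 * (real k - real h)\<^sup>2 / h) / (2 * sqrt h) \<le> real ((2 * h) choose k) / 4 ^ h"
proof -
  obtain u where u: "2 * u \<le> h" "(real k - real h)\<^sup>2 = (real u)\<^sup>2" "(2 * h) choose k = (2 * h) choose (h + u)"
  proof (cases "h \<le> k")
    case True
    then show ?thesis using k that[of "k - h"] by (auto simp: of_nat_diff)
  next
    case False
    have "(2 * h) choose k = (2 * h) choose (2 * h - k)" using False by (intro binomial_symmetric) auto
    moreover have "2 * h - k = h + (h - k)" using False by simp
    ultimately show ?thesis using False k that[of "h - k"] by (auto simp: of_nat_diff power2_commute)
  qed
  have "exp (- 2 * (real k - real h)\<^sup>2 / h) / (2 * sqrt h) * 4 ^ h = 4 ^ h / (2 * sqrt h) * exp (- 2 * (real u)\<^sup>2 / h)"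
    by (simp add: u(2))
  also have "\<dots> \<le> real ((2 * h) choose h) * exp (- 2 * (real u)\<^sup>2 / h)"
    using central_binomial_ge[OF h] by (intro mult_right_mono) auto
  also have "\<dots> \<le> real ((2 * h) choose k)" unfolding u(3) by (rule binomial_off_center_ge[OF u(1) h])
  finally show ?thesis by (simp add: field_simps)
qed

text \<open>The odd case follows from the even one by Pascal's rule, at the cost of a factor 2.\<close>

lemma fair_binomial_ge:
  assumes m: "2 \<le> m" and k: "8 * \<bar>real k - real m / 2\<bar> + 8 \<le> real m"
  shows "exp (- (16 * ((real k - real m / 2)\<^sup>2 + 1) / m)) / (4 * sqrt m) \<le> real (m choose k) / 2 ^ m"
proof -
  define h where "h = m div 2"
  have h: "0 < h" using m by (auto simp: h_def)
  have hm: "m = 2 * h \<or> m = 2 * h + 1" unfolding h_def by presburger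
  have hr: "real m - 1 \<le> 2 * real h" "2 * real h \<le> real m" using hm by auto
  have dist: "\<bar>real k - real h\<bar> \<le> \<bar>real k - real m / 2\<bar> + 1 / 2" using hr by linarith
  have k2: "2 * \<bar>real k - real h\<bar> \<le> real h"
  proof -
    have "2 * x \<le> r" if "x \<le> y + 1 / 2" "8 * y + 8 \<le> s" "s - 1 \<le> 2 * r" "0 \<le> s" for x y r s :: real
      using that by linarith
    from this[OF dist k hr(1)] show ?thesis by simp
  qed
  have "(real k - real h)\<^sup>2 \<le> (\<bar>real k - real m / 2\<bar> + 1 / 2)\<^sup>2"
    using dist by (metis abs_ge_zero power2_abs power_mono)
  also have "\<dots> = 2 * (\<bar>real k - real m / 2\<bar>\<^sup>2 + 1) - ((\<bar>real k - real m / 2\<bar> - 1/2)\<^sup>2 + 3/2)"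
    by (simp add: power2_eq_square algebra_simps)
  finally have sq: "(real k - real h)\<^sup>2 \<le> 2 * ((real k - real m / 2)\<^sup>2 + 1)"
    using zero_le_power2[of "\<bar>real k - real m / 2\<bar> - 1/2"] by (simp only: power2_abs)
  \<comment> \<open>The 16 is 2 from the even case, 2 from the squared shift of the centre by 1/2,
    and 4 because \<open>h\<close> is at least \<open>m / 4\<close>.\<close>
  have e1: "2 * (real k - real h)\<^sup>2 / h \<le> 16 * ((real k - real m / 2)\<^sup>2 + 1) / m"
  proof -
    have "2 * (real k - real h)\<^sup>2 / h \<le> 4 * ((real k - real m / 2)\<^sup>2 + 1) / h"
      using sq h by (intro divide_right_mono) auto
    also have "\<dots> \<le> 4 * ((real k - real m / 2)\<^sup>2 + 1) / (m / 4)"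
      using hr m h by (intro divide_left_mono) (auto intro!: mult_pos_pos)
    finally show ?thesis by simp
  qed
  have "exp (- (16 * ((real k - real m / 2)\<^sup>2 + 1) / m)) / (4 * sqrt m)
      \<le> exp (- (2 * (real k - real h)\<^sup>2 / h)) / (4 * sqrt h)"
    using e1 h hr by (intro frac_le) (simp_all only: exp_le_cancel_iff neg_le_iff_le, auto)
  also have "\<dots> = exp (- 2 * (real k - real h)\<^sup>2 / h) / (2 * sqrt h) / 2" by simp
  also have "\<dots> \<le> real ((2 * h) choose k) / 4 ^ h / 2"
    using even_binomial_ge[OF h k2] by (intro divide_right_mono) auto
  also have "\<dots> \<le> real (m choose k) / 2 ^ m"
    using hm
  proof
    assume "m = 2 * h" then show ?thesis by (simp add: power_mult) (intro divide_left_mono; simp)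
  next
    assume e: "m = 2 * h + 1"
    have "(2 * h) choose k \<le> m choose k" unfolding e by (cases k) auto
    then have "real ((2 * h) choose k) \<le> real (m choose k)" by simp
    then show ?thesis unfolding e by (simp add: power_mult mult.commute[of "4 ^ h"] divide_right_mono del: of_nat_le_iff)
  qed
  finally show ?thesis .
qed

section \<open>Sums of independent random variables\<close>

text \<open>Independent terms, one for each letter of a word and not identically distributed. A
  general monoid is allowed because pairs of a settled part and a number of coins are summed as
  well.\<close>

primrec sum_pmf :: "('a \<Rightarrow> 'c::comm_monoid_add pmf) \<Rightarrow> 'a list \<Rightarrow> 'c pmf" where
  "sum_pmf V [] = return_pmf 0"
| "sum_pmf V (j # x) = bind_pmf (V j) (\<lambda>v. map_pmf ((+) v) (sum_pmf V x))"

lemma finite_set_sum_pmf: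
  "(\<And>j. finite (set_pmf (V j))) \<Longrightarrow> finite (set_pmf (sum_pmf V x))"
  by (induction x) auto

lemma map_sum_pmf:
  assumes "L 0 = 0" "\<And>a b. L (a + b) = L a + L b"
  shows "map_pmf L (sum_pmf V x) = sum_pmf (\<lambda>j. map_pmf L (V j)) x"
proof (induction x)
  case (Cons j x)
  have "map_pmf L (sum_pmf V (j # x)) = bind_pmf (V j) (\<lambda>v. map_pmf ((+) (L v)) (map_pmf L (sum_pmf V x)))"
    by (simp add: map_bind_pmf map_pmf_comp assms(2))
  then show ?case by (simp add: Cons bind_map_pmf)
qed (simp add: assms)

lemma expectation_bind_finite:
  fixes h :: "'b \<Rightarrow> real"
  assumes "finite (set_pmf p)" "\<And>x. x \<in> set_pmf p \<Longrightarrow> finite (set_pmf (f x))"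
  shows "measure_pmf.expectation (bind_pmf p f) h = measure_pmf.expectation p (\<lambda>x. measure_pmf.expectation (f x) h)"
  by (subst pmf_expectation_bind[where A="set_pmf p"])
    (use assms in \<open>auto simp: integral_measure_pmf_real[where A="set_pmf p"] mult.commute\<close>)

text \<open>The centre \<open>a\<close> is arbitrary for the sake of the induction, which replaces
  it by \<open>a - v\<close> after peeling off a term \<open>v\<close>; the cross term has mean
  0.\<close>

lemma second_moment_sum_pmf:
  fixes V :: "'a \<Rightarrow> real pmf"
  assumes fin: "\<And>j. finite (set_pmf (V j))"
    and mean: "\<And>j. measure_pmf.expectation (V j) (\<lambda>v. v) = \<mu> j"
    and bound: "\<And>j v. v \<in> set_pmf (V j) \<Longrightarrow> \<bar>v - \<mu> j\<bar> \<le> B"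
  shows "measure_pmf.expectation (sum_pmf V x) (\<lambda>s. (s - a)\<^sup>2) \<le> B\<^sup>2 * length x + ((\<Sum>j\<leftarrow>x. \<mu> j) - a)\<^sup>2"
proof (induction x arbitrary: a)
  case (Cons j x)
  let ?m = "\<Sum>i\<leftarrow>x. \<mu> i"
  note [simp] = integrable_measure_pmf_finite[OF fin]
  have "measure_pmf.expectation (sum_pmf V (j # x)) (\<lambda>s. (s - a)\<^sup>2)
      = measure_pmf.expectation (V j) (\<lambda>v. measure_pmf.expectation (sum_pmf V x) (\<lambda>s. (s - (a - v))\<^sup>2))"
    using finite_set_sum_pmf[of V, OF fin]
    by (simp add: expectation_bind_finite fin algebra_simps)
  also have "\<dots> \<le> measure_pmf.expectation (V j) (\<lambda>v. B\<^sup>2 * length x + (?m - (a - v))\<^sup>2)"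
    by (intro integral_mono Cons.IH) auto
  also have "\<dots> \<le> measure_pmf.expectation (V j) (\<lambda>v. B\<^sup>2 * length x + (B\<^sup>2 + 2 * (v - \<mu> j) * (\<mu> j + ?m - a) + (\<mu> j + ?m - a)\<^sup>2))"
  proof (rule integral_mono_AE)
    show "AE v in V j. B\<^sup>2 * length x + (?m - (a - v))\<^sup>2 \<le> B\<^sup>2 * length x + (B\<^sup>2 + 2 * (v - \<mu> j) * (\<mu> j + ?m - a) + (\<mu> j + ?m - a)\<^sup>2)"
    proof (rule AE_pmfI)
      fix v assume "v \<in> set_pmf (V j)"
      then have "\<bar>v - \<mu> j\<bar>\<^sup>2 \<le> B\<^sup>2" using bound by (intro power_mono) auto
      then show "B\<^sup>2 * length x + (?m - (a - v))\<^sup>2 \<le> B\<^sup>2 * length x + (B\<^sup>2 + 2 * (v - \<mu> j) * (\<mu> j + ?m - a) + (\<mu> j + ?m - a)\<^sup>2)"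
        by (simp add: power2_eq_square algebra_simps)
    qed
  qed auto
  also have "\<dots> = B\<^sup>2 * length x + (B\<^sup>2 + 2 * (measure_pmf.expectation (V j) (\<lambda>v. v) - \<mu> j) * (\<mu> j + ?m - a) + (\<mu> j + ?m - a)\<^sup>2)"
    by simp
  finally show ?case by (simp add: mean algebra_simps)
qed simp

text \<open>Conditional law of a sum of which \<open>fst z\<close> is settled while
  \<open>snd z\<close> fair coins of value \<delta> remain to be tossed. The pairs of independent
  summands add componentwise.\<close>

definition coins :: "real \<Rightarrow> real \<times> nat \<Rightarrow> real pmf" where
  "coins \<delta> z = map_pmf (\<lambda>i. fst z + \<delta> * real i) (binomial_pmf (snd z) (1/2))"

lemma binomial_pmf_add:
  assumes q: "q \<in> {0..1}"
  shows "bind_pmf (binomial_pmf m q) (\<lambda>i. map_pmf ((+) i) (binomial_pmf n q)) = binomial_pmf (m + n) q"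
proof (induction m)
  case 0 show ?case using q by (simp add: binomial_pmf_0 bind_return_pmf map_pmf_idI)
next
  case (Suc m)
  show ?case
    using q by (simp add: binomial_pmf_Suc Suc[symmetric] bind_assoc_pmf bind_return_pmf map_pmf_def add.assoc)
qed

text \<open>All tosses can be postponed until the pairs have been added, which makes the sum a
  mixture of binomial laws on lattices of step \<delta>.\<close>

lemma sum_pmf_coins:
  "sum_pmf (\<lambda>j. bind_pmf (Z j) (coins \<delta>)) x = bind_pmf (sum_pmf Z x) (coins \<delta>)"
proof (induction x)
  case Nil show ?case by (simp add: coins_def bind_return_pmf binomial_pmf_0 zero_prod_def)
next
  case (Cons j x)
  have c: "bind_pmf (coins \<delta> z) (\<lambda>v. map_pmf ((+) v) (coins \<delta> z')) = coins \<delta> (z + z')" for z z'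
  proof -
    have "coins \<delta> (z + z') = bind_pmf (binomial_pmf (snd z) (1/2))
        (\<lambda>i. map_pmf (\<lambda>i'. (fst z + fst z') + \<delta> * real (i + i')) (binomial_pmf (snd z') (1/2)))"
      unfolding coins_def by (simp add: binomial_pmf_add[symmetric] map_bind_pmf map_pmf_comp)
    then show ?thesis by (simp add: coins_def bind_map_pmf map_pmf_comp algebra_simps)
  qed
  have "sum_pmf (\<lambda>j. bind_pmf (Z j) (coins \<delta>)) (j # x)
     = bind_pmf (Z j) (\<lambda>z. bind_pmf (coins \<delta> z) (\<lambda>v. bind_pmf (sum_pmf Z x) (\<lambda>z'. map_pmf ((+) v) (coins \<delta> z'))))"
    by (simp add: Cons bind_assoc_pmf map_bind_pmf)
  also have "\<dots> = bind_pmf (Z j) (\<lambda>z. bind_pmf (sum_pmf Z x) (\<lambda>z'. bind_pmf (coins \<delta> z) (\<lambda>v. map_pmf ((+) v) (coins \<delta> z'))))"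
    by (intro bind_pmf_cong refl bind_commute_pmf)
  also have "\<dots> = bind_pmf (sum_pmf Z (j # x)) (coins \<delta>)"
    by (simp add: c bind_assoc_pmf bind_map_pmf)
  finally show ?case .
qed

text \<open>Mass \<open>w\<close> is set aside at \<open>k\<close> and at \<open>l\<close>. On this
  event, of probability \<open>2 * w\<close>, it is forgotten which of the two letters occurred, and
  a fair coin decides again.\<close>

lemma coin_split:
  fixes W :: "'b::finite pmf" and f :: "'b \<Rightarrow> real"
  assumes "0 < w" "w \<le> pmf W k" "w \<le> pmf W l" and "f l = f k + \<delta>" and "k \<noteq> l"
  obtains Z :: "(real \<times> nat) pmf" where
    "bind_pmf Z (coins \<delta>) = map_pmf f W"
    "finite (set_pmf Z)" "\<And>v m. (v, m) \<in> set_pmf Z \<Longrightarrow> v \<in> range f \<and> m \<le> 1"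
    "measure_pmf.expectation Z (\<lambda>z. real (snd z)) = 2 * w"
    "measure_pmf.expectation Z (\<lambda>z. fst z + \<delta> * real (snd z) / 2) = (\<Sum>i\<in>UNIV. pmf W i * f i)"
proof -
  define g where "g i = (if i = k \<or> i = l then map_pmf (\<lambda>b. if b then (f k, 1::nat) else (f i, 0)) (bernoulli_pmf (w / pmf W i))
     else return_pmf (f i, 0))" for i
  define Z where "Z = bind_pmf W g"
  have fin: "finite (set_pmf (g i))" for i by (simp add: g_def)
  have E: "measure_pmf.expectation Z h = (\<Sum>i\<in>UNIV. pmf W i * h (f i, 0)) + w * (2 * h (f k, 1) - h (f k, 0) - h (f l, 0))"
    for h :: "real \<times> nat \<Rightarrow> real"
  proof -
    have b: "0 \<le> w / pmf W i" "w / pmf W i \<le> 1" "pmf W i \<noteq> 0" if "i = k \<or> i = l" for i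
      using that assms by (auto simp: divide_le_eq)
    have "pmf W i * measure_pmf.expectation (g i) h = pmf W i * h (f i, 0) +
      ((if i = k then w * (h (f k, 1) - h (f k, 0)) else 0) + (if i = l then w * (h (f k, 1) - h (f l, 0)) else 0))" for i
    proof (cases "i = k \<or> i = l")
      case True
      then have "pmf W i * measure_pmf.expectation (g i) h = w * h (f k, 1) + (pmf W i - w) * h (f i, 0)"
        using b[OF True] by (simp add: g_def integral_bernoulli_pmf field_simps)
      then show ?thesis using True assms(5) by (auto simp: algebra_simps)
    qed (simp add: g_def)
    then have "measure_pmf.expectation Z h = (\<Sum>i\<in>UNIV. pmf W i * h (f i, 0) +
      ((if i = k then w * (h (f k, 1) - h (f k, 0)) else 0) + (if i = l then w * (h (f k, 1) - h (f l, 0)) else 0)))"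
      unfolding Z_def by (subst pmf_expectation_bind[where A=UNIV]) (auto simp: fin)
    also have "\<dots> = (\<Sum>i\<in>UNIV. pmf W i * h (f i, 0)) + (w * (h (f k, 1) - h (f k, 0)) + w * (h (f k, 1) - h (f l, 0)))"
      by (simp add: sum.distrib)
    finally show ?thesis by (simp add: algebra_simps)
  qed
  show ?thesis
  proof (rule that)
    show "bind_pmf Z (coins \<delta>) = map_pmf f W"
    proof (rule pmf_eqI)
      fix y
      have c0: "coins \<delta> (a, 0) = return_pmf a" for a by (simp add: coins_def binomial_pmf_0)
      have "coins \<delta> (a, Suc 0) = map_pmf (\<lambda>b. if b then a + \<delta> else a) (bernoulli_pmf (1/2))" for a
        by (auto simp: coins_def binomial_pmf_Suc binomial_pmf_0 bind_return_pmf map_pmf_def bind_assoc_pmf intro!: bind_pmf_cong)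
      then have c1: "pmf (coins \<delta> (a, Suc 0)) y = (of_bool (y = a + \<delta>) + of_bool (y = a)) / 2" for a
        by (simp add: map_pmf_def pmf_bind integral_bernoulli_pmf)
      have "pmf (bind_pmf Z (coins \<delta>)) y = (\<Sum>i\<in>UNIV. pmf W i * of_bool (y = f i))"
        unfolding pmf_bind E by (simp add: c0 c1 assms(4) of_bool_def indicator_def eq_commute[of y])
      also have "\<dots> = pmf (map_pmf f W) y"
        unfolding pmf_map by (subst measure_measure_pmf_finite) (auto intro: sum.mono_neutral_cong_right)
      finally show "pmf (bind_pmf Z (coins \<delta>)) y = pmf (map_pmf f W) y" .
    qed
  next
    show "finite (set_pmf Z)" unfolding Z_def using fin by simp
  next
    fix v m assume "(v, m) \<in> set_pmf Z"
    then show "v \<in> range f \<and> m \<le> 1" unfolding Z_def by (auto simp: g_def split: if_splits)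
  next
    show "measure_pmf.expectation Z (\<lambda>z. real (snd z)) = 2 * w" unfolding E by simp
  next
    show "measure_pmf.expectation Z (\<lambda>z. fst z + \<delta> * real (snd z) / 2) = (\<Sum>i\<in>UNIV. pmf W i * f i)"
      unfolding E using assms(4) by (simp add: algebra_simps)
  qed
qed

lemma chebyshev_sum_pmf:
  fixes V :: "'a \<Rightarrow> real pmf"
  assumes fin: "\<And>j. finite (set_pmf (V j))"
    and mean: "\<And>j. measure_pmf.expectation (V j) (\<lambda>v. v) = \<mu> j"
    and bound: "\<And>j v. v \<in> set_pmf (V j) \<Longrightarrow> \<bar>v - \<mu> j\<bar> \<le> B"
    and "0 < B" "x \<noteq> []"
  shows "measure_pmf.prob (sum_pmf V x) {s. 2 * B * sqrt (length x) \<le> \<bar>s - (\<Sum>j\<leftarrow>x. \<mu> j)\<bar>} \<le> 1 / 4"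
proof -
  let ?P = "sum_pmf V x" and ?m = "\<Sum>j\<leftarrow>x. \<mu> j" and ?n = "real (length x)"
  have n: "?n > 0" using assms by simp
  have "{s. 2 * B * sqrt ?n \<le> \<bar>s - ?m\<bar>} = {s \<in> space ?P. 4 * B\<^sup>2 * ?n \<le> (s - ?m)\<^sup>2}"
  proof -
    have "(2 * B * sqrt ?n \<le> \<bar>s - ?m\<bar>) = (4 * B\<^sup>2 * ?n \<le> (s - ?m)\<^sup>2)" for s
      using \<open>0 < B\<close> n abs_le_square_iff[of "2 * B * sqrt ?n" "s - ?m"]
      by (simp add: power_mult_distrib abs_mult)
    then show ?thesis by simp
  qed
  then have "measure_pmf.prob ?P {s. 2 * B * sqrt ?n \<le> \<bar>s - ?m\<bar>} \<le> measure_pmf.expectation ?P (\<lambda>s. (s - ?m)\<^sup>2) / (4 * B\<^sup>2 * ?n)"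
    using integral_Markov_inequality_measure[of ?P "\<lambda>s. (s - ?m)\<^sup>2" "{}" "4 * B\<^sup>2 * ?n"] n \<open>0 < B\<close>
    by (simp add: integrable_measure_pmf_finite finite_set_sum_pmf fin)
  also have "\<dots> \<le> (B\<^sup>2 * ?n + (?m - ?m)\<^sup>2) / (4 * B\<^sup>2 * ?n)"
    using second_moment_sum_pmf[where V=V and x=x and a="?m", OF fin mean bound] n by (intro divide_right_mono) auto
  also have "\<dots> = 1 / 4" using n \<open>0 < B\<close> by simp
  finally show ?thesis .
qed

text \<open>A half-open window of length \<delta> holds exactly one point of the lattice; the 1
  added to the scaled distance allows for rounding to it.\<close>

lemma coins_window_ge:
  assumes "0 < \<delta>" and m: "2 \<le> m" "8 * (\<bar>a - (v + \<delta> * real m / 2)\<bar> / \<delta> + 1) + 8 \<le> real m"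
  shows "exp (- (16 * ((\<bar>a - (v + \<delta> * real m / 2)\<bar> / \<delta> + 1)\<^sup>2 + 1) / m)) / (4 * sqrt m)
    \<le> measure_pmf.prob (coins \<delta> (v, m)) {a - \<delta><..a}"
proof -
  let ?D = "\<bar>a - (v + \<delta> * real m / 2)\<bar> / \<delta> + 1"
  define k where "k = nat \<lfloor>(a - v) / \<delta>\<rfloor>"
  have e: "(a - v) / \<delta> - real m / 2 = (a - (v + \<delta> * real m / 2)) / \<delta>" using assms(1) by (simp add: field_simps)
  then have d: "\<bar>(a - v) / \<delta> - real m / 2\<bar> \<le> ?D - 1" using assms(1) by simp
  have "0 \<le> (a - v) / \<delta>"
  proof -
    have "0 \<le> y" if "\<bar>y - r / 2\<bar> \<le> D - 1" "8 * D + 8 \<le> r" "0 \<le> r" for y r D :: real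
      using that by linarith
    from this[OF d m(2)] show ?thesis by simp
  qed
  then have k: "real k \<le> (a - v) / \<delta>" "(a - v) / \<delta> < real k + 1" unfolding k_def by linarith+
  have D: "\<bar>real k - real m / 2\<bar> \<le> ?D" using d k by linarith
  have D2: "(real k - real m / 2)\<^sup>2 \<le> ?D\<^sup>2"
    using D by (metis abs_ge_zero power2_abs power_mono)
  have "exp (- (16 * (?D\<^sup>2 + 1) / m)) / (4 * sqrt m) \<le> exp (- (16 * ((real k - real m / 2)\<^sup>2 + 1) / m)) / (4 * sqrt m)"
    using D2 by (intro divide_right_mono iffD2[OF exp_le_cancel_iff] le_imp_neg_le mult_left_mono add_mono) auto
  also have "\<dots> \<le> real (m choose k) / 2 ^ m"
    using D m by (intro fair_binomial_ge) auto
  also have "\<dots> = pmf (binomial_pmf m (1/2)) k"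
  proof (cases "k \<le> m")
    case True
    then have "(1/2::real) ^ k * (1/2) ^ (m - k) = 1 / 2 ^ m" by (simp add: power_add[symmetric] power_one_over)
    then show ?thesis by (simp add: mult.assoc)
  qed (simp add: binomial_eq_0)
  also have "\<dots> = measure_pmf.prob (binomial_pmf m (1/2)) {k}" by (simp add: pmf.rep_eq)
  also have "\<dots> \<le> measure_pmf.prob (binomial_pmf m (1/2)) ((\<lambda>i. v + \<delta> * real i) -` {a - \<delta><..a})"
    using k assms(1) by (intro measure_pmf.finite_measure_mono) (auto simp: field_simps)
  also have "\<dots> = measure_pmf.prob (coins \<delta> (v, m)) {a - \<delta><..a}" by (simp add: coins_def)
  finally show ?thesis .
qed

lemma prob_bind_pmf:
  "measure_pmf.prob (bind_pmf p f) A = measure_pmf.expectation p (\<lambda>z. measure_pmf.prob (f z) A)"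
  unfolding measure_pmf_bind
  by (subst measure_pmf.measure_bind[where N="count_space UNIV"]) (auto simp: measure_subprob)

lemma measure_bind_pmf_ge:
  assumes "\<And>z. z \<in> set_pmf p \<Longrightarrow> z \<in> G \<Longrightarrow> c \<le> measure_pmf.prob (f z) A" "0 \<le> c"
  shows "measure_pmf.prob p G * c \<le> measure_pmf.prob (bind_pmf p f) A"
proof -
  have "measure_pmf.prob p G * c = measure_pmf.expectation p (\<lambda>z. indicat_real G z * c)"
    by simp
  also have "\<dots> \<le> measure_pmf.expectation p (\<lambda>z. measure_pmf.prob (f z) A)"
    by (rule integral_mono_AE)
      (use assms in \<open>auto simp: AE_measure_pmf_iff indicator_def intro!: measure_pmf.integrable_const_bound[where B=1] \<close>)
  also have "\<dots> = measure_pmf.prob (bind_pmf p f) A"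
    by (simp add: prob_bind_pmf)
  finally show ?thesis .
qed

text \<open>Conditionally on the parts that are not fair coins the sum is binomial on a lattice of step \<open>\<delta>\<close>,
  which replaces a local limit theorem for sums of independent, not identically distributed terms.\<close>

lemma local_lower_bound:
  fixes B \<delta> \<beta> :: real
  assumes B: "0 < B" and \<delta>: "0 < \<delta>" and \<beta>: "0 < \<beta>"
  obtains C \<eta> :: real and n0 :: nat where "0 < C" "0 < \<eta>"
    "\<And>(Z :: 'a \<Rightarrow> (real \<times> nat) pmf) \<mu> \<gamma> x a.
      (\<And>j. finite (set_pmf (Z j))) \<Longrightarrow>
      (\<And>j. measure_pmf.expectation (Z j) (\<lambda>z. fst z + \<delta> * real (snd z) / 2) = \<mu> j) \<Longrightarrow>
      (\<And>j. measure_pmf.expectation (Z j) (\<lambda>z. real (snd z)) = \<gamma> j) \<Longrightarrow>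
      (\<And>j z. z \<in> set_pmf (Z j) \<Longrightarrow> snd z \<le> 1 \<and> \<bar>fst z + \<delta> * real (snd z) / 2 - \<mu> j\<bar> \<le> B) \<Longrightarrow>
      n0 \<le> length x \<Longrightarrow> \<beta> * length x \<le> (\<Sum>j\<leftarrow>x. \<gamma> j) \<Longrightarrow> \<bar>(\<Sum>j\<leftarrow>x. \<mu> j) - a\<bar> \<le> \<eta> * length x \<Longrightarrow>
      exp (- (C * (1 + ((\<Sum>j\<leftarrow>x. \<mu> j) - a)\<^sup>2 / length x))) / sqrt (length x)
        \<le> measure_pmf.prob (sum_pmf (\<lambda>j. bind_pmf (Z j) (coins \<delta>)) x) {a - \<delta><..a}"
proof -
  \<comment> \<open>These come from inserting into \<open>coins_window_ge\<close> at least
    \<open>\<beta> * length x / 2\<close> coins and a distance made of three parts, whose squared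
    sum costs a factor 3. The 8 below is the 4 of the binomial bound times the 2 lost to untypical
    pairs.\<close>
  define C1 where "C1 = 96 / (\<beta> * \<delta>\<^sup>2)"
  define C2 where "C2 = 32 / \<beta> * (12 * B\<^sup>2 / \<delta>\<^sup>2 + 4)"
  define C where "C = max C1 (C2 + ln 8)"
  have C2: "0 < C2" using B \<delta> \<beta> unfolding C2_def by (intro mult_pos_pos add_nonneg_pos) auto
  have C: "0 < C" "C1 \<le> C" "C2 + ln 8 \<le> C" using C2 by (auto simp: C_def less_max_iff_disj intro!: add_pos_pos)
  \<comment> \<open>Keeps the window within the range of \<open>fair_binomial_ge\<close>: this part
    of the distance, in units of \<delta>, is at most
    \<open>\<beta> * length x / 32\<close>.\<close>
  define \<eta> where "\<eta> = \<beta> * \<delta> / 32"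
  have \<eta>: "0 < \<eta>" using \<beta> \<delta> by (simp add: \<eta>_def)
  have "\<forall>\<^sub>F n in sequentially. 4 * sqrt (real n) \<le> \<beta> * real n \<and> 4 \<le> \<beta> * real n \<and> 16 * B / \<delta> * sqrt (real n) + 16 \<le> \<beta> * real n / 4"
    using \<beta> \<delta> B by (intro eventually_conj; real_asymp)
  then obtain n1 where n1: "\<And>n. n1 \<le> n \<Longrightarrow> 4 * sqrt (real n) \<le> \<beta> * real n \<and> 4 \<le> \<beta> * real n \<and> 16 * B / \<delta> * sqrt (real n) + 16 \<le> \<beta> * real n / 4"
    by (auto simp: eventually_sequentially)
  show ?thesis
  proof (rule that[OF C(1) \<eta>, of "max 1 n1"])
    fix Z :: "'a \<Rightarrow> (real \<times> nat) pmf" and \<mu> \<gamma> :: "'a \<Rightarrow> real" and x :: "'a list" and a :: real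
    assume fin: "\<And>j. finite (set_pmf (Z j))"
      and mu: "\<And>j. measure_pmf.expectation (Z j) (\<lambda>z. fst z + \<delta> * real (snd z) / 2) = \<mu> j"
      and gam: "\<And>j. measure_pmf.expectation (Z j) (\<lambda>z. real (snd z)) = \<gamma> j"
      and bd: "\<And>j z. z \<in> set_pmf (Z j) \<Longrightarrow> snd z \<le> 1 \<and> \<bar>fst z + \<delta> * real (snd z) / 2 - \<mu> j\<bar> \<le> B"
      and n0: "max 1 n1 \<le> length x" and sg: "\<beta> * length x \<le> (\<Sum>j\<leftarrow>x. \<gamma> j)"
      and dev: "\<bar>(\<Sum>j\<leftarrow>x. \<mu> j) - a\<bar> \<le> \<eta> * length x"
    let ?n = "real (length x)" and ?M = "\<Sum>j\<leftarrow>x. \<mu> j" and ?G = "\<Sum>j\<leftarrow>x. \<gamma> j"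
    have n: "x \<noteq> []" "4 * sqrt ?n \<le> \<beta> * ?n" "4 \<le> \<beta> * ?n" "16 * B / \<delta> * sqrt ?n + 16 \<le> \<beta> * ?n / 4" "0 < ?n"
      using n0 n1[of "length x"] by auto
    let ?P = "sum_pmf Z x"
    \<comment> \<open>The mean of the sum given the pair \<open>z\<close>.\<close>
    define L where "L z = fst z + \<delta> * real (snd z) / 2" for z :: "real \<times> nat"
    have L: "map_pmf L ?P = sum_pmf (\<lambda>j. map_pmf L (Z j)) x"
      by (rule map_sum_pmf) (auto simp: L_def algebra_simps add_divide_distrib)
    have S: "map_pmf (\<lambda>z. real (snd z)) ?P = sum_pmf (\<lambda>j. map_pmf (\<lambda>z. real (snd z)) (Z j)) x"
      by (rule map_sum_pmf) auto
    have g01: "0 \<le> \<gamma> j \<and> \<gamma> j \<le> 1" for j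
    proof
      show "0 \<le> \<gamma> j" unfolding gam[symmetric] by simp
      have "\<gamma> j \<le> measure_pmf.expectation (Z j) (\<lambda>z. 1)" unfolding gam[symmetric]
        by (rule integral_mono_AE) (use bd fin in \<open>auto simp: AE_measure_pmf_iff integrable_measure_pmf_finite\<close>)
      then show "\<gamma> j \<le> 1" by simp
    qed
    have bad1: "measure_pmf.prob ?P {z. 2 * B * sqrt ?n \<le> \<bar>L z - ?M\<bar>} \<le> 1 / 4"
    proof -
      have "measure_pmf.prob (map_pmf L ?P) {s. 2 * B * sqrt ?n \<le> \<bar>s - ?M\<bar>} \<le> 1 / 4"
        unfolding L by (rule chebyshev_sum_pmf) (use fin mu bd B n in \<open>auto simp: L_def\<close>)
      then show ?thesis by (simp add: vimage_def)
    qed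
    have bad2: "measure_pmf.prob ?P {z. 2 * 1 * sqrt ?n \<le> \<bar>real (snd z) - ?G\<bar>} \<le> 1 / 4"
    proof -
      have b: "\<bar>real (snd z) - \<gamma> j\<bar> \<le> 1" if "z \<in> set_pmf (Z j)" for j z
        using bd[OF that] g01[of j] by (cases "snd z") auto
      have "measure_pmf.prob (map_pmf (\<lambda>z. real (snd z)) ?P) {s. 2 * 1 * sqrt ?n \<le> \<bar>s - ?G\<bar>} \<le> 1 / 4"
        unfolding S by (rule chebyshev_sum_pmf) (use fin gam b n in auto)
      then show ?thesis by (simp add: vimage_def)
    qed
    \<comment> \<open>Both the conditional mean and the number of coins are within O(sqrt n) of
      their expectations; each condition fails with probability at most 1/4.\<close>
    define G where "G = {z. \<bar>L z - ?M\<bar> < 2 * B * sqrt ?n \<and> \<bar>real (snd z) - ?G\<bar> < 2 * sqrt ?n}"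
    have "1 - measure_pmf.prob ?P G = measure_pmf.prob ?P (- G)"
      using measure_pmf.prob_compl[of G ?P] by (simp add: Compl_eq_Diff_UNIV)
    also have "\<dots> \<le> measure_pmf.prob ?P ({z. 2 * B * sqrt ?n \<le> \<bar>L z - ?M\<bar>} \<union> {z. 2 * 1 * sqrt ?n \<le> \<bar>real (snd z) - ?G\<bar>})"
      by (rule measure_pmf.finite_measure_mono) (auto simp: G_def)
    also have "\<dots> \<le> measure_pmf.prob ?P {z. 2 * B * sqrt ?n \<le> \<bar>L z - ?M\<bar>} + measure_pmf.prob ?P {z. 2 * 1 * sqrt ?n \<le> \<bar>real (snd z) - ?G\<bar>}"
      by (rule measure_Un_le) auto
    finally have PG: "1 / 2 \<le> measure_pmf.prob ?P G" using bad1 bad2 by linarith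
    have cnt: "snd z \<le> length x" if "z \<in> set_pmf (sum_pmf Z x)" for z
      using that
    proof (induction x arbitrary: z)
      case (Cons j x)
      then obtain v z' where "v \<in> set_pmf (Z j)" "z' \<in> set_pmf (sum_pmf Z x)" "z = v + z'" by auto
      then show ?case using bd[of v j] Cons.IH[of z'] by auto
    qed simp
    let ?c = "exp (- (C1 * (?M - a)\<^sup>2 / ?n + C2)) / (4 * sqrt ?n)"
    have win: "?c \<le> measure_pmf.prob (coins \<delta> z) {a - \<delta><..a}" if zP: "z \<in> set_pmf ?P" and zG: "z \<in> G" for z
    proof -
      obtain v m where z: "z = (v, m)" by (cases z)
      have g: "\<bar>L z - ?M\<bar> < 2 * B * sqrt ?n" "\<bar>real m - ?G\<bar> < 2 * sqrt ?n" using zG by (auto simp: G_def z)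
      have m1: "\<beta> * ?n / 2 \<le> real m" using g(2) sg n(2) by linarith
      have m2: "real m \<le> ?n" using cnt[OF zP] z by simp
      have m3: "2 \<le> real m" using m1 n(3) by linarith
      let ?D = "\<bar>a - L z\<bar> / \<delta> + 1"
      have d0: "\<bar>a - L z\<bar> \<le> \<bar>?M - a\<bar> + 2 * B * sqrt ?n" using g(1) by linarith
      have D: "?D \<le> \<bar>?M - a\<bar> / \<delta> + 2 * B * sqrt ?n / \<delta> + 1"
        using divide_right_mono[OF d0, of \<delta>] \<delta> by (simp add: add_divide_distrib)
      have Mn: "\<bar>?M - a\<bar> / \<delta> \<le> \<beta> * ?n / 32" using dev \<delta> by (simp add: \<eta>_def field_simps)
      have Bn: "8 * (2 * B * sqrt ?n / \<delta>) = 16 * B / \<delta> * sqrt ?n" by simp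
      have "8 * D + 8 \<le> m" if "p \<le> n / 32" "8 * q = r" "D \<le> p + q + 1" "r + 16 \<le> n / 4" "n / 2 \<le> m"
        for p q r n m D :: real
        using that by linarith
      from this[OF Mn Bn D n(4) m1] have cond: "8 * ?D + 8 \<le> real m" .
      have "?D\<^sup>2 \<le> (\<bar>?M - a\<bar> / \<delta> + 2 * B * sqrt ?n / \<delta> + 1)\<^sup>2"
        using D \<delta> by (intro power_mono) auto
      also have "\<dots> \<le> 3 * ((\<bar>?M - a\<bar> / \<delta>)\<^sup>2 + (2 * B * sqrt ?n / \<delta>)\<^sup>2 + 1)"
      proof -
        have "(p + q + 1)\<^sup>2 \<le> 3 * (p\<^sup>2 + q\<^sup>2 + 1)" for p q :: real
          using zero_le_power2[of "p - q"] zero_le_power2[of "p - 1"] zero_le_power2[of "q - 1"]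
          by (simp add: power2_eq_square algebra_simps)
        then show ?thesis .
      qed
      also have "\<dots> = 3 * (?M - a)\<^sup>2 / \<delta>\<^sup>2 + 12 * B\<^sup>2 * ?n / \<delta>\<^sup>2 + 3"
        by (simp add: power_divide power_mult_distrib)
      finally have D2: "?D\<^sup>2 + 1 \<le> 3 * (?M - a)\<^sup>2 / \<delta>\<^sup>2 + 12 * B\<^sup>2 * ?n / \<delta>\<^sup>2 + 4" by simp
      have "16 * (?D\<^sup>2 + 1) / m \<le> 16 * (?D\<^sup>2 + 1) / (\<beta> * ?n / 2)"
        using m1 m3 \<beta> n by (intro divide_left_mono mult_pos_pos) auto
      also have "\<dots> \<le> 16 * (3 * (?M - a)\<^sup>2 / \<delta>\<^sup>2 + 12 * B\<^sup>2 * ?n / \<delta>\<^sup>2 + 4) / (\<beta> * ?n / 2)"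
        using D2 \<beta> n by (intro divide_right_mono mult_left_mono) auto
      also have "\<dots> = C1 * (?M - a)\<^sup>2 / ?n + (32 / \<beta> * (12 * B\<^sup>2 / \<delta>\<^sup>2) + 128 / (\<beta> * ?n))"
        using \<beta> \<delta> n(5) by (simp add: C1_def field_simps)
      also have "128 / (\<beta> * ?n) \<le> 128 / \<beta>"
          using mult_left_mono[of 1 ?n \<beta>] n(5) n0 \<beta> by (intro divide_left_mono mult_pos_pos) linarith+
      also have "32 / \<beta> * (12 * B\<^sup>2 / \<delta>\<^sup>2) + 128 / \<beta> = C2" using \<beta> \<delta> by (simp add: C2_def field_simps)
      finally have E: "16 * (?D\<^sup>2 + 1) / m \<le> C1 * (?M - a)\<^sup>2 / ?n + C2" by simp
      have "?c \<le> exp (- (16 * (?D\<^sup>2 + 1) / m)) / (4 * sqrt m)"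
        using E m2 m3 by (intro frac_le) auto
      also have "\<dots> \<le> measure_pmf.prob (coins \<delta> (v, m)) {a - \<delta><..a}"
        using coins_window_ge[OF \<delta>, of m a v] m3 cond by (simp add: L_def z)
      finally show ?thesis by (simp add: z)
    qed
    have "exp (- (C * (1 + (?M - a)\<^sup>2 / ?n))) / sqrt ?n \<le> exp (- (C1 * (?M - a)\<^sup>2 / ?n + C2) - ln 8) / sqrt ?n"
    proof -
      have "C1 * ((?M - a)\<^sup>2 / ?n) \<le> C * ((?M - a)\<^sup>2 / ?n)" using C by (intro mult_right_mono) auto
      then show ?thesis using C n(5) by (intro divide_right_mono) (auto simp: algebra_simps)
    qed
    also have "\<dots> = 1 / 2 * ?c" by (simp add: exp_diff)
    also have "\<dots> \<le> measure_pmf.prob ?P G * ?c" using PG by (intro mult_right_mono) auto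
    also have "\<dots> \<le> measure_pmf.prob (bind_pmf ?P (coins \<delta>)) {a - \<delta><..a}"
      by (rule measure_bind_pmf_ge) (use win in auto)
    finally show "exp (- (C * (1 + (?M - a)\<^sup>2 / ?n))) / sqrt ?n
      \<le> measure_pmf.prob (sum_pmf (\<lambda>j. bind_pmf (Z j) (coins \<delta>)) x) {a - \<delta><..a}"
      unfolding sum_pmf_coins .
  qed
qed

section \<open>Tilting\<close>

lemma prob_sum_pmf_Cons:
  fixes W :: "'a \<Rightarrow> 'b::finite pmf" and f :: "'a \<Rightarrow> 'b \<Rightarrow> real"
  shows "measure_pmf.prob (sum_pmf (\<lambda>j. map_pmf (f j) (W j)) (j # x)) A =
    (\<Sum>k\<in>UNIV. pmf (W j) k * measure_pmf.prob (sum_pmf (\<lambda>j. map_pmf (f j) (W j)) x) {s. f j k + s \<in> A})"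
  by (simp add: prob_bind_pmf integral_measure_pmf_real[of UNIV] vimage_def mult.commute)

definition partition_sum :: "'b::finite pmf \<Rightarrow> ('b \<Rightarrow> real) \<Rightarrow> real" where
  "partition_sum Q u = (\<Sum>k\<in>UNIV. pmf Q k * exp (u k))"

definition tilt :: "'b::finite pmf \<Rightarrow> ('b \<Rightarrow> real) \<Rightarrow> 'b pmf" where
  "tilt Q u = embed_pmf (\<lambda>k. pmf Q k * exp (u k) / partition_sum Q u)"

lemma partition_sum_pos: "0 < partition_sum Q u"
proof -
  obtain k where "k \<in> set_pmf Q" using set_pmf_not_empty[of Q] by auto
  then have "0 < pmf Q k" by (simp add: pmf_positive)
  then show ?thesis unfolding partition_sum_def by (intro sum_pos2[of _ k]) auto
qed

lemma partition_sum_le_1: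
  assumes "\<And>k. u k \<le> 0" shows "partition_sum Q u \<le> 1"
proof -
  have "partition_sum Q u \<le> (\<Sum>k\<in>UNIV. pmf Q k * 1)"
    unfolding partition_sum_def using assms by (intro sum_mono mult_left_mono) auto
  then show ?thesis by (simp add: sum_pmf_eq_1)
qed

lemma pmf_tilt: "pmf (tilt Q u) k = pmf Q k * exp (u k) / partition_sum Q u"
  unfolding tilt_def using partition_sum_pos[of Q u]
  by (subst pmf_embed_pmf)
    (auto simp: nn_integral_count_space_finite sum_divide_distrib[symmetric] partition_sum_def[symmetric] intro!: divide_nonneg_pos)

text \<open>Change of measure: relative to the tilted law of the sum, the original one has density
  exp (lam s) times the product of partition sums, and on the window this is at least its value at
  \<open>a - \<delta>\<close>. The induction absorbs the value at the first letter into
  \<open>a\<close>.\<close>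

lemma tilting_lower_bound:
  fixes f :: "'a \<Rightarrow> 'b::finite \<Rightarrow> real"
  assumes "0 \<le> lam"
  shows "(\<Prod>j\<leftarrow>x. partition_sum Q (\<lambda>k. - lam * f j k)) * exp (lam * (a - \<delta>))
      * measure_pmf.prob (sum_pmf (\<lambda>j. map_pmf (f j) (tilt Q (\<lambda>k. - lam * f j k))) x) {a - \<delta><..a}
    \<le> measure_pmf.prob (sum_pmf (\<lambda>j. map_pmf (f j) Q) x) {..a}"
proof (induction x arbitrary: a)
  case Nil
  show ?case using assms by (auto simp: indicator_def mult_nonneg_nonpos)
next
  case (Cons j x)
  let ?Z = "\<lambda>j. partition_sum Q (\<lambda>k. - lam * f j k)" and ?T = "\<lambda>j. tilt Q (\<lambda>k. - lam * f j k)"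
  let ?S = "sum_pmf (\<lambda>j. map_pmf (f j) Q) x" and ?S' = "sum_pmf (\<lambda>j. map_pmf (f j) (?T j)) x"
  have "(\<Prod>j\<leftarrow>j#x. ?Z j) * exp (lam * (a - \<delta>)) * measure_pmf.prob (sum_pmf (\<lambda>j. map_pmf (f j) (?T j)) (j # x)) {a - \<delta><..a}
    = (\<Sum>k\<in>UNIV. pmf Q k * ((\<Prod>j\<leftarrow>x. ?Z j) * exp (lam * ((a - f j k) - \<delta>)) * measure_pmf.prob ?S' {(a - f j k) - \<delta><..a - f j k}))"
  proof -
    have "{s. a - \<delta> < f j k + s \<and> f j k + s \<le> a} = {(a - f j k) - \<delta><..a - f j k}" for k by auto
    moreover have "exp (lam * ((a - f j k) - \<delta>)) = exp (lam * (a - \<delta>)) * exp (- lam * f j k)" for k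
      by (simp add: exp_add[symmetric] algebra_simps)
    ultimately show ?thesis
      unfolding prob_sum_pmf_Cons using partition_sum_pos[of Q "\<lambda>k. - lam * f j k"]
      by (simp add: pmf_tilt sum_distrib_left mult.assoc mult.left_commute)
  qed
  also have "\<dots> \<le> (\<Sum>k\<in>UNIV. pmf Q k * measure_pmf.prob ?S {..a - f j k})"
    by (intro sum_mono mult_left_mono Cons.IH) auto
  also have "\<dots> = measure_pmf.prob (sum_pmf (\<lambda>j. map_pmf (f j) Q) (j # x)) {..a}"
  proof -
    have "{s. f j k + s \<le> a} = {..a - f j k}" for k by auto
    then show ?thesis unfolding prob_sum_pmf_Cons by simp
  qed
  finally show ?case .
qed

section \<open>Probabilities of distortion balls\<close>

lemma replicate_pmf_distortion:
  "map_pmf (\<lambda>y. \<Sum>i<length x. \<rho> (x ! i) (y ! i)) (replicate_pmf (length x) Q)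
    = sum_pmf (\<lambda>j. map_pmf (\<rho> j) Q) x" for \<rho> :: "('a, 'b) distortion"
proof (induction x)
  case (Cons j x)
  have "map_pmf (\<lambda>y. \<Sum>i<length (j#x). \<rho> ((j#x) ! i) (y ! i)) (replicate_pmf (length (j#x)) Q)
    = bind_pmf Q (\<lambda>k. map_pmf (\<lambda>y. \<rho> j k + (\<Sum>i<length x. \<rho> (x ! i) (y ! i))) (replicate_pmf (length x) Q))"
    by (simp add: map_bind_pmf map_pmf_def[symmetric] sum.lessThan_Suc_shift map_pmf_comp del: sum.lessThan_Suc)
  also have "\<dots> = bind_pmf Q (\<lambda>k. map_pmf ((+) (\<rho> j k)) (map_pmf (\<lambda>y. \<Sum>i<length x. \<rho> (x ! i) (y ! i)) (replicate_pmf (length x) Q)))"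
    by (simp add: map_pmf_comp)
  finally show ?case unfolding Cons by (simp add: bind_map_pmf)
qed simp

definition distortion_ball :: "real \<Rightarrow> ('a, 'b) distortion \<Rightarrow> 'a list \<Rightarrow> 'b list set" where
  "distortion_ball d \<rho> x = {y. block_distortion (length x) \<rho> x y \<le> d}"

lemma prob_distortion_ball:
  assumes "x \<noteq> []"
  shows "measure_pmf.prob (replicate_pmf (length x) Q) (distortion_ball d \<rho> x)
    = measure_pmf.prob (sum_pmf (\<lambda>j. map_pmf (\<rho> j) Q) x) {..d * length x}"
  using assms unfolding replicate_pmf_distortion[symmetric]
  by (simp add: distortion_ball_def block_distortion_def vimage_def divide_le_eq)

text \<open>Only the letter \<open>j0\<close> supplies coins, with values
  \<open>\<rho> j0 k1\<close> and \<open>\<rho> j0 k2\<close>; a word with a fraction \<theta> of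
  this letter has linearly many on average. The constants depend on \<open>Q\<close> only through
  \<open>q0\<close>, so one choice serves grid points for all lengths.\<close>

lemma distortion_ball_lower_bound:
  fixes \<rho> :: "('a, 'b::finite) distortion" and d lam rmax q0 \<theta> :: real
  assumes lam: "0 \<le> lam" and rho: "\<And>j k. 0 \<le> \<rho> j k" "\<And>j k. \<rho> j k \<le> rmax"
    and jk: "\<rho> j0 k1 < \<rho> j0 k2" and q0: "0 < q0" and \<theta>: "0 < \<theta>"
  obtains C \<eta> :: real and n0 :: nat where "0 < C" "0 < \<eta>"
    "\<And>Q x (\<mu> :: 'a \<Rightarrow> real). (\<And>k. q0 \<le> pmf Q k) \<Longrightarrow>
      (\<And>j. \<mu> j = (\<Sum>k\<in>UNIV. pmf (tilt Q (\<lambda>k. - lam * \<rho> j k)) k * \<rho> j k)) \<Longrightarrow>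
      n0 \<le> length x \<Longrightarrow> \<theta> * length x \<le> (\<Sum>j\<leftarrow>x. of_bool (j = j0) :: real) \<Longrightarrow>
      \<bar>(\<Sum>j\<leftarrow>x. \<mu> j) - d * length x\<bar> \<le> \<eta> * length x \<Longrightarrow>
      exp ((\<Sum>j\<leftarrow>x. ln (partition_sum Q (\<lambda>k. - lam * \<rho> j k))) + lam * d * length x
          - C * (1 + ((\<Sum>j\<leftarrow>x. \<mu> j) - d * length x)\<^sup>2 / length x)) / sqrt (length x)
        \<le> measure_pmf.prob (replicate_pmf (length x) Q) (distortion_ball d \<rho> x)"
proof -
  define \<delta> where "\<delta> = \<rho> j0 k2 - \<rho> j0 k1"
  have \<delta>: "0 < \<delta>" "\<delta> \<le> rmax" using jk rho(1)[of j0 k1] rho(2)[of j0 k2] by (auto simp: \<delta>_def)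
  \<comment> \<open>A lower bound for every tilted probability, uniform in \<open>Q\<close>, since
    the partition sum is at most 1.\<close>
  define w where "w = q0 * exp (- lam * rmax)"
  have w: "0 < w" using q0 by (simp add: w_def)
  obtain C \<eta> :: real and n0 :: nat where C: "0 < C" "0 < \<eta>"
    and main: "\<And>(Z :: 'a \<Rightarrow> (real \<times> nat) pmf) \<mu> \<gamma> x a.
      (\<And>j. finite (set_pmf (Z j))) \<Longrightarrow>
      (\<And>j. measure_pmf.expectation (Z j) (\<lambda>z. fst z + \<delta> * real (snd z) / 2) = \<mu> j) \<Longrightarrow>
      (\<And>j. measure_pmf.expectation (Z j) (\<lambda>z. real (snd z)) = \<gamma> j) \<Longrightarrow>
      (\<And>j z. z \<in> set_pmf (Z j) \<Longrightarrow> snd z \<le> 1 \<and> \<bar>fst z + \<delta> * real (snd z) / 2 - \<mu> j\<bar> \<le> 2 * rmax) \<Longrightarrow>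
      n0 \<le> length x \<Longrightarrow> (2 * w * \<theta>) * length x \<le> (\<Sum>j\<leftarrow>x. \<gamma> j) \<Longrightarrow> \<bar>(\<Sum>j\<leftarrow>x. \<mu> j) - a\<bar> \<le> \<eta> * length x \<Longrightarrow>
      exp (- (C * (1 + ((\<Sum>j\<leftarrow>x. \<mu> j) - a)\<^sup>2 / length x))) / sqrt (length x)
        \<le> measure_pmf.prob (sum_pmf (\<lambda>j. bind_pmf (Z j) (coins \<delta>)) x) {a - \<delta><..a}"
    by (rule local_lower_bound[of "2 * rmax" \<delta> "2 * w * \<theta>", where 'a='a]) (use \<delta> w \<theta> that in auto)
  show ?thesis
  \<comment> \<open>The summand \<open>lam * \<delta>\<close> pays for evaluating the tilting
    density at the lower end of the window.\<close>
  proof (rule that[of "C + lam * \<delta>" \<eta> "max 1 n0"])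
    show "0 < C + lam * \<delta>" using C lam \<delta> by (intro add_pos_nonneg) auto
    fix Q x \<mu>
    assume Q: "\<And>k. q0 \<le> pmf Q k" and mu: "\<And>j. \<mu> j = (\<Sum>k\<in>UNIV. pmf (tilt Q (\<lambda>k. - lam * \<rho> j k)) k * \<rho> j k)"
      and n0: "max 1 n0 \<le> length x" and cnt: "\<theta> * length x \<le> (\<Sum>j\<leftarrow>x. of_bool (j = j0) :: real)"
      and dev: "\<bar>(\<Sum>j\<leftarrow>x. \<mu> j) - d * length x\<bar> \<le> \<eta> * length x"
    let ?Z = "\<lambda>j. partition_sum Q (\<lambda>k. - lam * \<rho> j k)" and ?T = "\<lambda>j. tilt Q (\<lambda>k. - lam * \<rho> j k)"
    let ?n = "real (length x)" and ?D = "((\<Sum>j\<leftarrow>x. \<mu> j) - d * length x)\<^sup>2 / length x"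
    have xne: "x \<noteq> []" using n0 by auto
    have Z1: "?Z j \<le> 1" for j using lam rho(1) by (intro partition_sum_le_1) (simp add: mult_nonneg_nonneg)
    have Tw: "w \<le> pmf (?T j) k" for j k
    proof -
      have "exp (- lam * rmax) \<le> exp (- lam * \<rho> j k)" using lam rho(2) by (simp add: mult_left_mono)
      then have "w \<le> pmf Q k * exp (- lam * \<rho> j k)" unfolding w_def using Q q0 by (intro mult_mono) auto
      also have "\<dots> \<le> pmf Q k * exp (- lam * \<rho> j k) / ?Z j"
        using Z1[of j] partition_sum_pos[of Q "\<lambda>k. - lam * \<rho> j k"]
        by (simp add: le_divide_eq mult_left_le)
      finally show ?thesis by (simp add: pmf_tilt)
    qed
    have mur: "0 \<le> \<mu> j" "\<mu> j \<le> rmax" for j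
    proof -
      show "0 \<le> \<mu> j" unfolding mu using rho(1) by (intro sum_nonneg mult_nonneg_nonneg) auto
      have "\<mu> j \<le> (\<Sum>k\<in>UNIV. pmf (?T j) k * rmax)" unfolding mu using rho(2) by (intro sum_mono mult_left_mono) auto
      then show "\<mu> j \<le> rmax" by (simp add: sum_distrib_right[symmetric] sum_pmf_eq_1)
    qed
    obtain Z0 where Z0: "bind_pmf Z0 (coins \<delta>) = map_pmf (\<rho> j0) (?T j0)"
      "finite (set_pmf Z0)" "\<And>v m. (v, m) \<in> set_pmf Z0 \<Longrightarrow> v \<in> range (\<rho> j0) \<and> m \<le> 1"
      "measure_pmf.expectation Z0 (\<lambda>z. real (snd z)) = 2 * w"
      "measure_pmf.expectation Z0 (\<lambda>z. fst z + \<delta> * real (snd z) / 2) = (\<Sum>i\<in>UNIV. pmf (?T j0) i * \<rho> j0 i)"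
      by (rule coin_split[of w "?T j0" k1 k2 "\<rho> j0" \<delta>]) (use w Tw jk in \<open>auto simp: \<delta>_def\<close>)
    define Zc where "Zc j = (if j = j0 then Z0 else map_pmf (\<lambda>k. (\<rho> j k, 0)) (?T j))" for j
    have "bind_pmf (Zc j) (coins \<delta>) = map_pmf (\<rho> j) (?T j)" for j
      by (simp add: Zc_def Z0(1) bind_map_pmf coins_def binomial_pmf_0) (simp add: map_pmf_def)
    moreover have "exp (- (C * (1 + ?D))) / sqrt ?n
        \<le> measure_pmf.prob (sum_pmf (\<lambda>j. bind_pmf (Zc j) (coins \<delta>)) x) {d * ?n - \<delta><..d * ?n}"
    proof (rule main[where \<gamma>="\<lambda>j. 2 * w * of_bool (j = j0)"])
      fix j show "finite (set_pmf (Zc j))" by (simp add: Zc_def Z0(2))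
    next
      fix j show "measure_pmf.expectation (Zc j) (\<lambda>z. fst z + \<delta> * real (snd z) / 2) = \<mu> j"
        by (simp add: Zc_def Z0(5) mu integral_measure_pmf_real[of UNIV] mult.commute)
    next
      fix j show "measure_pmf.expectation (Zc j) (\<lambda>z. real (snd z)) = 2 * w * of_bool (j = j0)"
        by (simp add: Zc_def Z0(4))
    next
      fix j z assume z: "z \<in> set_pmf (Zc j)"
      have "snd z \<le> 1 \<and> fst z \<in> range (\<rho> j)" using z Z0(3)[of "fst z" "snd z"] by (auto simp: Zc_def split: if_splits)
      then have s: "snd z \<le> 1" and f: "0 \<le> fst z" "fst z \<le> rmax" using rho by auto
      have "0 \<le> \<delta> * real (snd z) / 2" "\<delta> * real (snd z) / 2 \<le> rmax"
        using s \<delta> by (cases "snd z"; simp)+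
      then show "snd z \<le> 1 \<and> \<bar>fst z + \<delta> * real (snd z) / 2 - \<mu> j\<bar> \<le> 2 * rmax"
        using s f mur[of j] by (intro conjI abs_leI) linarith+
    next
      show "2 * w * \<theta> * ?n \<le> (\<Sum>j\<leftarrow>x. 2 * w * of_bool (j = j0))"
        using mult_left_mono[OF cnt, of "2 * w"] w by (simp add: sum_list_const_mult mult.assoc)
    qed (use n0 dev in auto)
    ultimately have P: "exp (- (C * (1 + ?D))) / sqrt ?n
        \<le> measure_pmf.prob (sum_pmf (\<lambda>j. map_pmf (\<rho> j) (?T j)) x) {d * ?n - \<delta><..d * ?n}" by simp
    have prod: "(\<Prod>j\<leftarrow>x. ?Z j) = exp (\<Sum>j\<leftarrow>x. ln (?Z j))"
      by (induction x) (auto simp: exp_add partition_sum_pos)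
    have "exp ((\<Sum>j\<leftarrow>x. ln (?Z j)) + lam * d * ?n - (C + lam * \<delta>) * (1 + ?D)) / sqrt ?n
      \<le> exp ((\<Sum>j\<leftarrow>x. ln (?Z j)) + lam * (d * ?n - \<delta>) + - (C * (1 + ?D))) / sqrt ?n"
    proof (intro divide_right_mono iffD2[OF exp_le_cancel_iff])
      have gen: "0 \<le> lam * \<delta> * D \<Longrightarrow> L + lam * d * n - (C + lam * \<delta>) * (1 + D)
          \<le> L + lam * (d * n - \<delta>) + - (C * (1 + D))" for L D n :: real
        by (simp add: algebra_simps)
      have "0 \<le> lam * \<delta> * ?D" using lam \<delta> by simp
      then show "(\<Sum>j\<leftarrow>x. ln (?Z j)) + lam * d * ?n - (C + lam * \<delta>) * (1 + ?D)
        \<le> (\<Sum>j\<leftarrow>x. ln (?Z j)) + lam * (d * ?n - \<delta>) + - (C * (1 + ?D))"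
        by (rule gen)
    qed simp
    also have "\<dots> = (\<Prod>j\<leftarrow>x. ?Z j) * exp (lam * (d * ?n - \<delta>)) * (exp (- (C * (1 + ?D))) / sqrt ?n)"
      unfolding prod exp_add by simp
    also have "\<dots> \<le> (\<Prod>j\<leftarrow>x. ?Z j) * exp (lam * (d * ?n - \<delta>)) *
        measure_pmf.prob (sum_pmf (\<lambda>j. map_pmf (\<rho> j) (?T j)) x) {d * ?n - \<delta><..d * ?n}"
      using P unfolding prod by (intro mult_left_mono) auto
    also have "\<dots> \<le> measure_pmf.prob (replicate_pmf (length x) Q) (distortion_ball d \<rho> x)"
      unfolding prob_distortion_ball[OF xne] by (rule tilting_lower_bound[OF lam])
    finally show "exp ((\<Sum>j\<leftarrow>x. ln (?Z j)) + lam * d * ?n - (C + lam * \<delta>) * (1 + ?D)) / sqrt ?n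
      \<le> measure_pmf.prob (replicate_pmf (length x) Q) (distortion_ball d \<rho> x)" .
  qed (use C in auto)
qed

section \<open>The mixture of product distributions\<close>

lemma sum_list_replicate_pmf:
  "map_pmf (\<lambda>x. \<Sum>j\<leftarrow>x. f j) (replicate_pmf n p) = sum_pmf (\<lambda>_. map_pmf f p) (replicate n ())"
  for f :: "'a \<Rightarrow> real"
proof (induction n)
  case (Suc n)
  have "map_pmf (\<lambda>x. \<Sum>j\<leftarrow>x. f j) (replicate_pmf (Suc n) p)
    = bind_pmf p (\<lambda>j. map_pmf ((+) (f j)) (map_pmf (\<lambda>x. \<Sum>j\<leftarrow>x. f j) (replicate_pmf n p)))"
    by (simp add: map_bind_pmf map_pmf_def[symmetric] map_pmf_comp)
  then show ?case by (simp add: Suc bind_map_pmf)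
qed simp

lemma expectation_sum_pmf:
  fixes V :: "'a \<Rightarrow> real pmf"
  assumes fin: "\<And>j. finite (set_pmf (V j))"
    and mean: "\<And>j. measure_pmf.expectation (V j) (\<lambda>v. v) = \<mu> j"
  shows "measure_pmf.expectation (sum_pmf V x) (\<lambda>s. s) = (\<Sum>j\<leftarrow>x. \<mu> j)"
proof (induction x)
  case (Cons j x)
  note [simp] = integrable_measure_pmf_finite[OF fin]
    integrable_measure_pmf_finite[OF finite_set_sum_pmf, OF fin]
  show ?case
    using finite_set_sum_pmf[of V, OF fin] by (simp add: expectation_bind_finite fin Cons mean)
qed simp

lemma finite_set_replicate_pmf: "finite (set_pmf (replicate_pmf n (p :: 'a::finite pmf)))"
proof (rule finite_subset)
  show "set_pmf (replicate_pmf n p) \<subseteq> {xs. set xs \<subseteq> UNIV \<and> length xs = n}"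
    by (auto simp: set_replicate_pmf)
  show "finite {xs :: 'a list. set xs \<subseteq> UNIV \<and> length xs = n}" by (rule finite_lists_length_eq) simp
qed

lemma expectation_sum_replicate_pmf:
  fixes p :: "'a::finite pmf" and f :: "'a \<Rightarrow> real"
  shows "measure_pmf.expectation (replicate_pmf n p) (\<lambda>x. \<Sum>j\<leftarrow>x. f j) = n * (\<Sum>j\<in>UNIV. pmf p j * f j)"
proof -
  have "measure_pmf.expectation (replicate_pmf n p) (\<lambda>x. \<Sum>j\<leftarrow>x. f j)
      = measure_pmf.expectation (sum_pmf (\<lambda>_. map_pmf f p) (replicate n ())) (\<lambda>s. s)"
    unfolding sum_list_replicate_pmf[symmetric] by simp
  also have "\<dots> = (\<Sum>j\<leftarrow>replicate n (). \<Sum>j\<in>UNIV. pmf p j * f j)"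
    by (rule expectation_sum_pmf) (auto simp: integral_measure_pmf_real[of UNIV] mult.commute)
  finally show ?thesis by (simp add: sum_list_replicate)
qed

lemma second_moment_replicate_pmf:
  fixes p :: "'a::finite pmf" and f :: "'a \<Rightarrow> real"
  defines "m \<equiv> (\<Sum>j\<in>UNIV. pmf p j * f j)"
  assumes "\<And>j. \<bar>f j - m\<bar> \<le> B"
  shows "measure_pmf.expectation (replicate_pmf n p) (\<lambda>x. ((\<Sum>j\<leftarrow>x. f j) - a)\<^sup>2) \<le> B\<^sup>2 * n + (n * m - a)\<^sup>2"
proof -
  have "measure_pmf.expectation (replicate_pmf n p) (\<lambda>x. ((\<Sum>j\<leftarrow>x. f j) - a)\<^sup>2)
      = measure_pmf.expectation (sum_pmf (\<lambda>_. map_pmf f p) (replicate n ())) (\<lambda>s. (s - a)\<^sup>2)"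
    unfolding sum_list_replicate_pmf[symmetric] by simp
  also have "\<dots> \<le> B\<^sup>2 * length (replicate n ()) + ((\<Sum>j\<leftarrow>replicate n (). m) - a)\<^sup>2"
    by (rule second_moment_sum_pmf) (use assms(2) in \<open>auto simp: m_def integral_measure_pmf_real[of UNIV] mult.commute\<close>)
  finally show ?thesis by (simp add: sum_list_replicate)
qed

section \<open>The grid of distributions with a common denominator\<close>

definition grid :: "nat \<Rightarrow> 'b::finite pmf set" where
  "grid m = {Q. \<forall>k. \<exists>i. pmf Q k = real i / real m}"

text \<open>A distribution is determined by all but one of its probabilities. The exponent
  \<open>CARD('b) - 1\<close> matters, since each counted coordinate costs (ln n)/2 in the
  rate.\<close>

lemma
  assumes "0 < m"
  shows finite_grid: "finite (grid m :: 'b::finite pmf set)"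
    and card_grid_le: "card (grid m :: 'b pmf set) \<le> (m + 1) ^ (CARD('b) - 1)"
proof -
  define b0 :: 'b where "b0 = undefined"
  define \<phi> where "\<phi> Q = restrict (\<lambda>k. nat \<lfloor>real m * pmf Q k\<rfloor>) (UNIV - {b0})" for Q
  let ?F = "PiE (UNIV - {b0}) (\<lambda>_. {0..m})"
  have img: "\<phi> ` grid m \<subseteq> ?F"
  proof -
    have "nat \<lfloor>real m * pmf Q k\<rfloor> \<le> m" for Q :: "'b pmf" and k
      using mult_left_le[OF pmf_le_1[of Q k], of "real m"] by linarith
    then show ?thesis by (auto simp: \<phi>_def intro!: restrict_PiE_iff[THEN iffD2])
  qed
  have inj: "inj_on \<phi> (grid m)"
  proof (rule inj_onI)
    fix Q Q' :: "'b pmf" assume Q: "Q \<in> grid m" "Q' \<in> grid m" and eq: "\<phi> Q = \<phi> Q'"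
    have val: "real (nat \<lfloor>real m * pmf P k\<rfloor>) = real m * pmf P k" if P: "P \<in> grid m" for P :: "'b pmf" and k
    proof -
      obtain i where "pmf P k = real i / real m" using P by (auto simp: grid_def)
      then show ?thesis using assms by simp
    qed
    have ne: "pmf Q k = pmf Q' k" if "k \<noteq> b0" for k
    proof -
      have "nat \<lfloor>real m * pmf Q k\<rfloor> = nat \<lfloor>real m * pmf Q' k\<rfloor>"
        using fun_cong[OF eq, of k] that by (simp add: \<phi>_def)
      then have "real m * pmf Q k = real m * pmf Q' k" using val[OF Q(1), of k] val[OF Q(2), of k] by metis
      then show ?thesis using assms by simp
    qed
    have tot: "pmf P b0 = 1 - (\<Sum>k\<in>UNIV - {b0}. pmf P k)" for P
      using sum_pmf_eq_1[of UNIV P] by (simp add: sum.remove[of UNIV b0])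
    have "pmf Q b0 = pmf Q' b0" unfolding tot using ne by simp
    then show "Q = Q'" using ne by (intro pmf_eqI) metis
  qed
  have fin: "finite ?F" by (intro finite_PiE) auto
  show "finite (grid m :: 'b pmf set)" by (rule inj_on_finite[OF inj img fin])
  have "card (grid m :: 'b pmf set) \<le> card ?F" by (rule card_inj_on_le[OF inj img fin])
  also have "\<dots> = (m + 1) ^ (CARD('b) - 1)" by (simp add: card_PiE card_Diff_subset)
  finally show "card (grid m :: 'b pmf set) \<le> (m + 1) ^ (CARD('b) - 1)" .
qed

lemma uniform_in_grid: "0 < l \<Longrightarrow> pmf_of_set UNIV \<in> (grid (CARD('b) * l) :: 'b::finite pmf set)"
  by (auto simp: grid_def intro!: exI[of _ l])

text \<open>All probabilities but one are rounded down, and the last takes the remainder. It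
  collects the errors of the others, hence the factor \<open>CARD('b)\<close>.\<close>

lemma grid_approximation:
  fixes Q :: "'b::finite pmf"
  assumes m: "0 < m"
  obtains Q' where "Q' \<in> grid m" "\<And>k. \<bar>pmf Q' k - pmf Q k\<bar> \<le> CARD('b) / m"
proof -
  define b0 :: 'b where "b0 = undefined"
  let ?U = "UNIV - {b0}"
  define h where "h k = nat \<lfloor>real m * pmf Q k\<rfloor>" for k
  have h: "real (h k) \<le> real m * pmf Q k" "real m * pmf Q k \<le> real (h k) + 1" for k
    unfolding h_def by (simp_all add: le_floor_iff)
  have tot: "pmf Q b0 = 1 - (\<Sum>k\<in>?U. pmf Q k)"
    using sum_pmf_eq_1[of UNIV Q] by (simp add: sum.remove[of UNIV b0])
  have "real (\<Sum>k\<in>?U. h k) \<le> (\<Sum>k\<in>?U. real m * pmf Q k)" unfolding of_nat_sum by (intro sum_mono h)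
  also have "\<dots> \<le> (\<Sum>k\<in>UNIV. real m * pmf Q k)" by (intro sum_mono2) auto
  also have "\<dots> = real m" by (simp add: sum_distrib_left[symmetric] sum_pmf_eq_1)
  finally have hm: "(\<Sum>k\<in>?U. h k) \<le> m" by linarith
  define g where "g k = (if k = b0 then m - (\<Sum>k\<in>?U. h k) else h k)" for k
  have gsum: "(\<Sum>k\<in>UNIV. g k) = m"
  proof -
    have "(\<Sum>k\<in>UNIV. g k) = g b0 + (\<Sum>k\<in>?U. g k)" by (simp add: sum.remove[of UNIV b0])
    also have "(\<Sum>k\<in>?U. g k) = (\<Sum>k\<in>?U. h k)" by (intro sum.cong) (auto simp: g_def)
    finally show ?thesis using hm by (simp add: g_def)
  qed
  define Q' where "Q' = embed_pmf (\<lambda>k. real (g k) / real m)"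
  have Q': "pmf Q' k = real (g k) / real m" for k
    unfolding Q'_def
  proof (subst pmf_embed_pmf)
    have "(\<Sum>k\<in>UNIV. real (g k) / real m) = 1"
      using gsum m by (simp add: sum_divide_distrib[symmetric] of_nat_sum[symmetric] del: of_nat_sum)
    then show "(\<integral>\<^sup>+ x. ennreal (real (g x) / real m) \<partial>count_space UNIV) = 1"
      by (simp add: nn_integral_count_space_finite)
  qed auto
  have K: "1 \<le> real CARD('b)" by (simp add: Suc_le_eq)
  have ne: "\<bar>pmf Q' k - pmf Q k\<bar> \<le> 1 / m" if "k \<noteq> b0" for k
  proof -
    have "pmf Q' k - pmf Q k = (real (h k) - real m * pmf Q k) / m"
      using m that by (simp add: Q' g_def field_simps)
    moreover have "\<bar>real (h k) - real m * pmf Q k\<bar> / m \<le> 1 / m"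
      using h[of k] by (intro divide_right_mono) auto
    ultimately show ?thesis by simp
  qed
  show ?thesis
  proof (rule that)
    show "Q' \<in> grid m" by (auto simp: grid_def Q')
    fix k
    show "\<bar>pmf Q' k - pmf Q k\<bar> \<le> CARD('b) / m"
    proof (cases "k = b0")
      case False
      have "\<bar>pmf Q' k - pmf Q k\<bar> \<le> 1 / m" by (rule ne[OF False])
      also have "\<dots> \<le> CARD('b) / m" using K by (intro divide_right_mono) auto
      finally show ?thesis .
    next
      case True
      have tot': "pmf Q' b0 = 1 - (\<Sum>k\<in>?U. pmf Q' k)"
        using sum_pmf_eq_1[of UNIV Q'] by (simp add: sum.remove[of UNIV b0])
      have "\<bar>pmf Q' b0 - pmf Q b0\<bar> = \<bar>\<Sum>k\<in>?U. pmf Q' k - pmf Q k\<bar>"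
        unfolding tot tot' by (simp add: sum_subtractf)
      also have "\<dots> \<le> (\<Sum>k\<in>?U. 1 / m)" by (rule order_trans[OF sum_abs sum_mono]) (use ne in auto)
      also have "\<dots> \<le> (\<Sum>k\<in>(UNIV :: 'b set). 1 / m)" by (intro sum_mono2) auto
      finally show ?thesis by (simp add: True)
    qed
  qed
qed

text \<open>The factor \<open>CARD('b)\<close> puts the uniform distribution into the grid, as
  needed for \<open>ball_prob_ge\<close>, and cancels the same factor in
  \<open>grid_approximation\<close>, leaving an error of at most 1/sqrt n.\<close>

definition grid_size :: "'b::finite itself \<Rightarrow> nat \<Rightarrow> nat" where
  "grid_size _ n = CARD('b) * nat \<lceil>sqrt (real n)\<rceil>"

definition word_mixture :: "nat \<Rightarrow> 'b::finite list pmf" where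
  "word_mixture n = bind_pmf (pmf_of_set (grid (grid_size TYPE('b) n))) (replicate_pmf n)"

definition ball_prob :: "real \<Rightarrow> ('a, 'b::finite) distortion \<Rightarrow> 'a list \<Rightarrow> real" where
  "ball_prob d \<rho> x = measure_pmf.prob (word_mixture (length x)) (distortion_ball d \<rho> x)"

abbreviation grid_card :: "'b::finite itself \<Rightarrow> nat \<Rightarrow> nat" where
  "grid_card _ n \<equiv> card (grid (grid_size TYPE('b) n) :: 'b pmf set)"

lemma grid_size_pos: "0 < n \<Longrightarrow> 0 < grid_size TYPE('b::finite) n"
  by (simp add: grid_size_def)

lemma grid_card_pos: "0 < n \<Longrightarrow> 0 < grid_card TYPE('b::finite) n"
  using uniform_in_grid[of "nat \<lceil>sqrt (real n)\<rceil>", where 'b='b] finite_grid[OF grid_size_pos[of n]]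
  by (auto simp: card_gt_0_iff grid_size_def)

lemma word_mixture_ge:
  assumes "0 < n" "Q \<in> grid (grid_size TYPE('b) n)"
  shows "measure_pmf.prob (replicate_pmf n Q) A / grid_card TYPE('b::finite) n
    \<le> measure_pmf.prob (word_mixture n :: 'b list pmf) A"
proof -
  let ?G = "grid (grid_size TYPE('b) n) :: 'b pmf set"
  have fin: "finite ?G" by (rule finite_grid[OF grid_size_pos[OF assms(1)]])
  have "measure_pmf.prob (replicate_pmf n Q) A \<le> (\<Sum>Q\<in>?G. measure_pmf.prob (replicate_pmf n Q) A)"
    by (rule member_le_sum) (use assms fin in auto)
  then have "measure_pmf.prob (replicate_pmf n Q) A / card ?G \<le> (\<Sum>Q\<in>?G. measure_pmf.prob (replicate_pmf n Q) A) / card ?G"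
    by (rule divide_right_mono) simp
  also have "\<dots> = measure_pmf.prob (word_mixture n) A"
    unfolding word_mixture_def prob_bind_pmf using assms(2) fin by (subst integral_pmf_of_set) auto
  finally show ?thesis .
qed

lemma set_word_mixture: "0 < n \<Longrightarrow> set_pmf (word_mixture n :: 'b::finite list pmf) \<subseteq> words n"
  by (auto simp: word_mixture_def set_replicate_pmf words_def)

lemma ln_grid_card_le:
  assumes "1 \<le> n"
  shows "ln (grid_card TYPE('b::finite) n) \<le> (real CARD('b) - 1) * (ln (2 * CARD('b) + 1) + ln n / 2)"
proof -
  have K: "1 \<le> CARD('b)" by (simp add: Suc_le_eq)
  have s1: "1 \<le> sqrt (real n)" using assms by simp
  have "real (nat \<lceil>sqrt (real n)\<rceil>) \<le> 2 * sqrt n" using s1 by linarith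
  then have "real (grid_size TYPE('b) n) \<le> real CARD('b) * (2 * sqrt n)"
    unfolding grid_size_def of_nat_mult by (intro mult_left_mono) auto
  with s1 have "real (grid_size TYPE('b) n) + 1 \<le> real CARD('b) * (2 * sqrt n) + sqrt n" by (rule add_mono[rotated])
  then have s: "real (grid_size TYPE('b) n + 1) \<le> (2 * real CARD('b) + 1) * sqrt n" by (simp add: ring_distribs)
  have "real (grid_card TYPE('b) n) \<le> real ((grid_size TYPE('b) n + 1) ^ (CARD('b) - 1))"
    using card_grid_le[OF grid_size_pos[of n], where 'b='b] assms by (subst of_nat_le_iff) auto
  also have "\<dots> \<le> ((2 * real CARD('b) + 1) * sqrt n) ^ (CARD('b) - 1)"
    unfolding of_nat_power by (intro power_mono s) simp
  finally have "ln (grid_card TYPE('b) n) \<le> ln (((2 * real CARD('b) + 1) * sqrt n) ^ (CARD('b) - 1))"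
    using grid_card_pos[of n, where 'b='b] assms by simp
  also have "\<dots> = (real CARD('b) - 1) * (ln (2 * CARD('b) + 1) + ln n / 2)"
    using assms K by (simp add: ln_realpow ln_mult ln_sqrt of_nat_diff add.commute)
  finally show ?thesis .
qed

lemma uniform_ball_prob_ge:
  fixes \<rho> :: "('a, 'b::finite) distortion"
  assumes "\<And>j. \<exists>k. \<rho> j k = 0" "0 \<le> a"
  shows "1 / real CARD('b) ^ length x \<le> measure_pmf.prob (sum_pmf (\<lambda>j. map_pmf (\<rho> j) (pmf_of_set UNIV)) x) {..a}"
proof (induction x)
  case Nil show ?case using assms(2) by (simp add: indicator_def)
next
  case (Cons j x)
  let ?S = "sum_pmf (\<lambda>j. map_pmf (\<rho> j) (pmf_of_set UNIV)) x"
  obtain k where k: "\<rho> j k = 0" using assms(1) by blast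
  have "1 / real CARD('b) ^ length (j # x) = pmf (pmf_of_set UNIV) k * (1 / real CARD('b) ^ length x)" by simp
  also have "\<dots> \<le> pmf (pmf_of_set UNIV) k * measure_pmf.prob ?S {s. \<rho> j k + s \<in> {..a}}"
    using Cons by (intro mult_left_mono) (auto simp: k atMost_def)
  also have "\<dots> \<le> (\<Sum>k\<in>UNIV. pmf (pmf_of_set UNIV) k * measure_pmf.prob ?S {s. \<rho> j k + s \<in> {..a}})"
    by (rule member_le_sum) auto
  finally show ?case unfolding prob_sum_pmf_Cons .
qed

text \<open>The uniform distribution lies in the grid and picks, for each letter, an output of
  distortion 0 with probability at least 1 / \<open>CARD('b)\<close>. This crude bound covers every
  nonempty word and every distortion measure; it fixes the number of draws and handles atypical
  words.\<close>

lemma ball_prob_ge: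
  fixes \<rho> :: "('a, 'b::finite) distortion"
  assumes "\<And>j. \<exists>k. \<rho> j k = 0" "0 \<le> d" "x \<noteq> []"
  shows "1 / (real CARD('b) ^ length x * grid_card TYPE('b) (length x)) \<le> ball_prob d \<rho> x"
proof -
  have n: "0 < length x" using assms by simp
  have "1 / real CARD('b) ^ length x \<le> measure_pmf.prob (replicate_pmf (length x) (pmf_of_set UNIV)) (distortion_ball d \<rho> x)"
    unfolding prob_distortion_ball[OF assms(3)] by (rule uniform_ball_prob_ge) (use assms in auto)
  then have "1 / real CARD('b) ^ length x / grid_card TYPE('b) (length x) \<le>
      measure_pmf.prob (replicate_pmf (length x) (pmf_of_set UNIV)) (distortion_ball d \<rho> x) / grid_card TYPE('b) (length x)"
    by (rule divide_right_mono) simp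
  also have "\<dots> \<le> ball_prob d \<rho> x" unfolding ball_prob_def
    using n uniform_in_grid[of "nat \<lceil>sqrt (length x)\<rceil>", where 'b='b]
    by (intro word_mixture_ge) (auto simp: grid_size_def)
  finally show ?thesis by simp
qed

section \<open>Random list codes\<close>

definition binary_digits :: "nat \<Rightarrow> nat \<Rightarrow> bool list" where
  "binary_digits w a = map (bit a) [0..<w]"

lemma length_binary_digits [simp]: "length (binary_digits w a) = w"
  by (simp add: binary_digits_def)

lemma binary_digits_inject:
  assumes "a < 2 ^ w" "b < 2 ^ w" "binary_digits w a = binary_digits w b"
  shows "a = b"
proof -
  have "bit a i = bit b i" if "i < w" for i
    using arg_cong[OF assms(3), of "\<lambda>l. l ! i"] that by (simp add: binary_digits_def)
  then have "take_bit w a = take_bit w b" by (intro bit_eqI) (auto simp: bit_take_bit_iff)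
  then show ?thesis using assms(1,2) by (simp add: take_bit_nat_eq_self)
qed

text \<open>Prefix-free because the first \<open>w\<close> digits determine the length of the rest.\<close>

definition index_code :: "nat \<Rightarrow> nat \<Rightarrow> bool list" where
  "index_code w i = binary_digits w (floor_log (i + 1)) @
     binary_digits (floor_log (i + 1)) (i + 1 - 2 ^ floor_log (i + 1))"

lemma length_index_code: "length (index_code w i) = w + floor_log (i + 1)"
  by (simp add: index_code_def)

lemma index_code_prefix_inject:
  assumes "prefix (index_code w i) (index_code w j)" "floor_log (i + 1) < 2 ^ w" "floor_log (j + 1) < 2 ^ w"
  shows "i = j"
proof -
  let ?b = "\<lambda>i. floor_log (i + 1)"
  obtain zs where zs: "index_code w j = index_code w i @ zs" using assms(1) by (auto simp: prefix_def)
  have "take w (index_code w j) = take w (index_code w i @ zs)" using zs by simp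
  then have "binary_digits w (?b j) = binary_digits w (?b i)" by (simp add: index_code_def)
  then have b: "?b j = ?b i" using binary_digits_inject assms by blast
  have "length (index_code w j) = length (index_code w i)" by (simp only: length_index_code b)
  then have "index_code w j = index_code w i" using zs by simp
  then have "binary_digits (?b i) (j + 1 - 2 ^ ?b i) = binary_digits (?b i) (i + 1 - 2 ^ ?b i)"
    unfolding index_code_def b by simp
  moreover have "i + 1 - 2 ^ ?b i < 2 ^ ?b i" "j + 1 - 2 ^ ?b i < 2 ^ ?b i"
    using floor_log_exp2_gt[of "i + 1"] floor_log_exp2_gt[of "j + 1"] unfolding b by linarith+
  ultimately have "j + 1 - 2 ^ ?b i = i + 1 - 2 ^ ?b i" using binary_digits_inject by blast
  moreover have "2 ^ ?b i \<le> i + 1" "2 ^ ?b i \<le> j + 1"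
    using floor_log_exp2_le[of "i + 1"] floor_log_exp2_le[of "j + 1"] unfolding b by linarith+
  ultimately show ?thesis by linarith
qed

lemma floor_log_ln_le: "real (floor_log (i + 1)) * ln 2 \<le> ln (real i + 1)"
proof -
  have "real (2 ^ floor_log (i + 1)) \<le> real (i + 1)" using floor_log_exp2_le[of "i + 1"] by (subst of_nat_le_iff) simp
  then have "ln (2 ^ floor_log (i + 1)) \<le> ln (real i + 1)" by (subst ln_le_cancel_iff) (auto simp: add.commute)
  then show ?thesis by (simp add: ln_realpow)
qed

section \<open>Position of the first match in a list\<close>

definition position :: "('c \<Rightarrow> bool) \<Rightarrow> 'c list \<Rightarrow> nat" where
  "position P L = length (takeWhile (\<lambda>y. \<not> P y) L)"

definition first_match :: "('c \<Rightarrow> bool) \<Rightarrow> 'c list \<Rightarrow> 'c" where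
  "first_match P L = hd (dropWhile (\<lambda>y. \<not> P y) L)"

lemma position_simps [simp]:
  "position P [] = 0" "position P (a # L) = (if P a then 0 else Suc (position P L))"
  by (auto simp: position_def)

lemma first_match_simps [simp]:
  "first_match P (a # L) = (if P a then a else first_match P L)"
  by (auto simp: first_match_def)

text \<open>The third fact controls the rate: the encoder sees only the chosen word and sends the
  position of its first occurrence, which is not later than the first match.\<close>

lemma first_match:
  assumes "\<exists>y\<in>set L. P y"
  shows "P (first_match P L)" "first_match P L \<in> set L"
    "position ((=) (first_match P L)) L \<le> position P L" "position P L < length L"
  using assms by (induction L) auto

lemma position_eq_inject:
  assumes "y \<in> set L" "z \<in> set L" "position ((=) y) L = position ((=) z) L"
  shows "y = z"
  using assms by (induction L) (auto split: if_splits)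

text \<open>With success probability q, one more draw turns the expectation E into 1 + (1 - q) E.
  The fixed point is 1/q, and the initial error, at most \<open>N\<close>, shrinks by the factor 1 -
  q with every draw.\<close>

lemma expected_position_le:
  fixes D :: "'c pmf"
  assumes fin: "finite (set_pmf D)" and q: "0 < measure_pmf.prob D {y. P y}"
    and N: "real (position P en) + 1 \<le> N"
  shows "measure_pmf.expectation (replicate_pmf M D) (\<lambda>ys. real (position P (ys @ en)) + 1)
    \<le> 1 / measure_pmf.prob D {y. P y} + (1 - measure_pmf.prob D {y. P y}) ^ M * N"
proof (induction M)
  case 0
  show ?case using N q by (simp add: add_increasing)
next
  case (Suc M)
  let ?q = "measure_pmf.prob D {y. P y}" and ?E = "measure_pmf.expectation (replicate_pmf M D) (\<lambda>ys. real (position P (ys @ en)) + 1)"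
  have finr: "finite (set_pmf (replicate_pmf M D))"
    by (rule finite_subset[of _ "{xs. set xs \<subseteq> set_pmf D \<and> length xs = M}"])
      (auto simp: set_replicate_pmf fin intro!: finite_lists_length_eq)
  note [simp] = integrable_measure_pmf_finite[OF fin] integrable_measure_pmf_finite[OF finr]
  have "measure_pmf.expectation (replicate_pmf (Suc M) D) (\<lambda>ys. real (position P (ys @ en)) + 1)
    = measure_pmf.expectation D (\<lambda>y. measure_pmf.expectation (replicate_pmf M D) (\<lambda>ys. real (position P (y # ys @ en)) + 1))"
    by (simp add: expectation_bind_finite fin finr map_pmf_def[symmetric])
  also have "(\<lambda>y. measure_pmf.expectation (replicate_pmf M D) (\<lambda>ys. real (position P (y # ys @ en)) + 1))
    = (\<lambda>y. 1 + ?E - indicat_real {y. P y} y * ?E)"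
  proof
    fix y show "measure_pmf.expectation (replicate_pmf M D) (\<lambda>ys. real (position P (y # ys @ en)) + 1)
      = 1 + ?E - indicat_real {y. P y} y * ?E"
      by (cases "P y") (simp_all add: add.commute)
  qed
  also have "measure_pmf.expectation D (\<lambda>y. 1 + ?E - indicat_real {y. P y} y * ?E) = 1 + (1 - ?q) * ?E"
    by (simp add: algebra_simps)
  also have "\<dots> \<le> 1 + (1 - ?q) * (1 / ?q + (1 - ?q) ^ M * N)"
    by (intro add_left_mono mult_left_mono Suc) simp
  also have "\<dots> = 1 / ?q + (1 - ?q) ^ Suc M * N" using q by (simp add: field_simps)
  finally show ?case .
qed

section \<open>List codes as random semifaithful codes\<close>

lemma finite_words: "finite (words n :: 'c::finite list set)"
  using finite_lists_length_eq[of "UNIV :: 'c set" n] by (simp add: words_def)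

lemma card_words: "card (words n :: 'c::finite list set) = CARD('c) ^ n"
  using card_lists_length_eq[of "UNIV :: 'c set" n] by (simp add: words_def)

text \<open>The codebook is always the set of all words; the list \<open>L\<close> decides which
  word is chosen and how short its label is. \<open>decode\<close> inverts the labelling by choice,
  which is unambiguous once the labels are prefix-free.\<close>

definition list_code :: "nat \<Rightarrow> real \<Rightarrow> nat \<Rightarrow> 'b list list \<Rightarrow> ('a, 'b) code_triple" where
  "list_code n d w L = \<lparr>codebook = words n,
     quantize = (\<lambda>x \<rho>. first_match (\<lambda>y. y \<in> distortion_ball d \<rho> x) L),
     encode = (\<lambda>y. index_code w (position ((=) y) L)),
     decode = (\<lambda>s. SOME y. y \<in> words n \<and> index_code w (position ((=) y) L) = s)\<rparr>"

lemma distortion_ball_nonempty: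
  assumes "\<rho> \<in> distortions" "0 \<le> d"
  shows "\<exists>y\<in>words (length x). y \<in> distortion_ball d \<rho> x"
proof
  define z where "z j = (SOME k. \<rho> j k = 0)" for j
  have z: "\<rho> j (z j) = 0" for j using someI_ex[OF distortions_zero[OF assms(1), of j]] by (simp add: z_def)
  show "map z x \<in> words (length x)" by (simp add: words_def)
  show "map z x \<in> distortion_ball d \<rho> x" using assms(2) by (simp add: distortion_ball_def block_distortion_def z)
qed

text \<open>A list that contains every word leaves no input without a match, whatever the distortion
  measure, because each source word has a reproduction of distortion 0.\<close>

lemma list_code_semifaithful:
  fixes L :: "'b::finite list list"
  assumes d: "0 \<le> d" and L: "set L = words n" and w: "floor_log (length L) < 2 ^ w"
  shows "(list_code n d w L :: ('a::finite, 'b) code_triple) \<in> semifaithful_codes n d"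
proof -
  let ?c = "list_code n d w L :: ('a, 'b) code_triple" and ?pos = "\<lambda>y. position ((=) y) L"
  have lt: "?pos y < length L" if "y \<in> words n" for y
    using first_match(4)[of L "(=) y"] that by (auto simp: L)
  have log: "floor_log (?pos y + 1) < 2 ^ w" if "y \<in> words n" for y
    using floor_log_le_iff[of "?pos y + 1" "length L"] lt[OF that] w by simp
  have inj: "y = z" if "y \<in> words n" "z \<in> words n" "prefix (index_code w (?pos y)) (index_code w (?pos z))" for y z
    using index_code_prefix_inject[OF that(3) log[OF that(1)] log[OF that(2)]] position_eq_inject[of y L z] that
    by (simp add: L)
  have quant: "quantize ?c x \<rho> \<in> words n" "quantize ?c x \<rho> \<in> distortion_ball d \<rho> x"
    if "x \<in> words n" "\<rho> \<in> distortions" for x \<rho>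
  proof -
    have "\<exists>y\<in>set L. y \<in> distortion_ball d \<rho> x"
      using distortion_ball_nonempty[OF that(2) d, of x] that(1) by (simp add: L words_def)
    from first_match(1,2)[OF this] show "quantize ?c x \<rho> \<in> words n" "quantize ?c x \<rho> \<in> distortion_ball d \<rho> x"
      by (simp_all add: list_code_def L)
  qed
  have dec: "decode ?c (encode ?c y) = y" if "y \<in> words n" for y
  proof -
    have "(SOME z. z \<in> words n \<and> index_code w (?pos z) = index_code w (?pos y)) = y"
      using that inj by (intro some_equality) auto
    then show ?thesis by (simp add: list_code_def)
  qed
  have "prefix_free (encode ?c ` codebook ?c)"
    unfolding prefix_free_def list_code_def using inj by auto
  moreover have "block_distortion n \<rho> x (quantize ?c x \<rho>) \<le> d" if "x \<in> words n" "\<rho> \<in> distortions" for x \<rho>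
    using quant(2)[OF that] that(1) by (simp add: distortion_ball_def words_def)
  moreover have "codebook ?c = words n" by (simp add: list_code_def)
  ultimately show ?thesis unfolding semifaithful_codes_def using quant(1) dec by auto
qed

lemma sets_code_space:
  "sets (code_space n d) = sigma_sets (semifaithful_codes n d) ({{c \<in> semifaithful_codes n d. y \<in> codebook c} |y. y \<in> words n} \<union>
      {{c \<in> semifaithful_codes n d. quantize c x \<rho> = y} |x \<rho> y.
         x \<in> words n \<and> \<rho> \<in> distortions \<and> y \<in> words n} \<union>
      {{c \<in> semifaithful_codes n d. y \<in> codebook c \<and> encode c y = s} |y s. y \<in> words n} \<union>
      {{c \<in> semifaithful_codes n d. s \<in> encode c ` codebook c \<and> decode c s = y} |s y.
         y \<in> words n})"
  and space_code_space: "space (code_space n d) = semifaithful_codes n d"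
  unfolding code_space_def by (subst sets_measure_of space_measure_of; auto)+

text \<open>Splitting by the finitely many values of the quantizer writes each preimage as a finite
  union of intersections of two generating events.\<close>

lemma measurable_codeword:
  assumes x: "x \<in> words n" and \<rho>: "\<rho> \<in> distortions"
  shows "(\<lambda>c :: ('a::finite, 'b::finite) code_triple. encode c (quantize c x \<rho>)) \<in> measurable (code_space n d) (count_space UNIV)"
proof (subst measurable_count_space_eq2_countable; (intro conjI ballI)?)
  fix s :: "bool list"
  let ?\<Omega> = "semifaithful_codes n d :: ('a, 'b) code_triple set"
  have "(\<lambda>c. encode c (quantize c x \<rho>)) -` {s} \<inter> space (code_space n d)
    = (\<Union>y\<in>words n. {c \<in> ?\<Omega>. quantize c x \<rho> = y} \<inter> {c \<in> ?\<Omega>. y \<in> codebook c \<and> encode c y = s})"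
    using x \<rho> by (auto simp: space_code_space semifaithful_codes_def)
  also have "\<dots> \<in> sets (code_space n d)"
  proof (intro sets.finite_UN finite_words sets.Int)
    fix y :: "'b list" assume y: "y \<in> words n"
    show "{c \<in> ?\<Omega>. quantize c x \<rho> = y} \<in> sets (code_space n d)"
      unfolding sets_code_space by (rule sigma_sets.Basic) (use x \<rho> y in blast)
    show "{c \<in> ?\<Omega>. y \<in> codebook c \<and> encode c y = s} \<in> sets (code_space n d)"
      unfolding sets_code_space by (rule sigma_sets.Basic) (use y in blast)
  qed
  finally show "(\<lambda>c. encode c (quantize c x \<rho>)) -` {s} \<inter> space (code_space n d) \<in> sets (code_space n d)" .
qed auto

lemma rate_redundancy_eq:
  fixes p :: "'a::finite pmf"
  shows "rate_redundancy n d c p \<rho> = 1 / real n *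
    (\<Sum>x\<in>words n. pmf (replicate_pmf n p) x * (real (length (encode c (quantize c x \<rho>))) * ln 2)) - rate_distortion p d \<rho>"
  unfolding rate_redundancy_def
  by (subst integral_measure_pmf_real[OF finite_words[of n]])
    (auto simp: set_replicate_pmf words_def mult.commute dest: set_pmf_iff[THEN iffD2])

lemma measurable_rate_redundancy:
  assumes "\<rho> \<in> distortions"
  shows "(\<lambda>c :: ('a::finite, 'b::finite) code_triple. rate_redundancy n d c p \<rho>) \<in> borel_measurable (code_space n d)"
proof -
  have "(\<lambda>c :: ('a, 'b) code_triple. real (length (encode c (quantize c x \<rho>)))) \<in> borel_measurable (code_space n d)"
    if "x \<in> words n" for x
    by (rule measurable_compose[OF measurable_codeword[OF that assms]]) simp
  then show ?thesis unfolding rate_redundancy_eq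
    by (intro borel_measurable_diff borel_measurable_times borel_measurable_sum borel_measurable_const)
qed

text \<open>Every set is measurable for a pmf, so \<open>T\<close> is measurable as soon as it maps
  all lists, even those outside the support, to codes.\<close>

lemma random_list_code:
  fixes D :: "'b::finite list list pmf"
  assumes fin: "finite (set_pmf D)"
    and code: "\<And>L. (T L :: ('a::finite, 'b) code_triple) \<in> semifaithful_codes n d"
  defines "C \<equiv> distr (measure_pmf D) (code_space n d) T"
  shows "random_semifaithful_code n d C"
    "\<rho> \<in> distortions \<Longrightarrow> integrable C (\<lambda>c. rate_redundancy n d c p \<rho>)"
    "\<rho> \<in> distortions \<Longrightarrow> (\<integral>c. rate_redundancy n d c p \<rho> \<partial>C) = measure_pmf.expectation D (\<lambda>L. rate_redundancy n d (T L) p \<rho>)"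
proof -
  have T: "T \<in> measurable (measure_pmf D) (code_space n d)"
    using code by (auto simp: measurable_def space_code_space)
  show "random_semifaithful_code n d C" unfolding random_semifaithful_code_def C_def
    using measure_pmf.prob_space_distr[OF T] by simp
  assume "\<rho> \<in> distortions"
  note f = measurable_rate_redundancy[OF this, of n d p]
  show "integrable C (\<lambda>c. rate_redundancy n d c p \<rho>)" unfolding C_def integrable_distr_eq[OF T f]
    by (rule integrable_measure_pmf_finite[OF fin])
  show "(\<integral>c. rate_redundancy n d c p \<rho> \<partial>C) = measure_pmf.expectation D (\<lambda>L. rate_redundancy n d (T L) p \<rho>)"
    unfolding C_def by (rule integral_distr[OF T f])
qed

text \<open>Instead of Jensen's inequality, the logarithm is bounded by its tangent at 1/q. The
  hypothesis on \<open>M\<close> bounds the leftover (1 - q)^M N of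
  \<open>expected_position_le\<close> by exp (- N) N, hence by 1.\<close>

lemma expected_ln_position_le:
  fixes D :: "'c pmf"
  assumes fin: "finite (set_pmf D)" and q: "0 < measure_pmf.prob D {y. P y}"
    and N: "real (position P en) + 1 \<le> N" and M: "N \<le> measure_pmf.prob D {y. P y} * M"
  shows "measure_pmf.expectation (replicate_pmf M D) (\<lambda>ys. ln (real (position P (ys @ en)) + 1))
    \<le> 1 - ln (measure_pmf.prob D {y. P y})"
proof -
  let ?q = "measure_pmf.prob D {y. P y}" and ?R = "replicate_pmf M D"
  let ?u = "\<lambda>ys. real (position P (ys @ en)) + 1"
  have finr: "finite (set_pmf ?R)"
    by (rule finite_subset[of _ "{xs. set xs \<subseteq> set_pmf D \<and> length xs = M}"])
      (auto simp: set_replicate_pmf fin intro!: finite_lists_length_eq)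
  note [simp] = integrable_measure_pmf_finite[OF finr]
  have "0 < N" using N by linarith
  have "(1 - ?q) ^ M \<le> exp (- ?q) ^ M"
    using exp_ge_add_one_self[of "- ?q"] by (intro power_mono) auto
  also have "\<dots> = exp (- (?q * M))" by (simp add: exp_of_nat_mult[symmetric] mult.commute)
  also have "\<dots> \<le> exp (- N)" using M by simp
  finally have "(1 - ?q) ^ M \<le> exp (- N)" .
  moreover have "N \<le> exp N" using exp_ge_add_one_self[of N] by linarith
  ultimately have "(1 - ?q) ^ M * N \<le> exp (- N) * exp N"
    using \<open>0 < N\<close> by (intro mult_mono) auto
  then have tail: "(1 - ?q) ^ M * N \<le> 1" by (simp add: exp_add[symmetric])
  have "measure_pmf.expectation ?R (\<lambda>ys. ln (?u ys)) \<le> measure_pmf.expectation ?R (\<lambda>ys. ?u ys * ?q - 1 - ln ?q)"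
  proof (rule integral_mono)
    fix ys
    have "ln (?u ys * ?q) \<le> ?u ys * ?q - 1" using q by (intro ln_le_minus_one) auto
    moreover have "ln (?u ys * ?q) = ln (?u ys) + ln ?q" using q by (subst ln_mult) auto
    ultimately show "ln (?u ys) \<le> ?u ys * ?q - 1 - ln ?q" by linarith
  qed auto
  also have "\<dots> = measure_pmf.expectation ?R ?u * ?q - 1 - ln ?q" by simp
  also have "measure_pmf.expectation ?R ?u * ?q \<le> (1 / ?q + (1 - ?q) ^ M * N) * ?q"
    by (intro mult_right_mono expected_position_le[OF fin q N]) simp
  also have "\<dots> \<le> (1 / ?q + 1) * ?q" using tail by (intro mult_right_mono) auto
  also have "\<dots> \<le> 2" using q measure_pmf.prob_le_1[of D "{y. P y}"] by (simp add: ring_distribs)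
  finally show ?thesis by simp
qed

text \<open>So many draws that the words appended after them do not contribute to the expected position of
  the first match, and still few enough for the list to be only exponentially long.\<close>

definition draws :: "'b::finite itself \<Rightarrow> nat \<Rightarrow> nat" where
  "draws _ n = grid_card TYPE('b) n * CARD('b) ^ (2 * n)"

text \<open>Enough digits to write the binary length of any index in the list. As the list is only
  exponentially long in \<open>n\<close>, this is log2 n + O(1) digits, that is, ln n + O(1)
  nats.\<close>

definition width :: "'b::finite itself \<Rightarrow> nat \<Rightarrow> nat" where
  "width _ n = Suc (floor_log (floor_log (draws TYPE('b) n + CARD('b) ^ n)))"

lemma width_le:
  obtains c :: real where "\<And>n. 1 \<le> n \<Longrightarrow> real (width TYPE('b::finite) n) * ln 2 \<le> ln n + c"
proof -
  let ?K = "real CARD('b)"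
  have K: "1 \<le> ?K" by (simp add: Suc_le_eq)
  \<comment> \<open>Slope of a linear bound for the binary length of the list size: ln 2 for the
    factor 2, the bracket for the grid and for the exponent \<open>2 * n\<close>, and the division
    by ln 2 for the change from nats to digits.\<close>
  define a where "a = (ln 2 + ((?K - 1) * (ln (2 * ?K + 1) + 1 / 2) + 2 * ln ?K)) / ln 2"
  have a: "0 \<le> a" unfolding a_def using K by (intro divide_nonneg_pos add_nonneg_nonneg mult_nonneg_nonneg) auto
  show ?thesis
  proof (rule that[of "ln 2 + ln (a + 1)"])
    fix n :: nat assume n: "1 \<le> n"
    let ?G = "real (grid_card TYPE('b) n)" and ?N = "draws TYPE('b) n + CARD('b) ^ n"
    have G: "1 \<le> ?G" using grid_card_pos[of n, where 'b='b] n by (simp add: Suc_le_eq)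
    have N0: "0 < ?N" by simp
    have N: "real ?N \<le> 2 * (?G * ?K ^ (2 * n))"
    proof -
      have "?K ^ n \<le> ?G * ?K ^ (2 * n)"
        using mult_mono[OF G power_increasing[of n "2 * n" ?K]] K by simp
      then show ?thesis by (simp add: draws_def)
    qed
    have "real (floor_log ?N) * ln 2 \<le> ln (real ?N)"
      using floor_log_ln_le[of "?N - 1"] N0 by (simp add: of_nat_diff Suc_leI)
    also have "\<dots> \<le> ln (2 * (?G * ?K ^ (2 * n)))"
    proof (subst ln_le_cancel_iff)
      show "0 < real ?N" using N0 by (simp only: of_nat_0_less_iff)
      with N show "0 < 2 * (?G * ?K ^ (2 * n))" by linarith
    qed (rule N)
    also have "\<dots> = ln 2 + (ln ?G + 2 * n * ln ?K)" using G K by (simp add: ln_mult ln_realpow)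
    also have "\<dots> \<le> ln 2 * n + ((?K - 1) * (ln (2 * ?K + 1) + 1 / 2) * n + 2 * n * ln ?K)"
    proof (intro add_mono)
      have "ln ?G \<le> (?K - 1) * (ln (2 * ?K + 1) + ln n / 2)" using ln_grid_card_le[OF n, where 'b='b] by (simp add: add.commute)
      also have "\<dots> \<le> (?K - 1) * (ln (2 * ?K + 1) * n + n / 2)"
      proof (intro mult_left_mono add_mono divide_right_mono)
        show "ln (2 * ?K + 1) \<le> ln (2 * ?K + 1) * n" using n K by (simp add: mult_ge1_I)
        show "ln n \<le> real n" using ln_le_minus_one[of "real n"] n by simp
      qed (use K in auto)
      also have "\<dots> = (?K - 1) * (ln (2 * ?K + 1) + 1 / 2) * n" by (simp add: algebra_simps)
      finally show "ln ?G \<le> (?K - 1) * (ln (2 * ?K + 1) + 1 / 2) * n" .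
    qed (use n in auto)
    also have "\<dots> = a * n * ln 2" by (simp add: a_def field_simps)
    finally have f: "real (floor_log ?N) \<le> a * n" by simp
    let ?f = "floor_log ?N"
    have "real (floor_log ?f) * ln 2 \<le> real (floor_log (?f + 1)) * ln 2"
      using floor_log_le_iff[of ?f "?f + 1"] by (intro mult_right_mono) auto
    also have "\<dots> \<le> ln (real ?f + 1)" by (rule floor_log_ln_le)
    also have "\<dots> \<le> ln ((a + 1) * n)"
    proof -
      have "real ?f + 1 \<le> (a + 1) * n" using f n by (simp add: ring_distribs)
      then show ?thesis by (subst ln_le_cancel_iff) (use n a in \<open>auto intro: order.strict_trans2\<close>)
    qed
    also have "\<dots> = ln (a + 1) + ln n" using n a by (simp add: ln_mult)
    finally show "real (width TYPE('b) n) * ln 2 \<le> ln n + (ln 2 + ln (a + 1))"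
      by (simp add: width_def ring_distribs)
  qed
qed

text \<open>The law of the code depends only on \<open>n\<close> and \<open>d\<close>, so one code
  serves all \<open>p\<close> and \<rho>. The three terms are the length field, the constant loss in
  the waiting time, and the logarithm of the waiting time itself.\<close>

lemma random_code_rate:
  assumes n: "1 \<le> n" and d: "0 \<le> d"
  obtains C :: "('a::finite, 'b::finite) code_triple measure" where
    "random_semifaithful_code n d C"
    "\<And>p \<rho>. \<rho> \<in> distortions \<Longrightarrow> integrable C (\<lambda>c. rate_redundancy n d c p \<rho>)"
    "\<And>p \<rho>. \<rho> \<in> distortions \<Longrightarrow> (\<integral>c. rate_redundancy n d c p \<rho> \<partial>C) \<le>
      1 / n * (real (width TYPE('b) n) * ln 2 + 1 + measure_pmf.expectation (replicate_pmf n p) (\<lambda>x. - ln (ball_prob d \<rho> x)))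
      - rate_distortion p d \<rho>"
proof -
  let ?M = "draws TYPE('b) n" and ?w = "width TYPE('b) n" and ?K = "real CARD('b)"
  let ?G = "real (grid_card TYPE('b) n)"
  let ?mix = "word_mixture n :: 'b list pmf"
  have G: "0 < ?G" using grid_card_pos[of n, where 'b='b] n by simp
  obtain en :: "'b list list" where en: "set en = words n" "distinct en"
    using finite_distinct_list[OF finite_words] by blast
  have len: "length en = CARD('b) ^ n" using distinct_card[OF en(2)] by (simp add: en(1) card_words)
  have wid: "floor_log (?M + CARD('b) ^ n) < 2 ^ ?w"
    using floor_log_exp2_gt[of "floor_log (?M + CARD('b) ^ n)"] by (simp add: width_def)
  have wen: "floor_log (length en) < 2 ^ ?w"
    using floor_log_le_iff[of "length en" "?M + CARD('b) ^ n"] wid len by simp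
  \<comment> \<open>Lists that do not qualify are replaced by \<open>en\<close>, since
    \<open>random_list_code\<close> asks for a code on every list; no list of positive probability
    is affected.\<close>
  define T :: "'b list list \<Rightarrow> ('a, 'b) code_triple" where
    "T L = list_code n d ?w (if set L = words n \<and> floor_log (length L) < 2 ^ ?w then L else en)" for L
  have T: "T L \<in> semifaithful_codes n d" for L
    unfolding T_def by (rule list_code_semifaithful[OF d]) (use en wen in auto)
  have fmix: "finite (set_pmf ?mix)"
    by (rule finite_subset[OF set_word_mixture finite_words]) (use n in simp)
  let ?R = "replicate_pmf ?M ?mix"
  have fR: "finite (set_pmf ?R)"
    by (rule finite_subset[of _ "{xs. set xs \<subseteq> set_pmf ?mix \<and> length xs = ?M}"])
      (auto simp: set_replicate_pmf fmix intro!: finite_lists_length_eq)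
  note [simp] = integrable_measure_pmf_finite[OF fR]
  define D where "D = map_pmf (\<lambda>ys. ys @ en) ?R"
  have fD: "finite (set_pmf D)" using fR by (simp add: D_def)
  show ?thesis
  proof (rule that[of "distr (measure_pmf D) (code_space n d) T"])
    show "random_semifaithful_code n d (distr (measure_pmf D) (code_space n d) T)"
      by (rule random_list_code(1)[OF fD T])
  next
    fix p :: "'a pmf" and \<rho> :: "('a, 'b) distortion" assume \<rho>: "\<rho> \<in> distortions"
    show "integrable (distr (measure_pmf D) (code_space n d) T) (\<lambda>c. rate_redundancy n d c p \<rho>)"
      by (rule random_list_code(2)[OF fD T \<rho>])
    let ?len = "\<lambda>ys x. real (length (encode (T (ys @ en)) (quantize (T (ys @ en)) x \<rho>))) * ln 2"
    have key: "measure_pmf.expectation ?R (\<lambda>ys. ?len ys x) \<le> real ?w * ln 2 + 1 - ln (ball_prob d \<rho> x)"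
      if x: "x \<in> words n" for x
    proof -
      have lx: "length x = n" "x \<noteq> []" using x n by (auto simp: words_def)
      let ?P = "\<lambda>y. y \<in> distortion_ball d \<rho> x"
      have q: "measure_pmf.prob ?mix {y. ?P y} = ball_prob d \<rho> x" by (simp add: ball_prob_def lx)
      have qge: "1 / (?K ^ n * ?G) \<le> ball_prob d \<rho> x"
        using ball_prob_ge[of \<rho> d x] distortions_zero[OF \<rho>] d lx by simp
      then have qpos: "0 < ball_prob d \<rho> x" using G by (auto intro: order.strict_trans2[rotated])
      have ex: "\<exists>y\<in>set (ys @ en). ?P y" for ys
        using distortion_ball_nonempty[OF \<rho> d, of x] by (auto simp: en(1) lx)
      have "position ?P en < length en" using first_match(4)[of en ?P] ex[of "[]"] by simp
      then have N: "real (position ?P en) + 1 \<le> ?K ^ n" unfolding len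
        by (metis Suc_eq_plus1 Suc_leI of_nat_1 of_nat_add of_nat_le_iff of_nat_power)
      \<comment> \<open>\<open>draws\<close> is \<open>CARD('b) ^ n\<close> divided by the lower
        bound for the ball probability, which is what \<open>expected_ln_position_le\<close> asks
        for.\<close>
      have "?K ^ n = 1 / (?K ^ n * ?G) * ?M" using G by (simp add: draws_def power_add mult_2)
      also have "\<dots> \<le> ball_prob d \<rho> x * ?M" by (intro mult_right_mono qge) simp
      finally have M: "?K ^ n \<le> ball_prob d \<rho> x * ?M" .
      have "measure_pmf.expectation ?R (\<lambda>ys. ?len ys x) \<le>
        measure_pmf.expectation ?R (\<lambda>ys. real ?w * ln 2 + ln (real (position ?P (ys @ en)) + 1))"
      proof (rule integral_mono_AE)
        show "AE ys in ?R. ?len ys x \<le> real ?w * ln 2 + ln (real (position ?P (ys @ en)) + 1)"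
        proof (rule AE_pmfI)
          fix ys assume "ys \<in> set_pmf ?R"
          then have ys: "set ys \<subseteq> words n" "length ys = ?M"
            using set_word_mixture[of n, where 'b='b] n by (auto simp: set_replicate_pmf)
          let ?L = "ys @ en"
          have TL: "T ?L = list_code n d ?w ?L" using ys wid by (auto simp: T_def en(1) len)
          let ?i = "position ((=) (first_match ?P ?L)) ?L"
          have "?len ys x = real ?w * ln 2 + real (floor_log (?i + 1)) * ln 2"
            unfolding TL by (simp add: list_code_def length_index_code ring_distribs)
          also have "\<dots> \<le> real ?w * ln 2 + ln (real ?i + 1)" by (intro add_left_mono floor_log_ln_le)
          also have "\<dots> \<le> real ?w * ln 2 + ln (real (position ?P ?L) + 1)"
            using first_match(3)[OF ex, of ys] by simp
          finally show "?len ys x \<le> real ?w * ln 2 + ln (real (position ?P (ys @ en)) + 1)" .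
        qed
      qed auto
      also have "\<dots> = real ?w * ln 2 + measure_pmf.expectation ?R (\<lambda>ys. ln (real (position ?P (ys @ en)) + 1))" by simp
      also have "\<dots> \<le> real ?w * ln 2 + (1 - ln (ball_prob d \<rho> x))"
        using expected_ln_position_le[OF fmix, of ?P en "?K ^ n" ?M] q qpos N M by simp
      finally show ?thesis by simp
    qed
    have "(\<integral>c. rate_redundancy n d c p \<rho> \<partial>(distr (measure_pmf D) (code_space n d) T))
      = measure_pmf.expectation ?R (\<lambda>ys. 1 / n * (\<Sum>x\<in>words n. pmf (replicate_pmf n p) x * ?len ys x) - rate_distortion p d \<rho>)"
      unfolding random_list_code(3)[OF fD T \<rho>] by (simp add: D_def rate_redundancy_eq)
    also have "\<dots> = 1 / n * (\<Sum>x\<in>words n. pmf (replicate_pmf n p) x * measure_pmf.expectation ?R (\<lambda>ys. ?len ys x)) - rate_distortion p d \<rho>"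
      by simp
    also have "\<dots> \<le> 1 / n * (\<Sum>x\<in>words n. pmf (replicate_pmf n p) x * (real ?w * ln 2 + 1 - ln (ball_prob d \<rho> x))) - rate_distortion p d \<rho>"
      by (intro diff_right_mono mult_left_mono sum_mono key) auto
    also have "(\<Sum>x\<in>words n. pmf (replicate_pmf n p) x * (real ?w * ln 2 + 1 - ln (ball_prob d \<rho> x)))
      = measure_pmf.expectation (replicate_pmf n p) (\<lambda>x. real ?w * ln 2 + 1 + - ln (ball_prob d \<rho> x))"
      by (subst integral_measure_pmf_real[OF finite_words[of n]])
        (auto simp: set_replicate_pmf words_def mult.commute)
    also have "\<dots> = real ?w * ln 2 + 1 + measure_pmf.expectation (replicate_pmf n p) (\<lambda>x. - ln (ball_prob d \<rho> x))"
      by (subst Bochner_Integration.integral_add) (auto intro: integrable_measure_pmf_finite[OF finite_set_replicate_pmf])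
    finally show "(\<integral>c. rate_redundancy n d c p \<rho> \<partial>(distr (measure_pmf D) (code_space n d) T)) \<le>
      1 / n * (real ?w * ln 2 + 1 + measure_pmf.expectation (replicate_pmf n p) (\<lambda>x. - ln (ball_prob d \<rho> x)))
      - rate_distortion p d \<rho>" .
  qed
qed

section \<open>Stability of tilted quantities\<close>

lemma partition_sum_ge:
  assumes "\<And>k. 1 / a \<le> exp (u k)" shows "1 / a \<le> partition_sum Q u"
proof -
  have "(\<Sum>k\<in>UNIV. pmf Q k * (1 / a)) \<le> partition_sum Q u"
    unfolding partition_sum_def by (intro sum_mono mult_left_mono assms) auto
  then show ?thesis by (simp add: sum_distrib_right[symmetric] sum_pmf_eq_1 del: times_divide_eq_right)
qed

lemma abs_weighted_sum_diff_le:
  fixes Q Q' :: "'b::finite pmf"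
  assumes "\<And>k. \<bar>g k\<bar> \<le> r"
  shows "\<bar>(\<Sum>k\<in>UNIV. pmf Q k * g k) - (\<Sum>k\<in>UNIV. pmf Q' k * g k)\<bar> \<le> r * (\<Sum>k\<in>UNIV. \<bar>pmf Q k - pmf Q' k\<bar>)"
proof -
  have "\<bar>(\<Sum>k\<in>UNIV. pmf Q k * g k) - (\<Sum>k\<in>UNIV. pmf Q' k * g k)\<bar> = \<bar>\<Sum>k\<in>UNIV. (pmf Q k - pmf Q' k) * g k\<bar>"
    by (simp add: sum_subtractf left_diff_distrib)
  also have "\<dots> \<le> (\<Sum>k\<in>UNIV. r * \<bar>pmf Q k - pmf Q' k\<bar>)"
    by (rule order_trans[OF sum_abs sum_mono]) (use assms in \<open>auto simp: abs_mult mult.commute intro: mult_right_mono\<close>)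
  finally show ?thesis by (simp add: sum_distrib_left)
qed

text \<open>The gradient of the left-hand side at the optimal output distribution is constant in \<open>k\<close>, and so orthogonal
  to the difference of two distributions: the error is of second order.\<close>

lemma log_partition_sum_second_order:
  fixes Q Q0 :: "'b::finite pmf" and p c :: "'a::finite \<Rightarrow> real"
  assumes p: "\<And>j. 0 \<le> p j" "(\<Sum>j\<in>UNIV. p j) = 1"
    and u: "\<And>j k. u j k \<le> 0" "\<And>j k. 1 / a \<le> exp (u j k)" and a: "0 < a"
    and Z0: "\<And>j. partition_sum Q0 (u j) = exp (- c j)"
    and kkt: "\<And>k. (\<Sum>j\<in>UNIV. p j * exp (c j + u j k)) = 1"
  shows "(\<Sum>j\<in>UNIV. p j * - ln (partition_sum Q (u j))) \<le>
    (\<Sum>j\<in>UNIV. p j * c j) + a * (\<Sum>j\<in>UNIV. p j * exp (2 * c j)) * (\<Sum>k\<in>UNIV. \<bar>pmf Q k - pmf Q0 k\<bar>)\<^sup>2"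
proof -
  define e where "e = (\<Sum>k\<in>UNIV. \<bar>pmf Q k - pmf Q0 k\<bar>)"
  define z where "z j = partition_sum Q (u j) * exp (c j)" for j
  have Zp: "0 < partition_sum Q (u j)" for j by (rule partition_sum_pos)
  have c0: "0 \<le> c j" for j
    using partition_sum_le_1[of "u j" Q0] u(1) by (simp add: Z0)
  have zp: "0 < z j" for j using Zp by (simp add: z_def)
  have za: "1 / a \<le> z j" for j
  proof -
    have "1 / a * 1 \<le> z j" unfolding z_def
      by (intro mult_mono partition_sum_ge u) (use c0 Zp a in \<open>auto simp: less_imp_le\<close>)
    then show ?thesis by simp
  qed
  have dz: "\<bar>1 - z j\<bar> \<le> exp (c j) * e" for j
  proof -
    have "1 - z j = exp (c j) * (partition_sum Q0 (u j) - partition_sum Q (u j))"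
      by (simp add: z_def Z0 right_diff_distrib exp_minus mult.commute)
    then have "\<bar>1 - z j\<bar> = exp (c j) * \<bar>partition_sum Q (u j) - partition_sum Q0 (u j)\<bar>"
      by (simp add: abs_mult abs_minus_commute)
    also have "\<dots> \<le> exp (c j) * (1 * e)" unfolding partition_sum_def e_def
      by (intro mult_left_mono abs_weighted_sum_diff_le) (use u(1) in auto)
    finally show ?thesis by simp
  qed
  have pt: "- ln (partition_sum Q (u j)) \<le> c j + (1 - z j) + a * exp (2 * c j) * e\<^sup>2" for j
  proof -
    have "- ln (partition_sum Q (u j)) = c j + ln (1 / z j)" using Zp[of j] by (simp add: z_def ln_mult ln_div)
    also have "ln (1 / z j) \<le> 1 / z j - 1" using zp[of j] by (intro ln_le_minus_one) auto
    \<comment> \<open>Isolates the first-order part \<open>1 - z j\<close>, which cancels on average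
      over \<open>j\<close>; the rest is quadratic.\<close>
    also have "1 / z j - 1 = (1 - z j) + (1 - z j)\<^sup>2 * (1 / z j)" using zp[of j] by (simp add: field_simps power2_eq_square)
    also have "(1 - z j)\<^sup>2 * (1 / z j) \<le> (exp (c j) * e)\<^sup>2 * a"
    proof (intro mult_mono)
      show "(1 - z j)\<^sup>2 \<le> (exp (c j) * e)\<^sup>2" using dz[of j] by (metis abs_ge_zero power2_abs power_mono)
      show "1 / z j \<le> a" using za[of j] zp[of j] a by (simp add: field_simps)
    qed (use zp[of j] in auto)
    also have "(exp (c j) * e)\<^sup>2 * a = a * exp (2 * c j) * e\<^sup>2"
      by (simp add: power_mult_distrib exp_double)
    finally show ?thesis by simp
  qed
  have "(\<Sum>j\<in>UNIV. p j * z j) = (\<Sum>k\<in>UNIV. pmf Q k * (\<Sum>j\<in>UNIV. p j * exp (c j + u j k)))"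
    unfolding z_def partition_sum_def sum_distrib_left sum_distrib_right
    by (subst sum.swap) (simp add: exp_add algebra_simps)
  \<comment> \<open>The stationarity condition \<open>kkt\<close> makes the average of
    \<open>z\<close> exactly 1, whatever \<open>Q\<close> is.\<close>
  then have pz: "(\<Sum>j\<in>UNIV. p j * z j) = 1" by (simp add: kkt sum_pmf_eq_1)
  have "(\<Sum>j\<in>UNIV. p j * - ln (partition_sum Q (u j))) \<le> (\<Sum>j\<in>UNIV. p j * (c j + (1 - z j) + a * exp (2 * c j) * e\<^sup>2))"
    by (intro sum_mono mult_left_mono pt p)
  also have "\<dots> = (\<Sum>j\<in>UNIV. p j * c j) + ((\<Sum>j\<in>UNIV. p j) - (\<Sum>j\<in>UNIV. p j * z j)) + a * (\<Sum>j\<in>UNIV. p j * exp (2 * c j)) * e\<^sup>2"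
    by (simp add: sum.distrib sum_subtractf sum_distrib_left sum_distrib_right algebra_simps)
  finally show ?thesis by (simp add: p pz e_def)
qed

text \<open>The mean is a quotient of two functions linear in the distribution; its value is at most
  \<open>r\<close>, and its denominator is at least \<open>1 / a\<close>.\<close>

lemma tilt_mean_lipschitz:
  fixes Q Q0 :: "'b::finite pmf"
  assumes u: "\<And>k. u k \<le> 0" "\<And>k. 1 / a \<le> exp (u k)" and a: "0 < a"
    and f: "\<And>k. 0 \<le> f k" "\<And>k. f k \<le> r"
  shows "\<bar>(\<Sum>k\<in>UNIV. pmf (tilt Q u) k * f k) - (\<Sum>k\<in>UNIV. pmf (tilt Q0 u) k * f k)\<bar>
    \<le> 2 * a * r * (\<Sum>k\<in>UNIV. \<bar>pmf Q k - pmf Q0 k\<bar>)"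
proof -
  define e where "e = (\<Sum>k\<in>UNIV. \<bar>pmf Q k - pmf Q0 k\<bar>)"
  define N where "N P = (\<Sum>k\<in>UNIV. pmf P k * (exp (u k) * f k))" for P :: "'b pmf"
  let ?Z = "\<lambda>P. partition_sum P u"
  have mean: "(\<Sum>k\<in>UNIV. pmf (tilt P u) k * f k) = N P / ?Z P" for P
    by (simp add: pmf_tilt N_def sum_divide_distrib mult.assoc)
  have r: "0 \<le> r" using f[of undefined] by linarith
  have e0: "0 \<le> e" unfolding e_def by (intro sum_nonneg) auto
  have Zp: "0 < ?Z P" for P by (rule partition_sum_pos)
  have dN: "\<bar>N Q - N Q0\<bar> \<le> r * e" unfolding N_def e_def
  proof (rule abs_weighted_sum_diff_le)
    fix k have "exp (u k) * f k \<le> 1 * r" using u(1) f r by (intro mult_mono) auto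
    then show "\<bar>exp (u k) * f k\<bar> \<le> r" using f(1)[of k] by simp
  qed
  have dZ: "\<bar>?Z Q0 - ?Z Q\<bar> \<le> e"
    using abs_weighted_sum_diff_le[of "\<lambda>k. exp (u k)" 1 Q Q0] u(1) by (simp add: partition_sum_def e_def abs_minus_commute)
  have N0: "0 \<le> N Q0 / ?Z Q0" "N Q0 / ?Z Q0 \<le> r"
  proof -
    show "0 \<le> N Q0 / ?Z Q0" unfolding mean[symmetric] using f by (intro sum_nonneg mult_nonneg_nonneg) auto
    have "N Q0 / ?Z Q0 \<le> (\<Sum>k\<in>UNIV. pmf (tilt Q0 u) k * r)" unfolding mean[symmetric] using f by (intro sum_mono mult_left_mono) auto
    then show "N Q0 / ?Z Q0 \<le> r" by (simp add: sum_distrib_right[symmetric] sum_pmf_eq_1)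
  qed
  have "N Q / ?Z Q - N Q0 / ?Z Q0 = ((N Q - N Q0) + N Q0 / ?Z Q0 * (?Z Q0 - ?Z Q)) * (1 / ?Z Q)"
    using Zp[of Q] Zp[of Q0] by (simp add: field_simps)
  then have "\<bar>N Q / ?Z Q - N Q0 / ?Z Q0\<bar> = \<bar>(N Q - N Q0) + N Q0 / ?Z Q0 * (?Z Q0 - ?Z Q)\<bar> * (1 / ?Z Q)"
    using Zp[of Q] by (simp add: abs_mult)
  also have "\<dots> \<le> (r * e + r * e) * a"
  proof (intro mult_mono)
    have "\<bar>N Q0 / ?Z Q0 * (?Z Q0 - ?Z Q)\<bar> \<le> r * e"
      unfolding abs_mult using N0 dZ r by (intro mult_mono) auto
    then show "\<bar>(N Q - N Q0) + N Q0 / ?Z Q0 * (?Z Q0 - ?Z Q)\<bar> \<le> r * e + r * e"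
      using dN by (intro order_trans[OF abs_triangle_ineq] add_mono)
    have "1 / a \<le> ?Z Q" by (rule partition_sum_ge[OF u(2)])
    then show "1 / ?Z Q \<le> a" using Zp[of Q] a by (simp add: field_simps)
  qed (use r e0 Zp[of Q] in auto)
  finally show ?thesis unfolding mean e_def by (simp add: algebra_simps)
qed

section \<open>The expected redundancy\<close>

lemma regular_pair_bounds:
  assumes "(p, \<rho>) \<in> regular_pairs rho_max d"
  shows "\<rho> \<in> distortions" "0 \<le> \<rho> j k" "\<rho> j k \<le> rho_max" "0 < pmf p j" "0 < d"
  using assms by (auto simp: regular_pairs_def bounded_distortions_def distortions_def)

text \<open>The quadratic terms also absorb the atypical source words, for which only the bound
  \<open>ball_prob_ge\<close> is available.\<close>

lemma neg_ln_ball_prob_le: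
  fixes \<rho> :: "('a, 'b::finite) distortion" and d lam rmax q0 \<theta> :: real
  assumes lam: "0 \<le> lam" and rho: "\<And>j k. 0 \<le> \<rho> j k" "\<And>j k. \<rho> j k \<le> rmax" "\<And>j. \<exists>k. \<rho> j k = 0"
    and jk: "\<rho> j0 k1 < \<rho> j0 k2" and q0: "0 < q0" and \<theta>: "0 < \<theta>" and d: "0 \<le> d"
  obtains C :: real and n0 :: nat where "0 \<le> C"
    "\<And>Q x (\<mu> :: 'a \<Rightarrow> real). Q \<in> grid (grid_size TYPE('b) (length x)) \<Longrightarrow> (\<And>k. q0 \<le> pmf Q k) \<Longrightarrow>
      (\<And>j. \<mu> j = (\<Sum>k\<in>UNIV. pmf (tilt Q (\<lambda>k. - lam * \<rho> j k)) k * \<rho> j k)) \<Longrightarrow>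
      n0 \<le> length x \<Longrightarrow>
      - ln (ball_prob d \<rho> x) \<le> ln (grid_card TYPE('b) (length x)) + ln (length x) / 2 +
        (\<Sum>j\<leftarrow>x. - ln (partition_sum Q (\<lambda>k. - lam * \<rho> j k))) - lam * d * length x +
        C * (1 + ((\<Sum>j\<leftarrow>x. \<mu> j) - d * length x)\<^sup>2 / length x
               + ((\<Sum>j\<leftarrow>x. of_bool (j = j0)) - 2 * \<theta> * length x)\<^sup>2 / length x)"
proof -
  obtain C1 \<eta> :: real and n1 :: nat where C1: "0 < C1" "0 < \<eta>"
    and main: "\<And>Q x (\<mu> :: 'a \<Rightarrow> real). (\<And>k. q0 \<le> pmf Q k) \<Longrightarrow>
      (\<And>j. \<mu> j = (\<Sum>k\<in>UNIV. pmf (tilt Q (\<lambda>k. - lam * \<rho> j k)) k * \<rho> j k)) \<Longrightarrow>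
      n1 \<le> length x \<Longrightarrow> \<theta> * length x \<le> (\<Sum>j\<leftarrow>x. of_bool (j = j0) :: real) \<Longrightarrow>
      \<bar>(\<Sum>j\<leftarrow>x. \<mu> j) - d * length x\<bar> \<le> \<eta> * length x \<Longrightarrow>
      exp ((\<Sum>j\<leftarrow>x. ln (partition_sum Q (\<lambda>k. - lam * \<rho> j k))) + lam * d * length x
          - C1 * (1 + ((\<Sum>j\<leftarrow>x. \<mu> j) - d * length x)\<^sup>2 / length x)) / sqrt (length x)
        \<le> measure_pmf.prob (replicate_pmf (length x) Q) (distortion_ball d \<rho> x)"
    using distortion_ball_lower_bound[where \<rho>=\<rho> and d=d, OF lam rho(1,2) jk q0 \<theta>] by blast
  let ?K = "real CARD('b)"
  have K: "1 \<le> ?K" by (simp add: Suc_le_eq)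
  \<comment> \<open>Rate of the crude bound \<open>ball_prob_ge\<close>, plus the
    \<open>lam * d\<close> that the claim subtracts. An atypical word has a deviation of at least
    \<eta> n or \<theta> n, whose square over n is at least \<eta>^2 n or \<theta>^2 n; dividing
    \<open>H\<close> by these squares lets the quadratic terms cover \<open>H * n\<close>.\<close>
  define H where "H = ln ?K + lam * d"
  have H: "0 \<le> H" using K lam d by (simp add: H_def)
  define C where "C = C1 + H / \<eta>\<^sup>2 + H / \<theta>\<^sup>2"
  have C: "0 \<le> C" "C1 \<le> C" "H / \<eta>\<^sup>2 \<le> C" "H / \<theta>\<^sup>2 \<le> C" using C1 H by (auto simp: C_def)
  show ?thesis
  proof (rule that[OF C(1), of "max 1 n1"])
    fix Q :: "'b pmf" and x :: "'a list" and \<mu> :: "'a \<Rightarrow> real"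
    assume Q: "Q \<in> grid (grid_size TYPE('b) (length x))" "\<And>k. q0 \<le> pmf Q k"
      and mu: "\<And>j. \<mu> j = (\<Sum>k\<in>UNIV. pmf (tilt Q (\<lambda>k. - lam * \<rho> j k)) k * \<rho> j k)"
      and n0: "max 1 n1 \<le> length x"
    let ?n = "real (length x)" and ?G = "real (grid_card TYPE('b) (length x))"
    let ?D1 = "(\<Sum>j\<leftarrow>x. \<mu> j) - d * ?n" and ?D2 = "(\<Sum>j\<leftarrow>x. of_bool (j = j0)) - 2 * \<theta> * ?n"
    let ?S = "\<Sum>j\<leftarrow>x. - ln (partition_sum Q (\<lambda>k. - lam * \<rho> j k))"
    have n: "0 < length x" "x \<noteq> []" "1 \<le> ?n" "n1 \<le> length x" using n0 by auto
    have G: "0 < ?G" using grid_card_pos[OF n(1), where 'b='b] by simp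
    have S: "?S = - (\<Sum>j\<leftarrow>x. ln (partition_sum Q (\<lambda>k. - lam * \<rho> j k)))"
      by (simp add: uminus_sum_list_map o_def)
    show "- ln (ball_prob d \<rho> x) \<le> ln ?G + ln ?n / 2 + ?S - lam * d * ?n + C * (1 + ?D1\<^sup>2 / ?n + ?D2\<^sup>2 / ?n)"
    proof (cases "\<theta> * ?n \<le> (\<Sum>j\<leftarrow>x. of_bool (j = j0)) \<and> \<bar>?D1\<bar> \<le> \<eta> * ?n")
      case True
      let ?E = "- ?S + lam * d * ?n - C1 * (1 + ?D1\<^sup>2 / ?n)"
      have "exp ?E / sqrt ?n / ?G \<le> measure_pmf.prob (replicate_pmf (length x) Q) (distortion_ball d \<rho> x) / ?G"
        using main[OF Q(2) mu n(4)] True G unfolding S by (intro divide_right_mono) auto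
      also have "\<dots> \<le> ball_prob d \<rho> x" unfolding ball_prob_def by (rule word_mixture_ge[OF n(1) Q(1)])
      finally have le: "exp ?E / sqrt ?n / ?G \<le> ball_prob d \<rho> x" .
      have pos: "0 < exp ?E / sqrt ?n / ?G" using n G by simp
      have "ln (exp ?E / sqrt ?n / ?G) \<le> ln (ball_prob d \<rho> x)"
        using le pos by (subst ln_le_cancel_iff) auto
      also have "ln (exp ?E / sqrt ?n / ?G) = ?E - ln ?n / 2 - ln ?G" using n G by (simp add: ln_div ln_mult ln_sqrt)
      finally have "- ln (ball_prob d \<rho> x) \<le> ln ?G + ln ?n / 2 + ?S - lam * d * ?n + C1 * (1 + ?D1\<^sup>2 / ?n)" by linarith
      also have "C1 * (1 + ?D1\<^sup>2 / ?n) \<le> C * (1 + ?D1\<^sup>2 / ?n + ?D2\<^sup>2 / ?n)"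
        using C C1 by (intro mult_mono) auto
      finally show ?thesis by simp
    next
      case False
      have far: "y * ?n * t\<^sup>2 \<le> y * (D\<^sup>2 / ?n)" if "t * ?n \<le> \<bar>D\<bar>" "0 \<le> t" "0 \<le> y" for t y D
      proof -
        have "(t * ?n)\<^sup>2 \<le> \<bar>D\<bar>\<^sup>2" using that by (intro power_mono) auto
        then have "?n * t\<^sup>2 \<le> D\<^sup>2 / ?n" using n by (simp add: field_simps power2_eq_square)
        from mult_left_mono[OF this that(3)] show ?thesis by (simp add: mult.assoc)
      qed
      have HC: "H * ?n \<le> C * (?D1\<^sup>2 / ?n + ?D2\<^sup>2 / ?n)"
      proof (cases "\<bar>?D1\<bar> \<le> \<eta> * ?n")
        case True
        with False have "\<theta> * ?n \<le> \<bar>?D2\<bar>" by linarith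
        from far[OF this, of "H / \<theta>\<^sup>2"] have "H * ?n \<le> H / \<theta>\<^sup>2 * (?D2\<^sup>2 / ?n)" using \<theta> H by simp
        also have "\<dots> \<le> C * (?D1\<^sup>2 / ?n + ?D2\<^sup>2 / ?n)" using C H by (intro mult_mono) auto
        finally show ?thesis .
      next
        case False
        then have "\<eta> * ?n \<le> \<bar>?D1\<bar>" by linarith
        from far[OF this, of "H / \<eta>\<^sup>2"] have "H * ?n \<le> H / \<eta>\<^sup>2 * (?D1\<^sup>2 / ?n)" using C1 H by simp
        also have "\<dots> \<le> C * (?D1\<^sup>2 / ?n + ?D2\<^sup>2 / ?n)" using C H by (intro mult_mono) auto
        finally show ?thesis .
      qed
      have "1 / (?K ^ length x * ?G) \<le> ball_prob d \<rho> x" by (rule ball_prob_ge[OF rho(3) d n(2)])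
      moreover have "0 < 1 / (?K ^ length x * ?G)" using G by simp
      ultimately have "ln (1 / (?K ^ length x * ?G)) \<le> ln (ball_prob d \<rho> x)"
        by (subst ln_le_cancel_iff) linarith+
      then have "- ln (ball_prob d \<rho> x) \<le> ?n * ln ?K + ln ?G" using G K by (simp add: ln_div ln_mult ln_realpow)
      moreover have "?n * ln ?K = H * ?n - lam * d * ?n" by (simp add: H_def algebra_simps)
      moreover have "0 \<le> ?S"
      proof (rule sum_list_nonneg, clarsimp)
        fix j
        have "partition_sum Q (\<lambda>k. - lam * \<rho> j k) \<le> 1"
          using lam rho(1) by (intro partition_sum_le_1) simp
        then show "ln (partition_sum Q (\<lambda>k. - (lam * \<rho> j k))) \<le> 0"
          using partition_sum_pos[of Q "\<lambda>k. - lam * \<rho> j k"] by simp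
      qed
      moreover have "0 \<le> ln ?n / 2" using n by simp
      moreover have "C * (1 + ?D1\<^sup>2 / ?n + ?D2\<^sup>2 / ?n) = C + C * (?D1\<^sup>2 / ?n + ?D2\<^sup>2 / ?n)" by (simp add: ring_distribs)
      ultimately show ?thesis using HC C(1) by linarith
    qed
  qed
qed

text \<open>The grid point depends on \<open>n\<close> but not on the source word, so the pointwise
  bound can be integrated. The variance of a letter sum is O(n), and the bias of the total
  distortion at the grid point is O(sqrt n); both leave O(1) after squaring and division by
  \<open>n\<close>.\<close>

lemma expected_neg_ln_ball_prob_le:
  fixes p :: "'a::finite pmf" and \<rho> :: "('a, 'b::finite) distortion"
  assumes reg: "(p, \<rho>) \<in> regular_pairs rho_max d"
  obtains C :: real and n0 :: nat where
    "\<And>n. n0 \<le> n \<Longrightarrow> measure_pmf.expectation (replicate_pmf n p) (\<lambda>x. - ln (ball_prob d \<rho> x))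
      \<le> n * rate_distortion p d \<rho> + real CARD('b) / 2 * ln n + C"
proof -
  note bounds = regular_pair_bounds[OF reg]
  obtain Q0 :: "'b pmf" and lam c j0 k1 k2 where Q0: "\<And>k. 0 < pmf Q0 k" and lam: "0 \<le> lam"
    and Z0: "\<And>j. (\<Sum>k\<in>UNIV. pmf Q0 k * exp (- lam * \<rho> j k)) = exp (- c j)"
    and kkt: "\<And>k. (\<Sum>j\<in>UNIV. pmf p j * exp (c j - lam * \<rho> j k)) = 1"
    and dist: "(\<Sum>j\<in>UNIV. pmf p j * (\<Sum>k\<in>UNIV. pmf Q0 k * exp (c j - lam * \<rho> j k) * \<rho> j k)) = d"
    and rate: "rate_distortion p d \<rho> = (\<Sum>j\<in>UNIV. pmf p j * c j) - lam * d"
    and jk: "\<rho> j0 k1 < \<rho> j0 k2"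
    by (rule regular_pair_tilting[OF reg]) blast
  let ?K = "real CARD('b)" and ?u = "\<lambda>j k. - lam * \<rho> j k"
  have K: "1 \<le> ?K" by (simp add: Suc_le_eq)
  have rmax: "0 \<le> rho_max" using bounds(2,3)[of j0 k1] by linarith
  define a where "a = exp (lam * rho_max)"
  have a: "0 < a" by (simp add: a_def)
  have u0: "?u j k \<le> 0" and ua: "1 / a \<le> exp (?u j k)" for j k
    using lam bounds(2)[of j k] bounds(3)[of j k] by (auto simp: a_def exp_minus[symmetric] inverse_eq_divide[symmetric] mult_left_mono)
  \<comment> \<open>Half the least optimal probability: a grid point within 1/sqrt n \<le>
    \<open>q0\<close> of the optimum still has all probabilities at least \<open>q0\<close>. Hence
    the threshold with \<open>(1 / q0)\<^sup>2\<close> below.\<close>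
  define q0 where "q0 = (MIN k. pmf Q0 k) / 2"
  have q0: "0 < q0" unfolding q0_def by (simp add: Q0)
  have q0k: "2 * q0 \<le> pmf Q0 k" for k unfolding q0_def by simp
  \<comment> \<open>Half the probability of \<open>j0\<close>: the deviation from
    \<open>2 * \<theta> * n\<close> then has mean 0, and a frequency below \<theta> is a deviation
    of order n.\<close>
  define \<theta> where "\<theta> = pmf p j0 / 2"
  have \<theta>: "0 < \<theta>" using bounds(4) by (simp add: \<theta>_def)
  obtain C n1 where C: "0 \<le> C" and point: "\<And>Q x (\<mu> :: 'a \<Rightarrow> real). Q \<in> grid (grid_size TYPE('b) (length x)) \<Longrightarrow> (\<And>k. q0 \<le> pmf Q k) \<Longrightarrow>
      (\<And>j. \<mu> j = (\<Sum>k\<in>UNIV. pmf (tilt Q (?u j)) k * \<rho> j k)) \<Longrightarrow>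
      n1 \<le> length x \<Longrightarrow>
      - ln (ball_prob d \<rho> x) \<le> ln (grid_card TYPE('b) (length x)) + ln (length x) / 2 +
        (\<Sum>j\<leftarrow>x. - ln (partition_sum Q (?u j))) - lam * d * length x +
        C * (1 + ((\<Sum>j\<leftarrow>x. \<mu> j) - d * length x)\<^sup>2 / length x
               + ((\<Sum>j\<leftarrow>x. of_bool (j = j0)) - 2 * \<theta> * length x)\<^sup>2 / length x)"
    by (rule neg_ln_ball_prob_le[where \<rho>=\<rho>, OF lam bounds(2,3) distortions_zero[OF bounds(1)] jk q0 \<theta> less_imp_le[OF bounds(5)]])
      blast
  define E where "E = a * (\<Sum>j\<in>UNIV. pmf p j * exp (2 * c j)) * ?K\<^sup>2"
  define F where "F = 2 * a * rho_max * ?K"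
  show ?thesis
  proof (rule that[of "max 1 (max n1 (nat \<lceil>(1 / q0)\<^sup>2\<rceil>))" "(?K - 1) * ln (2 * ?K + 1) + E + C * (2 + rho_max\<^sup>2 + F\<^sup>2)"])
    fix n assume "max 1 (max n1 (nat \<lceil>(1 / q0)\<^sup>2\<rceil>)) \<le> n"
    then have n: "1 \<le> n" "n1 \<le> n" "nat \<lceil>(1 / q0)\<^sup>2\<rceil> \<le> n" by auto
    then have n': "0 < real n" "(1 / q0)\<^sup>2 \<le> real n" by linarith+
    have sq: "1 / sqrt n \<le> q0"
    proof -
      have "1 / q0 \<le> sqrt n" using n'(2) by (rule real_le_rsqrt)
      then show ?thesis using q0 n'(1) by (simp add: field_simps)
    qed
    obtain Q where Q: "Q \<in> grid (grid_size TYPE('b) n)" "\<And>k. \<bar>pmf Q k - pmf Q0 k\<bar> \<le> CARD('b) / grid_size TYPE('b) n"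
      using grid_approximation[OF grid_size_pos[of n, where 'b='b]] n by auto
    have Qd: "\<bar>pmf Q k - pmf Q0 k\<bar> \<le> 1 / sqrt n" for k
    proof -
      have "sqrt n \<le> real (nat \<lceil>sqrt n\<rceil>)" by linarith
      then have "CARD('b) / real (grid_size TYPE('b) n) \<le> 1 / sqrt n"
        using K n' by (simp add: grid_size_def field_simps)
      with Q(2)[of k] show ?thesis by linarith
    qed
    have Qq: "q0 \<le> pmf Q k" for k using Qd[of k] q0k[of k] sq by linarith
    define e where "e = (\<Sum>k\<in>UNIV. \<bar>pmf Q k - pmf Q0 k\<bar>)"
    have e: "0 \<le> e" "e \<le> ?K / sqrt n"
    proof -
      show "0 \<le> e" unfolding e_def by (intro sum_nonneg) auto
      have "e \<le> (\<Sum>k\<in>(UNIV :: 'b set). 1 / sqrt n)" unfolding e_def by (intro sum_mono Qd)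
      then show "e \<le> ?K / sqrt n" by simp
    qed
    define \<mu> where "\<mu> j = (\<Sum>k\<in>UNIV. pmf (tilt Q (?u j)) k * \<rho> j k)" for j
    define m where "m = (\<Sum>j\<in>UNIV. pmf p j * \<mu> j)"
    define z where "z j = - ln (partition_sum Q (?u j))" for j
    have mur: "0 \<le> \<mu> j" "\<mu> j \<le> rho_max" for j
    proof -
      show "0 \<le> \<mu> j" unfolding \<mu>_def using bounds(2) by (intro sum_nonneg mult_nonneg_nonneg) auto
      have "\<mu> j \<le> (\<Sum>k\<in>UNIV. pmf (tilt Q (?u j)) k * rho_max)" unfolding \<mu>_def using bounds(3) by (intro sum_mono mult_left_mono) auto
      then show "\<mu> j \<le> rho_max" by (simp add: sum_distrib_right[symmetric] sum_pmf_eq_1)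
    qed
    have wavg: "0 \<le> (\<Sum>j\<in>UNIV. pmf p j * f j)" "(\<Sum>j\<in>UNIV. pmf p j * f j) \<le> r"
      if "\<And>j. 0 \<le> f j" "\<And>j. f j \<le> r" for f :: "'a \<Rightarrow> real" and r
    proof -
      show "0 \<le> (\<Sum>j\<in>UNIV. pmf p j * f j)" using that by (intro sum_nonneg mult_nonneg_nonneg) auto
      have "(\<Sum>j\<in>UNIV. pmf p j * f j) \<le> (\<Sum>j\<in>UNIV. pmf p j * r)" using that by (intro sum_mono mult_left_mono) auto
      then show "(\<Sum>j\<in>UNIV. pmf p j * f j) \<le> r" by (simp add: sum_distrib_right[symmetric] sum_pmf_eq_1)
    qed
    have md: "\<bar>m - d\<bar> \<le> F / sqrt n"
    proof -
      have Z0': "partition_sum Q0 (?u j) = exp (- c j)" for j using Z0 by (simp add: partition_sum_def)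
      have "(\<Sum>j\<in>UNIV. pmf p j * (\<Sum>k\<in>UNIV. pmf (tilt Q0 (?u j)) k * \<rho> j k)) = d"
        unfolding dist[symmetric] pmf_tilt Z0' by (simp add: exp_diff exp_minus field_simps)
      then have "m - d = (\<Sum>j\<in>UNIV. pmf p j * (\<mu> j - (\<Sum>k\<in>UNIV. pmf (tilt Q0 (?u j)) k * \<rho> j k)))"
        by (simp add: m_def sum_subtractf right_diff_distrib)
      then have "\<bar>m - d\<bar> \<le> (\<Sum>j\<in>UNIV. pmf p j * \<bar>\<mu> j - (\<Sum>k\<in>UNIV. pmf (tilt Q0 (?u j)) k * \<rho> j k)\<bar>)"
        by (simp add: order_trans[OF sum_abs] abs_mult)
      also have "\<dots> \<le> 2 * a * rho_max * e"
        unfolding \<mu>_def e_def by (intro wavg(2) tilt_mean_lipschitz[OF u0 ua a bounds(2,3)] abs_ge_zero)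
      also have "\<dots> \<le> 2 * a * rho_max * (?K / sqrt n)" using a rmax e by (intro mult_left_mono) auto
      finally show ?thesis by (simp add: F_def)
    qed
    have so: "(\<Sum>j\<in>UNIV. pmf p j * z j) \<le> (\<Sum>j\<in>UNIV. pmf p j * c j) + E / n"
    proof -
      have "(\<Sum>j\<in>UNIV. pmf p j * z j) \<le> (\<Sum>j\<in>UNIV. pmf p j * c j) + a * (\<Sum>j\<in>UNIV. pmf p j * exp (2 * c j)) * e\<^sup>2"
        unfolding z_def e_def
        by (rule log_partition_sum_second_order[OF _ _ u0 ua a])
          (use Z0 kkt in \<open>auto simp: partition_sum_def sum_pmf_eq_1\<close>)
      also have "a * (\<Sum>j\<in>UNIV. pmf p j * exp (2 * c j)) * e\<^sup>2 \<le> a * (\<Sum>j\<in>UNIV. pmf p j * exp (2 * c j)) * (?K / sqrt n)\<^sup>2"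
        using a e by (intro mult_left_mono power_mono mult_nonneg_nonneg sum_nonneg) auto
      also have "\<dots> = E / n" using n' by (simp add: E_def power_divide)
      finally show ?thesis by simp
    qed
    let ?X = "replicate_pmf n p"
    note [simp] = integrable_measure_pmf_finite[OF finite_set_replicate_pmf]
    let ?A = "ln (grid_card TYPE('b) n) + ln n / 2 - lam * d * n"
    let ?D1 = "\<lambda>x. ((\<Sum>j\<leftarrow>x. \<mu> j) - d * n)\<^sup>2" and ?D2 = "\<lambda>x. ((\<Sum>j\<leftarrow>x. of_bool (j = j0)) - 2 * \<theta> * n)\<^sup>2"
    have "measure_pmf.expectation ?X (\<lambda>x. - ln (ball_prob d \<rho> x)) \<le>
      measure_pmf.expectation ?X (\<lambda>x. ?A + (\<Sum>j\<leftarrow>x. z j) + C * (1 + ?D1 x / n + ?D2 x / n))"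
    proof (rule integral_mono_AE)
      show "AE x in ?X. - ln (ball_prob d \<rho> x) \<le> ?A + (\<Sum>j\<leftarrow>x. z j) + C * (1 + ?D1 x / n + ?D2 x / n)"
      proof (rule AE_pmfI)
        fix x assume "x \<in> set_pmf ?X"
        then have "length x = n" by (simp add: set_replicate_pmf)
        then show "- ln (ball_prob d \<rho> x) \<le> ?A + (\<Sum>j\<leftarrow>x. z j) + C * (1 + ?D1 x / n + ?D2 x / n)"
          using point[of Q x \<mu>] Q(1) Qq n(2) \<mu>_def by (simp add: z_def)
      qed
    qed auto
    also have "\<dots> = ?A + measure_pmf.expectation ?X (\<lambda>x. \<Sum>j\<leftarrow>x. z j)
      + C * (1 + measure_pmf.expectation ?X ?D1 / n + measure_pmf.expectation ?X ?D2 / n)" by simp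
    also have "measure_pmf.expectation ?X (\<lambda>x. \<Sum>j\<leftarrow>x. z j) = n * (\<Sum>j\<in>UNIV. pmf p j * z j)"
      by (rule expectation_sum_replicate_pmf)
    also have "\<dots> \<le> n * ((\<Sum>j\<in>UNIV. pmf p j * c j) + E / n)" using so by (intro mult_left_mono) auto
    also have "\<dots> = n * (\<Sum>j\<in>UNIV. pmf p j * c j) + E" using n' by (simp add: ring_distribs)
    also have "measure_pmf.expectation ?X ?D1 / n \<le> (rho_max\<^sup>2 * n + (n * m - d * n)\<^sup>2) / n"
      unfolding m_def
    proof (intro divide_right_mono second_moment_replicate_pmf)
      fix j show "\<bar>\<mu> j - (\<Sum>j\<in>UNIV. pmf p j * \<mu> j)\<bar> \<le> rho_max"
        using wavg[of \<mu> rho_max, OF mur] mur[of j] by linarith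
    qed simp
    also have "\<dots> \<le> rho_max\<^sup>2 + F\<^sup>2"
    proof -
      have "(n * m - d * n)\<^sup>2 = n\<^sup>2 * \<bar>m - d\<bar>\<^sup>2" by (simp add: power2_eq_square algebra_simps)
      also have "\<dots> \<le> n\<^sup>2 * (F / sqrt n)\<^sup>2" using md by (intro mult_left_mono power_mono) auto
      also have "\<dots> = F\<^sup>2 * n" using n' by (simp add: power_divide power2_eq_square)
      finally show ?thesis using n' by (simp add: field_simps)
    qed
    also have "measure_pmf.expectation ?X ?D2 / n \<le> ((1::real)\<^sup>2 * n + (n * pmf p j0 - 2 * \<theta> * n)\<^sup>2) / n"
    proof (intro divide_right_mono)
      have s: "(\<Sum>j\<in>UNIV. pmf p j * of_bool (j = j0)) = pmf p j0" by (simp add: of_bool_def if_distrib cong: if_cong)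
      show "measure_pmf.expectation ?X ?D2 \<le> (1::real)\<^sup>2 * n + (n * pmf p j0 - 2 * \<theta> * n)\<^sup>2"
      proof (rule second_moment_replicate_pmf[of "\<lambda>j. of_bool (j = j0)" p 1 n "2 * \<theta> * n", unfolded s])
        fix j show "\<bar>of_bool (j = j0) - pmf p j0\<bar> \<le> 1"
          using pmf_le_1[of p j0] pmf_nonneg[of p j0] by (auto simp del: pmf_nonneg)
      qed
    qed simp
    also have "\<dots> = 1" using n' by (simp add: \<theta>_def)
    finally have fin: "measure_pmf.expectation ?X (\<lambda>x. - ln (ball_prob d \<rho> x)) \<le>
       ?A + (n * (\<Sum>j\<in>UNIV. pmf p j * c j) + E) + C * (1 + (rho_max\<^sup>2 + F\<^sup>2) + 1)"
      using C by (simp add: mult_left_mono)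
    have "?A \<le> (?K - 1) * (ln (2 * ?K + 1) + ln n / 2) + ln n / 2 - lam * d * n"
      using ln_grid_card_le[OF n(1), where 'b='b] by (simp add: add.commute)
    also have "\<dots> = (?K - 1) * ln (2 * ?K + 1) + ?K / 2 * ln n - lam * d * n" by (simp add: field_simps)
    finally show "measure_pmf.expectation ?X (\<lambda>x. - ln (ball_prob d \<rho> x)) \<le>
      n * rate_distortion p d \<rho> + ?K / 2 * ln n + ((?K - 1) * ln (2 * ?K + 1) + E + C * (2 + rho_max\<^sup>2 + F\<^sup>2))"
      using fin unfolding rate by (simp add: algebra_simps)
  qed
qed

theorem theorem3:
  fixes rho_max d :: real
  assumes "rho_max > 0" and "d > 0"
  shows "\<exists>C :: nat \<Rightarrow> ('a::finite, 'b::finite) code_triple measure.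
    (\<forall>n\<ge>1. random_semifaithful_code n d (C n)) \<and>
    (\<forall>(p, \<rho>) \<in> regular_pairs rho_max d.
       \<exists>\<epsilon> :: nat \<Rightarrow> real. \<epsilon> \<in> o(\<lambda>n. ln (real n) / real n) \<and>
         (\<forall>n\<ge>1. integrable (C n) (\<lambda>c. rate_redundancy n d c p \<rho>) \<and>
            (\<integral>c. rate_redundancy n d c p \<rho> \<partial>(C n))
              \<le> (real CARD('b) / 2 + 1) * (ln (real n) / real n) + \<epsilon> n))"
proof -
  let ?w = "\<lambda>n. real (width TYPE('b) n) * ln 2"
  let ?E = "\<lambda>n p \<rho>. measure_pmf.expectation (replicate_pmf n p) (\<lambda>x. - ln (ball_prob d \<rho> x))"
  let ?good = "\<lambda>n (C :: ('a, 'b) code_triple measure). random_semifaithful_code n d C \<and>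
    (\<forall>p. \<forall>\<rho>\<in>distortions. integrable C (\<lambda>c. rate_redundancy n d c p \<rho>) \<and>
      (\<integral>c. rate_redundancy n d c p \<rho> \<partial>C) \<le> 1 / n * (?w n + 1 + ?E n p \<rho>) - rate_distortion p d \<rho>)"
  have "\<exists>C. ?good n C" if n: "1 \<le> n" for n
  proof -
    obtain C :: "('a, 'b) code_triple measure" where "random_semifaithful_code n d C"
      "\<And>p \<rho>. \<rho> \<in> distortions \<Longrightarrow> integrable C (\<lambda>c. rate_redundancy n d c p \<rho>)"
      "\<And>p \<rho>. \<rho> \<in> distortions \<Longrightarrow> (\<integral>c. rate_redundancy n d c p \<rho> \<partial>C) \<le>
        1 / n * (?w n + 1 + ?E n p \<rho>) - rate_distortion p d \<rho>"
      by (rule random_code_rate[OF n less_imp_le[OF assms(2)]]) blast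
    then show ?thesis by blast
  qed
  \<comment> \<open>The codes are chosen before \<open>p\<close> and \<rho> are fixed; this order
    makes them universal.\<close>
  then have "\<forall>n. \<exists>C. 1 \<le> n \<longrightarrow> ?good n C" by blast
  then obtain C where "\<forall>n. 1 \<le> n \<longrightarrow> ?good n (C n)" by (rule choice[THEN exE])
  then have C: "?good n (C n)" if "1 \<le> n" for n using that by blast
  obtain c0 where c0: "\<And>n. 1 \<le> n \<Longrightarrow> ?w n \<le> ln n + c0" using width_le[where 'b='b] by blast
  have "\<exists>\<epsilon> :: nat \<Rightarrow> real. \<epsilon> \<in> o(\<lambda>n. ln (real n) / real n) \<and>
         (\<forall>n\<ge>1. integrable (C n) (\<lambda>c. rate_redundancy n d c p \<rho>) \<and>
            (\<integral>c. rate_redundancy n d c p \<rho> \<partial>(C n))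
              \<le> (real CARD('b) / 2 + 1) * (ln (real n) / real n) + \<epsilon> n)"
    if reg: "(p, \<rho>) \<in> regular_pairs rho_max d" for p \<rho>
  proof -
    have \<rho>: "\<rho> \<in> distortions" by (rule regular_pair_bounds(1)[OF reg])
    obtain c1 n0 where c1: "\<And>n. n0 \<le> n \<Longrightarrow> ?E n p \<rho> \<le> n * rate_distortion p d \<rho> + real CARD('b) / 2 * ln n + c1"
      by (rule expected_neg_ln_ball_prob_le[OF reg]) blast
    let ?I = "\<lambda>n. \<integral>c. rate_redundancy n d c p \<rho> \<partial>(C n)"
    let ?main = "\<lambda>n. (real CARD('b) / 2 + 1) * (ln (real n) / real n)"
    \<comment> \<open>The positive part of the excess makes the inequality hold for all
      \<open>n\<close>, including small ones; it remains to bound it by O(1/n) for large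
      \<open>n\<close>.\<close>
    define \<epsilon> where "\<epsilon> n = max 0 (?I n - ?main n)" for n
    define c where "c = \<bar>c0 + c1 + 1\<bar>"
    have le: "?I n - ?main n \<le> c / n" if n: "max 1 n0 \<le> n" for n
    proof -
      have n': "1 \<le> n" "n0 \<le> n" "0 < real n" using n by auto
      have "?I n \<le> 1 / n * (?w n + 1 + ?E n p \<rho>) - rate_distortion p d \<rho>" using C[OF n'(1)] \<rho> by blast
      also have "\<dots> \<le> 1 / n * ((ln n + c0) + 1 + (n * rate_distortion p d \<rho> + real CARD('b) / 2 * ln n + c1)) - rate_distortion p d \<rho>"
        using c0[OF n'(1)] c1[OF n'(2)] by (intro diff_right_mono mult_left_mono add_mono) auto
      also have "\<dots> = ?main n + (c0 + c1 + 1) / n" using n'(3) by (simp add: field_simps)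
      also have "(c0 + c1 + 1) / n \<le> c / n" by (intro divide_right_mono) (auto simp: c_def)
      finally show ?thesis by simp
    qed
    have "\<forall>\<^sub>F n in sequentially. norm (\<epsilon> n) \<le> norm (c / real n)"
      using eventually_ge_at_top[of "max 1 n0"]
    proof eventually_elim
      case (elim n)
      have "0 \<le> c" by (simp add: c_def)
      then show ?case using le[OF elim] by (simp add: \<epsilon>_def)
    qed
    then have "\<epsilon> \<in> O(\<lambda>n. c / real n)" by (rule landau_o.big_mono)
    also have "(\<lambda>n. c / real n) \<in> o(\<lambda>n. ln (real n) / real n)" by real_asymp
    finally have "\<epsilon> \<in> o(\<lambda>n. ln (real n) / real n)" .
    moreover have "?I n \<le> ?main n + \<epsilon> n" for n by (simp add: \<epsilon>_def)
    ultimately show ?thesis using C \<rho> by blast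
  qed
  then show ?thesis using C by (intro exI[of _ C]) blast
qed

end
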